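(* Let $H$ and $K$ be infinite discrete groups, let $\alpha: K\to\mathrm{Aut}(H)$ be an action, and let $\Gamma=H\rtimes_\alpha K$. Consider the following statements. (i) For each $k\in K\setminus\{e_K\}$, the only fixed point of $\alpha_k$ is $e_H$. (ii) $\Gamma$ is I.C.C. and, given finite subsets $F_1,F_2\subseteq H\setminus\{e_H\}$, there exists $k\in K$ such that $\alpha_k(F_1)\cap F_2=\emptyset$. (iii) $\Gamma$ is I.C.C. and, given a finite subset $F\subseteq H\setminus\{e_H\}$, there exists $k\in K$ such that $\alpha_k(F)\cap F=\emptyset$. (iv) $VN(\Gamma)$ is a type $\mathrm{II}_1$ factor and $VN(K)$ is a strongly singular von Neumann subalgebra of $VN(\Gamma)$. Then (i) $\Rightarrow$ (ii) $\Leftrightarrow$ (iii) $\Rightarrow$ (iv).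
   Context: $e_H,e_K$ are the identity elements of $H$, $K$. The semidirect product $\Gamma=H\rtimes_\alpha K$ is the set of formal products $\{hk: h\in H,\ k\in K\}$ with multiplication $(hk)(h'k')=(h\alpha_k(h'))(kk')$; $H$ and $K$ are viewed as subgroups of $\Gamma$. I.C.C. means infinite conjugacy class: every element other than the identity has an infinite conjugacy class. $VN(\Gamma)$ is the group von Neumann algebra generated by the left regular representation of $\Gamma$ on $\ell^2(\Gamma)$; for a subgroup $K\subseteq\Gamma$, $VN(K)$ is identified with the von Neumann subalgebra of $VN(\Gamma)$ generated by the elements of $K$. For a type $\mathrm{II}_1$ factor $\mathcal{M}$ with faithful normal tracial state $tr$, put $\|x\|_2=(tr(x^*x))^{1/2}$, and for a linear map $\phi:\mathcal{M}\to\mathcal{M}$ put $\|\phi\|_{\infty,2}=\sup\{\|\phi(x)\|_2:\|x\|\le1\}$. For a von Neumann subalgebra $\mathcal{N}\subseteq\mathcal{M}$, $\mathbb{E}_{\mathcal{N}}$ is the unique trace preserving conditional expectation onto $\mathcal{N}$. A von Neumann subalgebra $\mathcal{A}\subseteq\mathcal{M}$ is strongly singular if $\|\mathbb{E}_{\mathcal{A}}-\mathbb{E}_{u\mathcal{A}u^*}\|_{\infty,2}\ge\|(I-\mathbb{E}_{\mathcal{A}})(u)\|_2$ for all unitaries $u\in\mathcal{M}$. *)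

theory Defs
  imports
    "HOL-Analysis.Infinite_Sum"
    "HOL-Library.Function_Algebras"
    "HOL-Algebra.Bij"
begin

section \<open>Semidirect products and conjugacy classes\<close>

text \<open>The formal product \<open>hk\<close> is the pair \<open>(h, k)\<close>; an action is a homomorphism
  from \<open>K\<close> to the automorphism group of \<open>H\<close>.\<close>

definition semidirect_product ::
  "('h, 'm) monoid_scheme \<Rightarrow> ('k, 'n) monoid_scheme \<Rightarrow> ('k \<Rightarrow> 'h \<Rightarrow> 'h) \<Rightarrow> ('h \<times> 'k) monoid" where
  "semidirect_product H K \<alpha> =
     \<lparr>carrier = carrier H \<times> carrier K,
      mult = (\<lambda>(h, k) (h', k'). (h \<otimes>\<^bsub>H\<^esub> \<alpha> k h', k \<otimes>\<^bsub>K\<^esub> k')),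
      one = (\<one>\<^bsub>H\<^esub>, \<one>\<^bsub>K\<^esub>)\<rparr>"

definition conjugacy_class :: "('g, 'm) monoid_scheme \<Rightarrow> 'g \<Rightarrow> 'g set" where
  "conjugacy_class G x = (\<lambda>g. g \<otimes>\<^bsub>G\<^esub> x \<otimes>\<^bsub>G\<^esub> inv\<^bsub>G\<^esub> g) ` carrier G"

definition ICC :: "('g, 'm) monoid_scheme \<Rightarrow> bool" where
  "ICC G \<longleftrightarrow> (\<forall>x \<in> carrier G - {\<one>\<^bsub>G\<^esub>}. infinite (conjugacy_class G x))"


section \<open>Bounded operators on the Hilbert space of square summable functions\<close>

text \<open>Vectors of \<open>\<ell>\<^sup>2(S)\<close> are functions on the ambient type that vanish outside \<open>S\<close>, and
  operators on \<open>\<ell>\<^sup>2(S)\<close> are maps that vanish outside \<open>\<ell>\<^sup>2(S)\<close>.  With this convention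
  equality, sum and difference of vectors and operators are those of functions, and the product
  of operators is \<open>\<circ>\<close>.\<close>

definition l2 :: "'s set \<Rightarrow> ('s \<Rightarrow> complex) set" where
  "l2 S = {f. (\<forall>a. a \<notin> S \<longrightarrow> f a = 0) \<and> (\<lambda>a. (cmod (f a))\<^sup>2) summable_on S}"

definition l2_inner :: "('s \<Rightarrow> complex) \<Rightarrow> ('s \<Rightarrow> complex) \<Rightarrow> complex" where
  "l2_inner f g = (\<Sum>\<^sub>\<infinity>a. f a * cnj (g a))"

definition l2_norm :: "('s \<Rightarrow> complex) \<Rightarrow> real" where
  "l2_norm f = sqrt (\<Sum>\<^sub>\<infinity>a. (cmod (f a))\<^sup>2)"

type_synonym 's l2_op = "('s \<Rightarrow> complex) \<Rightarrow> ('s \<Rightarrow> complex)"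

definition vec_scale :: "complex \<Rightarrow> ('s \<Rightarrow> complex) \<Rightarrow> 's \<Rightarrow> complex" where
  "vec_scale c f = (\<lambda>a. c * f a)"

definition op_scale :: "complex \<Rightarrow> 's l2_op \<Rightarrow> 's l2_op" where
  "op_scale c x = (\<lambda>f. vec_scale c (x f))"

definition bounded_ops :: "'s set \<Rightarrow> 's l2_op set" where
  "bounded_ops S =
     {x. (\<forall>f. f \<notin> l2 S \<longrightarrow> x f = 0) \<and>
         (\<forall>f \<in> l2 S. x f \<in> l2 S) \<and>
         (\<forall>f \<in> l2 S. \<forall>g \<in> l2 S. x (f + g) = x f + x g) \<and>
         (\<forall>c. \<forall>f \<in> l2 S. x (vec_scale c f) = vec_scale c (x f)) \<and>
         (\<exists>C. \<forall>f \<in> l2 S. l2_norm (x f) \<le> C * l2_norm f)}"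

definition op_norm :: "'s set \<Rightarrow> 's l2_op \<Rightarrow> real" where
  "op_norm S x = (SUP f \<in> {f \<in> l2 S. l2_norm f \<le> 1}. l2_norm (x f))"

definition op_id :: "'s set \<Rightarrow> 's l2_op" where
  "op_id S = (\<lambda>f. if f \<in> l2 S then f else 0)"

definition op_adj :: "'s set \<Rightarrow> 's l2_op \<Rightarrow> 's l2_op" where
  "op_adj S x =
     (THE y. y \<in> bounded_ops S \<and>
             (\<forall>f \<in> l2 S. \<forall>g \<in> l2 S. l2_inner (x f) g = l2_inner f (y g)))"

text \<open>For complex numbers, \<open>0 \<le> z\<close> is the order of \<open>HOL-Library.Complex_Order\<close>: \<open>z\<close> is real and
  nonnegative.\<close>

definition op_positive :: "'s set \<Rightarrow> 's l2_op \<Rightarrow> bool" where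
  "op_positive S x \<longleftrightarrow> x \<in> bounded_ops S \<and> (\<forall>f \<in> l2 S. 0 \<le> l2_inner (x f) f)"

definition op_unitary :: "'s set \<Rightarrow> 's l2_op \<Rightarrow> bool" where
  "op_unitary S u \<longleftrightarrow> u \<in> bounded_ops S \<and>
     op_adj S u \<circ> u = op_id S \<and> u \<circ> op_adj S u = op_id S"

definition op_projection :: "'s set \<Rightarrow> 's l2_op \<Rightarrow> bool" where
  "op_projection S p \<longleftrightarrow> p \<in> bounded_ops S \<and> p \<circ> p = p \<and> op_adj S p = p"


section \<open>Von Neumann algebras\<close>

definition commutant :: "'s set \<Rightarrow> 's l2_op set \<Rightarrow> 's l2_op set" where
  "commutant S M = {y \<in> bounded_ops S. \<forall>x \<in> M. x \<circ> y = y \<circ> x}"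

definition von_neumann_algebra :: "'s set \<Rightarrow> 's l2_op set \<Rightarrow> bool" where
  "von_neumann_algebra S M \<longleftrightarrow> M \<subseteq> bounded_ops S \<and> (\<forall>x \<in> M. op_adj S x \<in> M) \<and>
     commutant S (commutant S M) = M"

definition vn_generated :: "'s set \<Rightarrow> 's l2_op set \<Rightarrow> 's l2_op set" where
  "vn_generated S X = \<Inter> {M. von_neumann_algebra S M \<and> X \<subseteq> M}"

definition vn_factor :: "'s set \<Rightarrow> 's l2_op set \<Rightarrow> bool" where
  "vn_factor S M \<longleftrightarrow> von_neumann_algebra S M \<and>
     M \<inter> commutant S M = range (\<lambda>c. op_scale c (op_id S))"

text \<open>The algebra is finite if its identity is a finite projection, i.e. not equivalent to a
  proper subprojection.\<close>

definition vn_finite :: "'s set \<Rightarrow> 's l2_op set \<Rightarrow> bool" where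
  "vn_finite S M \<longleftrightarrow>
     (\<forall>v \<in> M. op_adj S v \<circ> v = op_id S \<longrightarrow> v \<circ> op_adj S v = op_id S)"

text \<open>A projection \<open>p\<close> of \<open>M\<close> is abelian if the corner \<open>pMp\<close> is abelian.\<close>

definition abelian_projection :: "'s set \<Rightarrow> 's l2_op set \<Rightarrow> 's l2_op \<Rightarrow> bool" where
  "abelian_projection S M p \<longleftrightarrow> p \<in> M \<and> op_projection S p \<and>
     (\<forall>x \<in> M. \<forall>y \<in> M. (p \<circ> x \<circ> p) \<circ> (p \<circ> y \<circ> p) = (p \<circ> y \<circ> p) \<circ> (p \<circ> x \<circ> p))"

text \<open>Type II requires that there is no nonzero abelian projection and that every nonzero central
  projection majorizes a nonzero finite one; the latter is subsumed by finiteness, which is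
  what the subscript 1 adds.\<close>

definition type_II1_factor :: "'s set \<Rightarrow> 's l2_op set \<Rightarrow> bool" where
  "type_II1_factor S M \<longleftrightarrow> vn_factor S M \<and> vn_finite S M \<and>
     (\<forall>p. abelian_projection S M p \<longrightarrow> p = 0)"


section \<open>Traces and conditional expectations\<close>

text \<open>A functional is normal if it is \<open>\<sigma>\<close>-weakly (ultraweakly) continuous, that is, of the form
  \<open>x \<mapsto> \<Sum>n. \<langle>x \<xi>\<^sub>n, \<eta>\<^sub>n\<rangle>\<close> with square summable sequences of vectors.\<close>

definition normal_functional :: "'s set \<Rightarrow> 's l2_op set \<Rightarrow> ('s l2_op \<Rightarrow> complex) \<Rightarrow> bool" where
  "normal_functional S M \<phi> \<longleftrightarrow>
     (\<exists>\<xi> \<eta> :: nat \<Rightarrow> 's \<Rightarrow> complex. (\<forall>n. \<xi> n \<in> l2 S) \<and> (\<forall>n. \<eta> n \<in> l2 S) \<and>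
        summable (\<lambda>n. (l2_norm (\<xi> n))\<^sup>2) \<and> summable (\<lambda>n. (l2_norm (\<eta> n))\<^sup>2) \<and>
        (\<forall>x \<in> M. (\<lambda>n. l2_inner (x (\<xi> n)) (\<eta> n)) sums \<phi> x))"

definition faithful_normal_tracial_state ::
  "'s set \<Rightarrow> 's l2_op set \<Rightarrow> ('s l2_op \<Rightarrow> complex) \<Rightarrow> bool" where
  "faithful_normal_tracial_state S M \<tau> \<longleftrightarrow>
     (\<forall>x \<in> M. \<forall>y \<in> M. \<tau> (x + y) = \<tau> x + \<tau> y) \<and>
     (\<forall>c. \<forall>x \<in> M. \<tau> (op_scale c x) = c * \<tau> x) \<and>
     (\<forall>x \<in> M. 0 \<le> \<tau> (op_adj S x \<circ> x)) \<and>
     \<tau> (op_id S) = 1 \<and>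
     (\<forall>x \<in> M. \<tau> (op_adj S x \<circ> x) = 0 \<longrightarrow> x = 0) \<and>
     normal_functional S M \<tau> \<and>
     (\<forall>x \<in> M. \<forall>y \<in> M. \<tau> (x \<circ> y) = \<tau> (y \<circ> x))"

text \<open>The faithful normal tracial state of a type \<open>II\<^sub>1\<close> factor is unique.  Functionals on \<open>M\<close> and
  maps on \<open>M\<close> are taken in \<open>extensional M\<close> so that they are determined by their values on \<open>M\<close>.\<close>

definition vn_trace :: "'s set \<Rightarrow> 's l2_op set \<Rightarrow> 's l2_op \<Rightarrow> complex" where
  "vn_trace S M = (THE \<tau>. \<tau> \<in> extensional M \<and> faithful_normal_tracial_state S M \<tau>)"

definition trace_norm2 :: "'s set \<Rightarrow> 's l2_op set \<Rightarrow> 's l2_op \<Rightarrow> real" where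
  "trace_norm2 S M x = sqrt (Re (vn_trace S M (op_adj S x \<circ> x)))"

definition norm_inf_2 :: "'s set \<Rightarrow> 's l2_op set \<Rightarrow> ('s l2_op \<Rightarrow> 's l2_op) \<Rightarrow> ereal" where
  "norm_inf_2 S M \<phi> = (SUP x \<in> {x \<in> M. op_norm S x \<le> 1}. ereal (trace_norm2 S M (\<phi> x)))"

definition conditional_expectation ::
  "'s set \<Rightarrow> 's l2_op set \<Rightarrow> 's l2_op set \<Rightarrow> ('s l2_op \<Rightarrow> 's l2_op) \<Rightarrow> bool" where
  "conditional_expectation S M N E \<longleftrightarrow>
     (\<forall>x \<in> M. \<forall>y \<in> M. E (x + y) = E x + E y) \<and>
     (\<forall>c. \<forall>x \<in> M. E (op_scale c x) = op_scale c (E x)) \<and>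
     (\<forall>x \<in> M. E x \<in> N) \<and>
     (\<forall>y \<in> N. E y = y) \<and>
     (\<forall>x \<in> M. op_positive S x \<longrightarrow> op_positive S (E x)) \<and>
     (\<forall>x \<in> M. \<forall>a \<in> N. \<forall>b \<in> N. E (a \<circ> x \<circ> b) = a \<circ> E x \<circ> b)"

definition cond_exp :: "'s set \<Rightarrow> 's l2_op set \<Rightarrow> 's l2_op set \<Rightarrow> 's l2_op \<Rightarrow> 's l2_op" where
  "cond_exp S M N =
     (THE E. E \<in> extensional M \<and> conditional_expectation S M N E \<and>
             (\<forall>x \<in> M. vn_trace S M (E x) = vn_trace S M x))"

definition strongly_singular :: "'s set \<Rightarrow> 's l2_op set \<Rightarrow> 's l2_op set \<Rightarrow> bool" where
  "strongly_singular S M A \<longleftrightarrow> von_neumann_algebra S A \<and> A \<subseteq> M \<and>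
     (\<forall>u \<in> M. op_unitary S u \<longrightarrow>
        norm_inf_2 S M (cond_exp S M A - cond_exp S M ((\<lambda>x. u \<circ> x \<circ> op_adj S u) ` A))
          \<ge> ereal (trace_norm2 S M (u - cond_exp S M A u)))"


section \<open>Group von Neumann algebras\<close>

definition left_regular :: "('g, 'm) monoid_scheme \<Rightarrow> 'g \<Rightarrow> 'g l2_op" where
  "left_regular G g =
     (\<lambda>f. if f \<in> l2 (carrier G)
          then (\<lambda>s. if s \<in> carrier G then f (inv\<^bsub>G\<^esub> g \<otimes>\<^bsub>G\<^esub> s) else 0)
          else 0)"

text \<open>\<open>VN_sub G L\<close> is generated, on \<open>\<ell>\<^sup>2(G)\<close>, by the elements of a subgroup \<open>L\<close> of \<open>G\<close>.\<close>

definition VN_sub :: "('g, 'm) monoid_scheme \<Rightarrow> 'g set \<Rightarrow> 'g l2_op set" where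
  "VN_sub G L = vn_generated (carrier G) (left_regular G ` L)"

definition VN :: "('g, 'm) monoid_scheme \<Rightarrow> 'g l2_op set" where
  "VN G = VN_sub G (carrier G)"

end

theory Submission
  imports Defs "HOL-Analysis.Uniform_Limit" "HOL-Algebra.Coset"
begin

text \<open>
  If no \<open>\<alpha> k\<close> with \<open>k \<noteq> \<one>\<close> has a nontrivial fixed point, then different elements of \<open>K\<close> move a
  point \<open>h \<noteq> \<one>\<close> of \<open>H\<close> to different places.  Hence only finitely many \<open>k\<close> move a point of \<open>F1\<close> into
  \<open>F2\<close>, and conjugation by \<open>K\<close> already gives \<open>hk\<close> infinitely many conjugates; for \<open>h = \<one>\<close> the
  conjugates \<open>g \<alpha>\<^sub>k(g)\<^sup>-\<^sup>1 k\<close> with \<open>g\<close> in \<open>H\<close> are pairwise different.  This is (i) \<open>\<Longrightarrow>\<close> (ii), and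
  (iii) for the set \<open>F1 \<union> F2\<close> gives (ii) for the pair.  The rest is about (iii) \<open>\<Longrightarrow>\<close> (iv), for
  which three ideas carry the argument.

  First, an element \<open>x\<close> of the algebra generated by a subgroup \<open>L\<close> is left convolution by the function
  \<open>\<xi> = x \<delta>\<^sub>1\<close>, called its symbol here: \<open>VN(L)\<close> consists of the bounded operators with matrix
  \<open>(x \<delta>\<^sub>s)(t) = \<xi>(ts\<^sup>-\<^sup>1)\<close> whose symbol is supported in \<open>L\<close> (\<open>VN_sub_eq_conv_ops\<close>).  Everything in the
  statement can be read off the symbol: the trace is \<open>\<xi>(1)\<close>, the norm \<open>\<parallel>x\<parallel>\<^sub>2\<close> is the norm of \<open>\<xi>\<close> in
  \<open>\<ell>\<^sup>2\<close>, and the conditional expectation onto \<open>VN(L)\<close> restricts the symbol to \<open>L\<close>.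

  Second, the infinite conjugacy classes provide a filter on the group along which \<open>gsg\<^sup>-\<^sup>1\<close> leaves
  every point, for all \<open>s \<noteq> 1\<close> at once (\<open>ICC_filter\<close>).  The operator \<open>\<lambda>(g)\<^sup>* x \<lambda>(g)\<close> has the symbol
  \<open>t \<mapsto> \<xi>(gtg\<^sup>-\<^sup>1)\<close>, so it converges weakly to \<open>\<xi>(1)\<close> times the identity along that filter
  (\<open>conjugates_tendsto_tau\<close>).  Taking this limit shows that central elements are scalars, that a normal
  trace has no choice but \<open>\<xi>(1)\<close>, and that an abelian projection is zero.

  Third, (iii) provides a filter on \<open>K\<close> along which \<open>rks \<notin> K\<close> for all \<open>r\<close> and all \<open>s \<notin> K\<close>
  (\<open>separating_filter\<close>).  For \<open>A = VN(K)\<close>, a unitary \<open>u\<close> and \<open>v = \<lambda>(k)\<close> one has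
  \<open>E\<^sub>A(v) - E\<^sub>u\<^sub>A\<^sub>u\<^sub>*(v) = u (w - E\<^sub>A(w)) u\<^sup>*\<close> with \<open>w = u\<^sup>*vu\<close>, an element of \<open>2\<close>-norm squared
  \<open>1 - \<parallel>E\<^sub>A(w)\<parallel>\<^sub>2\<^sup>2\<close>.  Split the symbol of \<open>u\<close> into its parts on \<open>K\<close> and off \<open>K\<close>.  The first part
  contributes at most \<open>\<parallel>E\<^sub>A(u)\<parallel>\<^sub>2\<close> to \<open>\<parallel>E\<^sub>A(w)\<parallel>\<^sub>2\<close>, and the contribution of the second part tends to zero
  along the filter (\<open>cutoff_translates_tendsto_0\<close>).  In the limit the distance is at least
  \<open>(1 - \<parallel>E\<^sub>A(u)\<parallel>\<^sub>2\<^sup>2)\<^sup>1\<^sup>/\<^sup>2 = \<parallel>u - E\<^sub>A(u)\<parallel>\<^sub>2\<close>, which is strong singularity.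
\<close>

section \<open>Square summable functions\<close>

definition delta :: "'s \<Rightarrow> 's \<Rightarrow> complex" where
  "delta a = (\<lambda>b. if b = a then 1 else 0)"

definition cutoff :: "'s set \<Rightarrow> ('s \<Rightarrow> complex) \<Rightarrow> 's \<Rightarrow> complex" where
  "cutoff C f = (\<lambda>a. if a \<in> C then f a else 0)"

lemma cutoff_inside: "a \<in> C \<Longrightarrow> cutoff C f a = f a"
  by (simp add: cutoff_def)

lemma cutoff_outside: "a \<notin> C \<Longrightarrow> cutoff C f a = 0"
  by (simp add: cutoff_def)

lemma delta_apply: "delta a b = (if b = a then 1 else 0)"
  by (simp add: delta_def)

lemma l2_iff: "f \<in> l2 S \<longleftrightarrow> (\<forall>a. a \<notin> S \<longrightarrow> f a = 0) \<and> (\<lambda>a. (cmod (f a))\<^sup>2) summable_on UNIV"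
proof -
  have "(\<lambda>a. (cmod (f a))\<^sup>2) summable_on S \<longleftrightarrow> (\<lambda>a. (cmod (f a))\<^sup>2) summable_on UNIV"
    if "\<forall>a. a \<notin> S \<longrightarrow> f a = 0"
    by (rule summable_on_cong_neutral) (use that in auto)
  then show ?thesis by (auto simp: l2_def)
qed

lemma l2_outside: "f \<in> l2 S \<Longrightarrow> a \<notin> S \<Longrightarrow> f a = 0"
  by (simp add: l2_iff)

lemma l2_summable: "f \<in> l2 S \<Longrightarrow> (\<lambda>a. (cmod (f a))\<^sup>2) summable_on A"
  by (auto simp: l2_iff intro: summable_on_subset_banach)

lemma l2_dominated:
  assumes "f \<in> l2 S" "\<And>a. cmod (g a) \<le> cmod (f a)"
  shows "g \<in> l2 S"
proof -
  have "(\<lambda>a. (cmod (g a))\<^sup>2) summable_on UNIV"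
    by (rule summable_on_comparison_test[OF l2_summable[OF assms(1)]])
       (auto intro: power_mono assms)
  moreover have "g a = 0" if "a \<notin> S" for a
    using assms(2)[of a] l2_outside[OF assms(1) that] by simp
  ultimately show ?thesis by (auto simp: l2_iff)
qed

lemma zero_l2 [simp]: "0 \<in> l2 S"
  by (simp add: l2_iff)

lemma delta_l2 [simp]: "a \<in> S \<Longrightarrow> delta a \<in> l2 S"
  by (auto simp: l2_iff delta_def intro!: finite_nonzero_values_imp_summable_on)

lemma cutoff_l2 [simp]: "f \<in> l2 S \<Longrightarrow> cutoff C f \<in> l2 S"
  by (erule l2_dominated) (auto simp: cutoff_def)

lemma scale_l2 [simp]: "f \<in> l2 S \<Longrightarrow> vec_scale c f \<in> l2 S"
  by (auto simp: l2_iff vec_scale_def norm_mult power_mult_distrib intro!: summable_on_cmult_right)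

lemma add_l2 [simp]:
  assumes "f \<in> l2 S" "g \<in> l2 S" shows "f + g \<in> l2 S"
proof -
  have "(cmod (f a + g a))\<^sup>2 \<le> 2 * (cmod (f a))\<^sup>2 + 2 * (cmod (g a))\<^sup>2" for a
  proof -
    have "(cmod (f a + g a))\<^sup>2 \<le> (cmod (f a) + cmod (g a))\<^sup>2"
      by (intro power_mono norm_triangle_ineq) auto
    also have "\<dots> \<le> 2 * (cmod (f a))\<^sup>2 + 2 * (cmod (g a))\<^sup>2"
      using sum_squares_bound[of "cmod (f a)" "cmod (g a)"] by (simp add: power2_sum)
    finally show ?thesis .
  qed
  moreover have "(\<lambda>a. 2 * (cmod (f a))\<^sup>2 + 2 * (cmod (g a))\<^sup>2) summable_on UNIV"
    by (intro summable_on_add summable_on_cmult_right l2_summable[OF assms(1)] l2_summable[OF assms(2)])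
  ultimately have "(\<lambda>a. (cmod (f a + g a))\<^sup>2) summable_on UNIV"
    using summable_on_comparison_test[of "\<lambda>a. 2 * (cmod (f a))\<^sup>2 + 2 * (cmod (g a))\<^sup>2" UNIV
        "\<lambda>a. (cmod (f a + g a))\<^sup>2"] by simp
  with assms show ?thesis by (auto simp: l2_iff)
qed

lemma diff_eq_add_scale: "f - g = f + vec_scale (- 1) g"
  by (rule ext) (simp add: vec_scale_def)

lemma diff_l2 [simp]: "f \<in> l2 S \<Longrightarrow> g \<in> l2 S \<Longrightarrow> f - g \<in> l2 S"
  unfolding diff_eq_add_scale by (intro add_l2 scale_l2)

lemma cutoff_add: "cutoff C (f + g) = cutoff C f + cutoff C g"
  and cutoff_scale: "cutoff C (vec_scale c f) = vec_scale c (cutoff C f)"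
  and cutoff_cutoff: "cutoff C (cutoff D f) = cutoff (C \<inter> D) f"
  by (auto simp: cutoff_def vec_scale_def fun_eq_iff)

lemma delta_self [simp]: "delta a a = 1"
  by (simp add: delta_def)

subsection \<open>Inner product and norm\<close>

lemma inner_summable:
  assumes "f \<in> l2 S" "g \<in> l2 T"
  shows "(\<lambda>a. f a * cnj (g a)) abs_summable_on A"
proof (rule abs_summable_product)
  show "(\<lambda>x. f x * f x) abs_summable_on A"
    using l2_summable[OF assms(1)] by (simp add: norm_mult power2_eq_square)
  show "(\<lambda>x. cnj (g x) * cnj (g x)) abs_summable_on A"
    using l2_summable[OF assms(2)] by (simp add: norm_mult power2_eq_square)
qed

lemma inner_has_sum:
  assumes "f \<in> l2 S" "g \<in> l2 T"
  shows "((\<lambda>a. f a * cnj (g a)) has_sum l2_inner f g) UNIV"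
  unfolding l2_inner_def using inner_summable[OF assms] by (simp add: abs_summable_summable)

lemma inner_add_left:
  assumes "f \<in> l2 S" "g \<in> l2 S" "h \<in> l2 S"
  shows "l2_inner (f + g) h = l2_inner f h + l2_inner g h"
  using infsumI[OF has_sum_add[OF inner_has_sum[OF assms(1,3)] inner_has_sum[OF assms(2,3)]]]
  by (simp add: l2_inner_def algebra_simps)

lemma inner_commute: "l2_inner g f = cnj (l2_inner f g)"
  unfolding l2_inner_def by (simp flip: infsum_cnj add: mult.commute)

lemma inner_add_right:
  assumes "f \<in> l2 S" "g \<in> l2 S" "h \<in> l2 S"
  shows "l2_inner h (f + g) = l2_inner h f + l2_inner h g"
  by (subst (1 2 3) inner_commute) (simp add: inner_add_left[OF assms])

lemma inner_scale_left: "l2_inner (vec_scale c f) g = c * l2_inner f g"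
  by (simp add: l2_inner_def vec_scale_def mult.assoc infsum_cmult_right')

lemma inner_scale_right: "l2_inner f (vec_scale c g) = cnj c * l2_inner f g"
  by (subst (1 2) inner_commute) (simp add: inner_scale_left)

lemma inner_zero [simp]: "l2_inner 0 f = 0" "l2_inner f 0 = 0"
  by (simp_all add: l2_inner_def)

lemma inner_diff_left:
  assumes "f \<in> l2 S" "g \<in> l2 S" "h \<in> l2 S"
  shows "l2_inner (f - g) h = l2_inner f h - l2_inner g h"
  using assms by (simp add: diff_eq_add_scale inner_add_left[of _ S] inner_scale_left)

lemma infsum_single: "(\<And>b. b \<noteq> a \<Longrightarrow> f b = 0) \<Longrightarrow> (\<Sum>\<^sub>\<infinity>b. f b) = (f a :: complex)"
  by (subst infsum_cong_neutral[where T = "{a}" and g = f]) auto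

lemma inner_delta_right [simp]: "l2_inner f (delta a) = f a"
  unfolding l2_inner_def by (subst infsum_single[of a]) (auto simp: delta_def)

lemma inner_delta_left [simp]: "l2_inner (delta a) f = cnj (f a)"
  by (subst inner_commute) simp

lemma l2_norm_nonneg [simp]: "0 \<le> l2_norm f"
  by (simp add: l2_norm_def infsum_nonneg)

lemma l2_norm_sq: "(l2_norm f)\<^sup>2 = (\<Sum>\<^sub>\<infinity>a. (cmod (f a))\<^sup>2)"
  by (simp add: l2_norm_def infsum_nonneg)

lemma l2_norm_sq_has_sum: "f \<in> l2 S \<Longrightarrow> ((\<lambda>a. (cmod (f a))\<^sup>2) has_sum (l2_norm f)\<^sup>2) UNIV"
  unfolding l2_norm_sq by (intro has_sum_infsum l2_summable)

lemma inner_self: "f \<in> l2 S \<Longrightarrow> l2_inner f f = of_real ((l2_norm f)\<^sup>2)"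
  using infsumI[OF has_sum_of_real[OF l2_norm_sq_has_sum, where 'a = complex]]
  by (simp add: l2_inner_def complex_norm_square del: of_real_power)

lemma finite_sum_le_norm_sq:
  assumes "f \<in> l2 S" "finite F"
  shows "(\<Sum>a\<in>F. (cmod (f a))\<^sup>2) \<le> (l2_norm f)\<^sup>2"
  by (rule finite_sum_le_has_sum[OF l2_norm_sq_has_sum[OF assms(1)] assms(2)]) auto

lemma cmod_le_norm: "f \<in> l2 S \<Longrightarrow> cmod (f a) \<le> l2_norm f"
  using finite_sum_le_norm_sq[of f S "{a}"] by (simp add: abs_le_square_iff[symmetric])

lemma l2_norm_eq_0: "f \<in> l2 S \<Longrightarrow> l2_norm f = 0 \<Longrightarrow> f = 0"
  using cmod_le_norm[of f S] by (fastforce simp: fun_eq_iff)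

lemma l2_norm_zero [simp]: "l2_norm 0 = 0"
  by (simp add: l2_norm_def)

lemma l2_norm_scale: "l2_norm (vec_scale c f) = cmod c * l2_norm f"
  by (simp add: l2_norm_def vec_scale_def norm_mult power_mult_distrib infsum_cmult_right' real_sqrt_mult)

lemma l2_norm_delta [simp]: "l2_norm (delta a) = 1"
  using inner_self[of "delta a" UNIV] by (simp flip: of_real_power add: abs_square_eq_1)

lemma l2_norm_mono:
  assumes "f \<in> l2 S" "\<And>a. cmod (g a) \<le> cmod (f a)"
  shows "l2_norm g \<le> l2_norm f"
  unfolding l2_norm_def
  by (intro real_sqrt_le_mono infsum_mono l2_summable[OF assms(1)]
        l2_summable[OF l2_dominated[OF assms]] power_mono assms) auto

lemma l2_norm_cutoff_le: "f \<in> l2 S \<Longrightarrow> l2_norm (cutoff C f) \<le> l2_norm f"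
  by (erule l2_norm_mono) (auto simp: cutoff_def)

lemma cauchy_schwarz:
  assumes "f \<in> l2 S" "g \<in> l2 S"
  shows "cmod (l2_inner f g) \<le> l2_norm f * l2_norm g"
proof -
  have "(\<Sum>a\<in>F. cmod (f a * cnj (g a))) \<le> l2_norm f * l2_norm g" if F: "finite F" for F
  proof -
    have "(\<Sum>a\<in>F. cmod (f a * cnj (g a))) = (\<Sum>a\<in>F. \<bar>cmod (f a)\<bar> * \<bar>cmod (g a)\<bar>)"
      by (simp add: norm_mult)
    also have "\<dots> \<le> L2_set (\<lambda>a. cmod (f a)) F * L2_set (\<lambda>a. cmod (g a)) F"
      by (rule L2_set_mult_ineq)
    also have "\<dots> \<le> l2_norm f * l2_norm g"
      unfolding L2_set_def using finite_sum_le_norm_sq[OF assms(1) F] finite_sum_le_norm_sq[OF assms(2) F]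
      by (intro mult_mono real_le_lsqrt) (auto intro: sum_nonneg)
    finally show ?thesis .
  qed
  then have "(\<Sum>\<^sub>\<infinity>a. cmod (f a * cnj (g a))) \<le> l2_norm f * l2_norm g"
    by (intro infsum_le_finite_sums inner_summable[OF assms])
  then show ?thesis
    unfolding l2_inner_def using norm_infsum_bound[OF inner_summable[OF assms, of UNIV]] by linarith
qed

lemma l2_norm_sq_add:
  assumes "f \<in> l2 S" "g \<in> l2 S"
  shows "(l2_norm (f + g))\<^sup>2 = (l2_norm f)\<^sup>2 + (l2_norm g)\<^sup>2 + 2 * Re (l2_inner f g)"
proof -
  have "complex_of_real ((l2_norm (f + g))\<^sup>2) = l2_inner (f + g) (f + g)"
    using assms by (simp add: inner_self[of _ S])
  also have "\<dots> = l2_inner f f + l2_inner g g + (l2_inner f g + cnj (l2_inner f g))"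
    using assms by (simp add: inner_add_left[of _ S] inner_add_right[of _ S] inner_commute[of g f])
  also have "\<dots> = complex_of_real ((l2_norm f)\<^sup>2 + (l2_norm g)\<^sup>2 + 2 * Re (l2_inner f g))"
    using assms by (simp add: inner_self[of _ S] complex_add_cnj)
  finally show ?thesis using of_real_eq_iff by blast
qed

lemma l2_norm_triangle:
  assumes "f \<in> l2 S" "g \<in> l2 S"
  shows "l2_norm (f + g) \<le> l2_norm f + l2_norm g"
proof (rule power2_le_imp_le)
  have "Re (l2_inner f g) \<le> l2_norm f * l2_norm g"
    using cauchy_schwarz[OF assms] complex_Re_le_cmod[of "l2_inner f g"] by linarith
  then show "(l2_norm (f + g))\<^sup>2 \<le> (l2_norm f + l2_norm g)\<^sup>2"
    by (simp add: l2_norm_sq_add[OF assms] power2_sum)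
qed auto

lemma l2_norm_sq_split:
  assumes "f \<in> l2 S"
  shows "(l2_norm f)\<^sup>2 = (l2_norm (cutoff C f))\<^sup>2 + (l2_norm (f - cutoff C f))\<^sup>2"
proof -
  have "l2_inner (cutoff C f) (f - cutoff C f) = 0"
    unfolding l2_inner_def by (rule infsum_0) (auto simp: cutoff_def)
  moreover have "f = cutoff C f + (f - cutoff C f)" by simp
  ultimately show ?thesis
    using l2_norm_sq_add[of "cutoff C f" S "f - cutoff C f"] assms by simp
qed

subsection \<open>Approximation by finitely supported functions\<close>

lemma cutoff_finite_tendsto:
  assumes "f \<in> l2 S"
  shows "((\<lambda>F. l2_norm (f - cutoff F f)) \<longlongrightarrow> 0) (finite_subsets_at_top UNIV)"
proof -
  have eq: "l2_norm (f - cutoff F f) = sqrt ((l2_norm f)\<^sup>2 - (\<Sum>a\<in>F. (cmod (f a))\<^sup>2))" if "finite F" for F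
  proof -
    have "(l2_norm (cutoff F f))\<^sup>2 = infsum (\<lambda>a. (cmod (f a))\<^sup>2) F"
      unfolding l2_norm_sq by (rule infsum_cong_neutral) (auto simp: cutoff_def)
    then have "(l2_norm (f - cutoff F f))\<^sup>2 = (l2_norm f)\<^sup>2 - (\<Sum>a\<in>F. (cmod (f a))\<^sup>2)"
      using l2_norm_sq_split[OF assms, of F] that by simp
    then show ?thesis by (metis l2_norm_nonneg real_sqrt_unique)
  qed
  have "((\<lambda>F. sqrt ((l2_norm f)\<^sup>2 - (\<Sum>a\<in>F. (cmod (f a))\<^sup>2))) \<longlongrightarrow> sqrt ((l2_norm f)\<^sup>2 - (l2_norm f)\<^sup>2))
          (finite_subsets_at_top UNIV)"
    using l2_norm_sq_has_sum[OF assms] unfolding has_sum_def by (intro tendsto_intros)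
  then have "((\<lambda>F. sqrt ((l2_norm f)\<^sup>2 - (\<Sum>a\<in>F. (cmod (f a))\<^sup>2))) \<longlongrightarrow> 0)
          (finite_subsets_at_top UNIV)" by simp
  then show ?thesis
    by (rule Lim_transform_eventually)
       (auto intro!: eventually_finite_subsets_at_top_weakI simp: eq)
qed

lemma cutoff_finite_approx:
  assumes "f \<in> l2 S" "e > 0"
  obtains F where "finite F" "l2_norm (f - cutoff F f) < e"
proof -
  have "\<forall>\<^sub>F F in finite_subsets_at_top UNIV. finite F \<and> l2_norm (f - cutoff F f) < e"
    using order_tendstoD(2)[OF cutoff_finite_tendsto[OF assms(1)] assms(2)]
    by (auto intro: eventually_elim2[OF _ eventually_finite_subsets_at_top_weakI[of UNIV finite]])
  then show ?thesis
    using that eventually_happens finite_subsets_at_top_neq_bot by blast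
qed

text \<open>Only the inequality in the last clause is demanded, since upper estimates are all that is
  propagated from basis vectors to general ones.\<close>

definition l2_seminorm :: "'s set \<Rightarrow> real \<Rightarrow> (('s \<Rightarrow> complex) \<Rightarrow> real) \<Rightarrow> bool" where
  "l2_seminorm S C p \<longleftrightarrow>
     (\<forall>f\<in>l2 S. 0 \<le> p f \<and> p f \<le> C * l2_norm f) \<and>
     (\<forall>f\<in>l2 S. \<forall>g\<in>l2 S. p (f + g) \<le> p f + p g) \<and>
     (\<forall>f\<in>l2 S. \<forall>c. p (vec_scale c f) \<le> cmod c * p f)"

lemma l2_seminormD:
  assumes "l2_seminorm S C p" "f \<in> l2 S"
  shows "0 \<le> p f" "p f \<le> C * l2_norm f" "g \<in> l2 S \<Longrightarrow> p (f + g) \<le> p f + p g"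
    "p (vec_scale c f) \<le> cmod c * p f"
  using assms by (auto simp: l2_seminorm_def)

text \<open>Finitely supported functions are dense in \<open>\<ell>\<^sup>2\<close>, and a common bound \<open>C\<close> makes the approximation
  uniform in \<open>i\<close>.  Hence convergence on basis vectors is enough.  The set \<open>A\<close> allows for functions
  whose support avoids part of the index set.\<close>

lemma seminorms_tendsto_0:
  fixes p :: "'i \<Rightarrow> ('s \<Rightarrow> complex) \<Rightarrow> real"
  assumes ev: "\<forall>\<^sub>F i in \<F>. l2_seminorm S C (p i)"
    and delta: "\<And>a. a \<in> A \<Longrightarrow> ((\<lambda>i. p i (delta a)) \<longlongrightarrow> 0) \<F>"
    and f: "f \<in> l2 S" and supp: "\<And>a. a \<notin> A \<Longrightarrow> f a = 0" and "A \<subseteq> S"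
  shows "((\<lambda>i. p i f) \<longlongrightarrow> 0) \<F>"
proof -
  have fin: "((\<lambda>i. p i (cutoff F f)) \<longlongrightarrow> 0) \<F>" if "finite F" for F
    using that
  proof (induction F rule: finite_induct)
    case empty
    have "\<forall>\<^sub>F i in \<F>. p i (cutoff {} f) = 0"
      using ev
    proof (rule eventually_mono)
      fix i
      assume i: "l2_seminorm S C (p i)"
      have "cutoff {} f = 0" by (auto simp: cutoff_def)
      then show "p i (cutoff {} f) = 0"
        using l2_seminormD(1,2)[OF i zero_l2] by simp
    qed
    then show ?case by (rule tendsto_eventually)
  next
    case (insert a F)
    show ?case
    proof (cases "a \<in> A")
      case True
      then have aS: "a \<in> S" using \<open>A \<subseteq> S\<close> by auto
      have split: "cutoff (insert a F) f = vec_scale (f a) (delta a) + cutoff F f"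
        using insert by (auto simp: cutoff_def vec_scale_def delta_def fun_eq_iff)
      show ?thesis
      proof (rule tendsto_sandwich[OF _ _ tendsto_const])
        have "((\<lambda>i. cmod (f a) * p i (delta a) + p i (cutoff F f)) \<longlongrightarrow> cmod (f a) * 0 + 0) \<F>"
          by (intro tendsto_intros insert delta True)
        then show "((\<lambda>i. cmod (f a) * p i (delta a) + p i (cutoff F f)) \<longlongrightarrow> 0) \<F>" by simp
        show "\<forall>\<^sub>F i in \<F>. p i (cutoff (insert a F) f) \<le> cmod (f a) * p i (delta a) + p i (cutoff F f)"
          using ev
        proof (rule eventually_mono)
          fix i
          assume i: "l2_seminorm S C (p i)"
          have "p i (cutoff (insert a F) f) \<le> p i (vec_scale (f a) (delta a)) + p i (cutoff F f)"
            unfolding split using f aS by (intro l2_seminormD(3)[OF i]) auto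
          also have "p i (vec_scale (f a) (delta a)) \<le> cmod (f a) * p i (delta a)"
            using aS by (intro l2_seminormD(4)[OF i]) auto
          finally show "p i (cutoff (insert a F) f) \<le> cmod (f a) * p i (delta a) + p i (cutoff F f)"
            by simp
        qed
        show "\<forall>\<^sub>F i in \<F>. 0 \<le> p i (cutoff (insert a F) f)"
          using ev by (rule eventually_mono) (use f in \<open>auto intro: l2_seminormD(1)\<close>)
      qed
    next
      case False
      then have "cutoff (insert a F) f = cutoff F f"
        using supp by (auto simp: cutoff_def)
      with insert show ?thesis by simp
    qed
  qed
  show ?thesis
  proof (rule order_tendstoI)
    fix e :: real assume "e < 0"
    then show "\<forall>\<^sub>F i in \<F>. e < p i f"
      by (auto intro!: eventually_mono[OF ev] dest: l2_seminormD(1)[OF _ f])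
  next
    fix e :: real assume "0 < e"
    define D where "D = \<bar>C\<bar> + 1"
    have D: "D > 0" "C \<le> D" by (auto simp: D_def)
    define r where "r = e / (2 * D)"
    have "r > 0" using \<open>0 < e\<close> D by (simp add: r_def)
    then obtain F where F: "finite F" "l2_norm (f - cutoff F f) < r"
      using cutoff_finite_approx[OF f] by blast
    have "\<forall>\<^sub>F i in \<F>. p i (cutoff F f) < e / 2"
      using order_tendstoD(2)[OF fin[OF F(1)], of "e / 2"] \<open>0 < e\<close> by simp
    with ev show "\<forall>\<^sub>F i in \<F>. p i f < e"
    proof (rule eventually_elim2)
      fix i
      assume i: "l2_seminorm S C (p i)"
        and small: "p i (cutoff F f) < e / 2"
      have "p i f = p i (cutoff F f + (f - cutoff F f))" by simp
      also have "\<dots> \<le> p i (cutoff F f) + p i (f - cutoff F f)"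
        using f by (intro l2_seminormD(3)[OF i]) auto
      also have "p i (f - cutoff F f) \<le> C * l2_norm (f - cutoff F f)"
        using f by (intro l2_seminormD(2)[OF i]) auto
      also have "\<dots> \<le> D * r"
        using F(2) D by (intro mult_mono) auto
      also have "\<dots> = e / 2"
        using D by (simp add: r_def)
      finally show "p i f < e" using small by simp
    qed
  qed
qed

section \<open>Bounded operators\<close>

text \<open>Vectors and operators are functions.  Their sums have to stay folded for the linearity
  rules below to match.\<close>

declare plus_fun_apply [simp del] zero_fun_apply [simp del] minus_apply [simp del]

lemmas fun_apply = plus_fun_apply zero_fun_apply minus_apply


lemma bops_outside: "x \<in> bounded_ops S \<Longrightarrow> f \<notin> l2 S \<Longrightarrow> x f = 0"
  and bops_add: "x \<in> bounded_ops S \<Longrightarrow> f \<in> l2 S \<Longrightarrow> g \<in> l2 S \<Longrightarrow> x (f + g) = x f + x g"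
  and bops_scale: "x \<in> bounded_ops S \<Longrightarrow> f \<in> l2 S \<Longrightarrow> x (vec_scale c f) = vec_scale c (x f)"
  by (auto simp: bounded_ops_def)

lemma bops_l2 [simp]: "x \<in> bounded_ops S \<Longrightarrow> x f \<in> l2 S"
  by (cases "f \<in> l2 S") (auto simp: bounded_ops_def)

lemma bops_diff: "x \<in> bounded_ops S \<Longrightarrow> f \<in> l2 S \<Longrightarrow> g \<in> l2 S \<Longrightarrow> x (f - g) = x f - x g"
  unfolding diff_eq_add_scale by (subst bops_add) (auto simp: bops_scale[of x S])

lemma bops_zero: "x \<in> bounded_ops S \<Longrightarrow> x 0 = 0"
  using bops_diff[of x S 0 0] by simp

lemma bops_bound:
  assumes "x \<in> bounded_ops S"
  obtains C where "C \<ge> 0" "\<And>f. f \<in> l2 S \<Longrightarrow> l2_norm (x f) \<le> C * l2_norm f"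
proof -
  from assms obtain C where C: "\<And>f. f \<in> l2 S \<Longrightarrow> l2_norm (x f) \<le> C * l2_norm f"
    unfolding bounded_ops_def by blast
  have "l2_norm (x f) \<le> \<bar>C\<bar> * l2_norm f" if "f \<in> l2 S" for f
    using C[OF that] mult_right_mono[of C "\<bar>C\<bar>" "l2_norm f"] abs_ge_self[of C] by simp
  then show ?thesis using that[of "\<bar>C\<bar>"] by simp
qed

lemma bopsI:
  assumes "\<And>f. f \<notin> l2 S \<Longrightarrow> x f = 0" "\<And>f. f \<in> l2 S \<Longrightarrow> x f \<in> l2 S"
    "\<And>f g. f \<in> l2 S \<Longrightarrow> g \<in> l2 S \<Longrightarrow> x (f + g) = x f + x g"
    "\<And>c f. f \<in> l2 S \<Longrightarrow> x (vec_scale c f) = vec_scale c (x f)"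
    "\<And>f. f \<in> l2 S \<Longrightarrow> l2_norm (x f) \<le> C * l2_norm f"
  shows "x \<in> bounded_ops S"
  unfolding bounded_ops_def using assms by blast

lemma scale_add: "vec_scale c (f + g) = vec_scale c f + vec_scale c g"
  and scale_scale: "vec_scale c (vec_scale d f) = vec_scale (c * d) f"
  and scale_zero [simp]: "vec_scale c 0 = 0" "vec_scale 0 f = 0"
  by (simp_all add: vec_scale_def fun_eq_iff fun_apply algebra_simps)

lemma comp_bops [simp]:
  assumes x: "x \<in> bounded_ops S" and y: "y \<in> bounded_ops S"
  shows "x \<circ> y \<in> bounded_ops S"
proof -
  obtain C where C: "C \<ge> 0" "\<And>f. f \<in> l2 S \<Longrightarrow> l2_norm (x f) \<le> C * l2_norm f"
    by (rule bops_bound[OF x], rule that)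
  obtain D where D: "D \<ge> 0" "\<And>f. f \<in> l2 S \<Longrightarrow> l2_norm (y f) \<le> D * l2_norm f"
    by (rule bops_bound[OF y], rule that)
  have "l2_norm (x (y f)) \<le> (C * D) * l2_norm f" if "f \<in> l2 S" for f
    using C(2)[of "y f"] mult_left_mono[OF D(2)[OF that] C(1)] y by (simp add: mult.assoc)
  then show ?thesis
    using x y by (intro bopsI[where C = "C * D"])
      (auto simp: bops_outside[OF y] bops_zero[OF x] bops_add[OF x] bops_add[OF y] bops_scale[OF x] bops_scale[OF y])
qed

lemma op_add_apply: "(x + y) f = x f + y f" for x y :: "'s l2_op"
  by (rule plus_fun_apply)

lemma op_diff_apply: "(x - y) f = x f - y f" for x y :: "'s l2_op"
  by (rule minus_apply)

lemma op_scale_apply: "op_scale c x f = vec_scale c (x f)"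
  by (simp add: op_scale_def)

lemma zero_bops [simp]: "0 \<in> bounded_ops S"
  by (rule bopsI[where C = 0]) (auto simp: fun_apply)

lemma add_bops [simp]:
  assumes x: "x \<in> bounded_ops S" and y: "y \<in> bounded_ops S"
  shows "x + y \<in> bounded_ops S"
proof -
  obtain C where C: "C \<ge> 0" "\<And>f. f \<in> l2 S \<Longrightarrow> l2_norm (x f) \<le> C * l2_norm f"
    by (rule bops_bound[OF x], rule that)
  obtain D where D: "D \<ge> 0" "\<And>f. f \<in> l2 S \<Longrightarrow> l2_norm (y f) \<le> D * l2_norm f"
    by (rule bops_bound[OF y], rule that)
  have "l2_norm (x f + y f) \<le> (C + D) * l2_norm f" if "f \<in> l2 S" for f
    using l2_norm_triangle[of "x f" S "y f"] C(2)[OF that] D(2)[OF that] x y by (simp add: distrib_right)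
  then show ?thesis
    using x y by (intro bopsI[where C = "C + D"])
      (auto simp: op_add_apply bops_outside[OF x] bops_outside[OF y] bops_add[OF x] bops_add[OF y]
        bops_scale[OF x] bops_scale[OF y] scale_add)
qed

lemma op_scale_bops [simp]:
  assumes x: "x \<in> bounded_ops S"
  shows "op_scale c x \<in> bounded_ops S"
proof -
  obtain C where C: "C \<ge> 0" "\<And>f. f \<in> l2 S \<Longrightarrow> l2_norm (x f) \<le> C * l2_norm f"
    by (rule bops_bound[OF x], rule that)
  have "l2_norm (vec_scale c (x f)) \<le> (cmod c * C) * l2_norm f" if "f \<in> l2 S" for f
    using mult_left_mono[OF C(2)[OF that], of "cmod c"] by (simp add: l2_norm_scale mult.assoc)
  then show ?thesis
    unfolding op_scale_def using x
    by (intro bopsI[where C = "cmod c * C"]) (auto simp: bops_outside[OF x] bops_add[OF x] bops_scale[OF x] scale_add scale_scale mult.commute)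
qed

lemma op_diff_eq: "x - y = x + op_scale (- 1) y"
  by (rule ext)+ (simp add: op_scale_def vec_scale_def fun_apply)

lemma diff_bops [simp]: "x \<in> bounded_ops S \<Longrightarrow> y \<in> bounded_ops S \<Longrightarrow> x - y \<in> bounded_ops S"
  by (simp add: op_diff_eq)

lemma op_id_apply [simp]: "f \<in> l2 S \<Longrightarrow> op_id S f = f"
  by (simp add: op_id_def)

lemma op_id_bops [simp]: "op_id S \<in> bounded_ops S"
  by (rule bopsI[where C = 1]) (auto simp: op_id_def)

lemma op_id_comp [simp]:
  assumes "x \<in> bounded_ops S" shows "op_id S \<circ> x = x" "x \<circ> op_id S = x"
  using bops_outside[OF assms] bops_zero[OF assms] bops_l2[OF assms]
  by (auto simp: fun_eq_iff[of _ x] op_id_def)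

definition cutoff_op :: "'s set \<Rightarrow> 's set \<Rightarrow> 's l2_op" where
  "cutoff_op S C = (\<lambda>f. if f \<in> l2 S then cutoff C f else 0)"

lemma cutoff_op_bops [simp]: "cutoff_op S C \<in> bounded_ops S"
  by (rule bopsI[where C = 1]) (auto simp: cutoff_op_def cutoff_add cutoff_scale l2_norm_cutoff_le)

subsection \<open>Determination by matrix entries\<close>

text \<open>The expansion of a bounded functional in its values on the basis; every computation with matrix
  entries below is an instance of it.\<close>

lemma functional_has_sum:
  fixes \<Phi> :: "('s \<Rightarrow> complex) \<Rightarrow> complex"
  assumes add: "\<And>f g. f \<in> l2 S \<Longrightarrow> g \<in> l2 S \<Longrightarrow> \<Phi> (f + g) = \<Phi> f + \<Phi> g"
    and scale: "\<And>c f. f \<in> l2 S \<Longrightarrow> \<Phi> (vec_scale c f) = c * \<Phi> f"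
    and bound: "\<And>f. f \<in> l2 S \<Longrightarrow> cmod (\<Phi> f) \<le> C * l2_norm f"
    and f: "f \<in> l2 S"
  shows "((\<lambda>a. f a * \<Phi> (delta a)) has_sum \<Phi> f) UNIV"
proof -
  have zero: "\<Phi> 0 = 0"
    using scale[of 0 0] by simp
  have fin: "(\<Sum>a\<in>F. f a * \<Phi> (delta a)) = \<Phi> (cutoff F f)" if "finite F" for F
    using that
  proof (induction F rule: finite_induct)
    case empty
    have "cutoff {} f = 0" by (simp add: cutoff_def fun_eq_iff zero_fun_apply)
    show ?case unfolding \<open>cutoff {} f = 0\<close> using zero by simp
  next
    case (insert a F)
    have split: "cutoff (insert a F) f = vec_scale (f a) (delta a) + cutoff F f"
      using insert.hyps by (auto simp: cutoff_def vec_scale_def delta_def fun_eq_iff plus_fun_apply)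
    show ?case
    proof (cases "a \<in> S")
      case True
      then show ?thesis
        using insert f unfolding split by (simp add: add scale)
    next
      case False
      then have "f a = 0" using l2_outside[OF f] by blast
      then show ?thesis using insert unfolding split by simp
    qed
  qed
  have "((\<lambda>F. \<Phi> f - \<Phi> (cutoff F f)) \<longlongrightarrow> 0) (finite_subsets_at_top UNIV)"
  proof (rule Lim_null_comparison)
    have "cmod (\<Phi> f - \<Phi> (cutoff F f)) \<le> C * l2_norm (f - cutoff F f)" for F
    proof -
      have "\<Phi> f = \<Phi> (cutoff F f) + \<Phi> (f - cutoff F f)"
        using add[of "cutoff F f" "f - cutoff F f"] f by simp
      then show ?thesis using bound[of "f - cutoff F f"] f by simp
    qed
    then show "\<forall>\<^sub>F F in finite_subsets_at_top UNIV. cmod (\<Phi> f - \<Phi> (cutoff F f)) \<le> C * l2_norm (f - cutoff F f)"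
      by simp
    show "((\<lambda>F. C * l2_norm (f - cutoff F f)) \<longlongrightarrow> 0) (finite_subsets_at_top UNIV)"
      using tendsto_mult_left[OF cutoff_finite_tendsto[OF f], of C] by simp
  qed
  then have "((\<lambda>F. \<Phi> f - (\<Phi> f - \<Phi> (cutoff F f))) \<longlongrightarrow> \<Phi> f - 0) (finite_subsets_at_top UNIV)"
    by (rule tendsto_diff[OF tendsto_const])
  then have "((\<lambda>F. \<Phi> (cutoff F f)) \<longlongrightarrow> \<Phi> f) (finite_subsets_at_top UNIV)"
    by simp
  then show ?thesis
    unfolding has_sum_def
    by (rule Lim_transform_eventually)
       (rule eventually_finite_subsets_at_top_weakI, simp add: fin)
qed

lemma bops_inner_has_sum:
  assumes x: "x \<in> bounded_ops S" and f: "f \<in> l2 S" and g: "g \<in> l2 S"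
  shows "((\<lambda>a. f a * l2_inner (x (delta a)) g) has_sum l2_inner (x f) g) UNIV"
proof -
  obtain C where C: "C \<ge> 0" "\<And>f. f \<in> l2 S \<Longrightarrow> l2_norm (x f) \<le> C * l2_norm f"
    by (rule bops_bound[OF x], rule that)
  show ?thesis
  proof (rule functional_has_sum[where C = "C * l2_norm g"])
    fix f assume f: "f \<in> l2 S"
    have "cmod (l2_inner (x f) g) \<le> l2_norm (x f) * l2_norm g"
      using cauchy_schwarz[of "x f" S g] x g by simp
    also have "\<dots> \<le> C * l2_norm f * l2_norm g"
      using C(2)[OF f] by (intro mult_right_mono) auto
    finally show "cmod (l2_inner (x f) g) \<le> C * l2_norm g * l2_norm f"
      by (simp add: mult_ac)
  qed (use x f g in \<open>auto simp: bops_add[OF x] bops_scale[OF x] inner_add_left[of _ S] inner_scale_left\<close>)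
qed

lemma bops_has_sum:
  assumes "x \<in> bounded_ops S" "f \<in> l2 S" "t \<in> S"
  shows "((\<lambda>a. f a * x (delta a) t) has_sum x f t) UNIV"
  using bops_inner_has_sum[OF assms(1,2) delta_l2[OF assms(3)]] by simp

lemma bops_eqI:
  assumes x: "x \<in> bounded_ops S" and y: "y \<in> bounded_ops S"
    and eq: "\<And>s t. s \<in> S \<Longrightarrow> t \<in> S \<Longrightarrow> x (delta s) t = y (delta s) t"
  shows "x = y"
proof
  fix f
  show "x f = y f"
  proof (cases "f \<in> l2 S")
    case True
    have "x f t = y f t" for t
    proof (cases "t \<in> S")
      case t: True
      have "(\<lambda>a. f a * x (delta a) t) = (\<lambda>a. f a * y (delta a) t)"
        using eq t l2_outside[OF True] by fastforce
      then show ?thesis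
        using has_sum_unique bops_has_sum[OF x True t] bops_has_sum[OF y True t] by metis
    next
      case False
      then show ?thesis using l2_outside bops_l2 x y by metis
    qed
    then show ?thesis by auto
  next
    case False
    then show ?thesis using bops_outside x y by metis
  qed
qed

subsection \<open>Adjoints\<close>

text \<open>The adjoint has the conjugate transposed matrix, and the point is that this matrix defines a
  bounded operator \<open>y\<close>.  For a finite set \<open>F\<close> let \<open>h\<close> be \<open>y g\<close> cut off to \<open>F\<close>.  Then
  \<open>\<parallel>h\<parallel>\<^sup>2 = \<langle>x h, g\<rangle> \<le> C \<parallel>h\<parallel> \<parallel>g\<parallel>\<close>, so the square sum of \<open>y g\<close> over \<open>F\<close> is at most \<open>(C \<parallel>g\<parallel>)\<^sup>2\<close>.\<close>

lemma adj_exists: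
  assumes x: "x \<in> bounded_ops S"
  shows "\<exists>y\<in>bounded_ops S. \<forall>f\<in>l2 S. \<forall>g\<in>l2 S. l2_inner (x f) g = l2_inner f (y g)"
proof -
  obtain C where C: "C \<ge> 0" "\<And>f. f \<in> l2 S \<Longrightarrow> l2_norm (x f) \<le> C * l2_norm f"
    by (rule bops_bound[OF x], rule that)
  define y where "y = (\<lambda>g. if g \<in> l2 S then (\<lambda>a. if a \<in> S then l2_inner g (x (delta a)) else 0) else 0)"
  have fin: "(\<Sum>a\<in>F. (cmod (y g a))\<^sup>2) \<le> (C * l2_norm g)\<^sup>2"
    if g: "g \<in> l2 S" and F: "finite F" for g F
  proof -
    define h where "h = cutoff F (y g)"
    define q where "q = (\<Sum>a\<in>F. (cmod (y g a))\<^sup>2)"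
    have hF: "finite {a. h a \<noteq> 0}"
      by (rule finite_subset[OF _ F]) (auto simp: h_def cutoff_def)
    have h: "h \<in> l2 S"
      unfolding l2_iff
    proof (intro conjI allI impI finite_nonzero_values_imp_summable_on)
      show "h a = 0" if "a \<notin> S" for a
        using that g by (auto simp: h_def cutoff_def y_def)
      show "finite {a \<in> UNIV. (cmod (h a))\<^sup>2 \<noteq> 0}"
        using hF by simp
    qed
    have "(l2_norm h)\<^sup>2 = infsum (\<lambda>a. (cmod (y g a))\<^sup>2) F"
      unfolding l2_norm_sq by (rule infsum_cong_neutral) (auto simp: h_def cutoff_def)
    then have hq: "(l2_norm h)\<^sup>2 = q" using F by (simp add: q_def)
    have "((\<lambda>a. h a * l2_inner (x (delta a)) g) has_sum l2_inner (x h) g) UNIV"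
      by (rule bops_inner_has_sum[OF x h g])
    moreover have "((\<lambda>a. h a * l2_inner (x (delta a)) g) has_sum of_real q) UNIV"
    proof (rule has_sum_finite_neutralI[OF F])
      have "l2_inner (x (delta a)) g = cnj (y g a)" if "h a \<noteq> 0" for a
        using that g by (auto simp: y_def h_def cutoff_def inner_commute[of g] split: if_splits)
      then have "h a * l2_inner (x (delta a)) g = of_real ((cmod (y g a))\<^sup>2)" if "a \<in> F" for a
        using that complex_norm_square[of "y g a"] by (cases "h a = 0") (auto simp: h_def cutoff_def)
      then show "of_real q = (\<Sum>a\<in>F. h a * l2_inner (x (delta a)) g)"
        by (simp add: q_def)
    qed (auto simp: h_def cutoff_def)
    ultimately have "l2_inner (x h) g = of_real q"
      by (rule has_sum_unique)
    then have "q = cmod (l2_inner (x h) g)"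
      using hq by (metis abs_of_nonneg norm_of_real zero_le_power2)
    also have "\<dots> \<le> l2_norm (x h) * l2_norm g"
      using cauchy_schwarz[of "x h" S g] x g by simp
    also have "\<dots> \<le> (C * l2_norm h) * l2_norm g"
      by (intro mult_right_mono C(2)[OF h]) auto
    finally have "(l2_norm h)\<^sup>2 \<le> (C * l2_norm g) * l2_norm h"
      by (simp add: hq mult_ac)
    then have "l2_norm h \<le> C * l2_norm g"
      using C(1) l2_norm_nonneg[of h] by (cases "l2_norm h = 0") (auto simp: power2_eq_square)
    then show ?thesis
      unfolding q_def[symmetric] hq[symmetric] by (intro power_mono) auto
  qed
  have y_l2: "y g \<in> l2 S" if "g \<in> l2 S" for g
  proof -
    have "(\<lambda>a. (cmod (y g a))\<^sup>2) summable_on UNIV"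
      by (rule nonneg_bdd_above_summable_on) (auto intro!: bdd_aboveI2 fin that)
    then show ?thesis using that by (auto simp: l2_iff y_def)
  qed
  have y_norm: "l2_norm (y g) \<le> C * l2_norm g" if "g \<in> l2 S" for g
  proof (rule power2_le_imp_le)
    show "(l2_norm (y g))\<^sup>2 \<le> (C * l2_norm g)\<^sup>2"
      unfolding l2_norm_sq
      by (rule infsum_le_finite_sums[OF l2_summable[OF y_l2[OF that]]]) (use fin[OF that] in auto)
  qed (use C in auto)
  have "y \<in> bounded_ops S"
  proof (rule bopsI[OF _ y_l2 _ _ y_norm])
    fix f g assume "f \<in> l2 S" "g \<in> l2 S"
    then show "y (f + g) = y f + y g"
      using x by (auto simp: y_def inner_add_left[of _ S] fun_eq_iff plus_fun_apply)
  next
    fix c f assume "f \<in> l2 S"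
    then show "y (vec_scale c f) = vec_scale c (y f)"
      by (intro ext) (simp add: y_def inner_scale_left, simp add: vec_scale_def)
  qed (auto simp: y_def)
  moreover have "l2_inner (x f) g = l2_inner f (y g)" if f: "f \<in> l2 S" and g: "g \<in> l2 S" for f g
  proof (rule has_sum_unique)
    show "((\<lambda>a. f a * l2_inner (x (delta a)) g) has_sum l2_inner (x f) g) UNIV"
      by (rule bops_inner_has_sum[OF x f g])
    have "(\<lambda>a. f a * l2_inner (x (delta a)) g) = (\<lambda>a. f a * cnj (y g a))"
      using l2_outside[OF f] g by (auto simp: y_def inner_commute[of g])
    then show "((\<lambda>a. f a * l2_inner (x (delta a)) g) has_sum l2_inner f (y g)) UNIV"
      using inner_has_sum[OF f y_l2[OF g]] by (simp only:)
  qed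
  ultimately show ?thesis by blast
qed

lemma adj_unique:
  assumes y: "y \<in> bounded_ops S" "\<And>f g. f \<in> l2 S \<Longrightarrow> g \<in> l2 S \<Longrightarrow> l2_inner (x f) g = l2_inner f (y g)"
    and z: "z \<in> bounded_ops S" "\<And>f g. f \<in> l2 S \<Longrightarrow> g \<in> l2 S \<Longrightarrow> l2_inner (x f) g = l2_inner f (z g)"
  shows "y = z"
proof (rule bops_eqI[OF y(1) z(1)])
  fix s t assume "s \<in> S" "t \<in> S"
  then have "l2_inner (delta t) (y (delta s)) = l2_inner (delta t) (z (delta s))"
    using y(2) z(2) by (metis delta_l2)
  then show "y (delta s) t = z (delta s) t" by simp
qed

lemma op_adj_eqI:
  assumes "y \<in> bounded_ops S" "\<And>f g. f \<in> l2 S \<Longrightarrow> g \<in> l2 S \<Longrightarrow> l2_inner (x f) g = l2_inner f (y g)"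
  shows "op_adj S x = y"
  unfolding op_adj_def
proof (rule the_equality)
  fix z assume "z \<in> bounded_ops S \<and> (\<forall>f \<in> l2 S. \<forall>g \<in> l2 S. l2_inner (x f) g = l2_inner f (z g))"
  then have z: "z \<in> bounded_ops S" "\<And>f g. f \<in> l2 S \<Longrightarrow> g \<in> l2 S \<Longrightarrow> l2_inner (x f) g = l2_inner f (z g)"
    by blast+
  show "z = y" by (rule adj_unique[OF z assms])
qed (use assms in blast)

lemma adj_props:
  assumes "x \<in> bounded_ops S"
  shows adj_bops [simp]: "op_adj S x \<in> bounded_ops S"
    and adj_inner: "f \<in> l2 S \<Longrightarrow> g \<in> l2 S \<Longrightarrow> l2_inner (x f) g = l2_inner f (op_adj S x g)"
proof -
  obtain y where "y \<in> bounded_ops S"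
    "\<And>f g. f \<in> l2 S \<Longrightarrow> g \<in> l2 S \<Longrightarrow> l2_inner (x f) g = l2_inner f (y g)"
    using adj_exists[OF assms] by blast
  moreover from this have "op_adj S x = y" by (rule op_adj_eqI)
  ultimately show "op_adj S x \<in> bounded_ops S"
    "f \<in> l2 S \<Longrightarrow> g \<in> l2 S \<Longrightarrow> l2_inner (x f) g = l2_inner f (op_adj S x g)" by simp_all
qed

lemma adj_inner_left:
  assumes "x \<in> bounded_ops S" "f \<in> l2 S" "g \<in> l2 S"
  shows "l2_inner (op_adj S x f) g = l2_inner f (x g)"
  by (subst (1 2) inner_commute) (simp add: adj_inner[OF assms(1,3,2)])

lemma adj_delta: "x \<in> bounded_ops S \<Longrightarrow> s \<in> S \<Longrightarrow> t \<in> S \<Longrightarrow> op_adj S x (delta s) t = cnj (x (delta t) s)"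
  using adj_inner_left[of x S "delta s" "delta t"] by simp

lemma adj_adj [simp]: "x \<in> bounded_ops S \<Longrightarrow> op_adj S (op_adj S x) = x"
  by (rule op_adj_eqI) (auto simp: adj_inner_left[of x S])

lemma adj_comp: "x \<in> bounded_ops S \<Longrightarrow> y \<in> bounded_ops S \<Longrightarrow> op_adj S (x \<circ> y) = op_adj S y \<circ> op_adj S x"
  by (rule op_adj_eqI) (auto simp: adj_inner[of x S] adj_inner[of y S])

lemma norm_sq_via_adj:
  assumes "x \<in> bounded_ops S" "f \<in> l2 S"
  shows "of_real ((l2_norm (x f))\<^sup>2) = l2_inner (op_adj S x (x f)) f"
  using adj_inner_left[of x S "x f" f] inner_self[of "x f" S] assms by simp

lemma isometry_norm:
  assumes v: "v \<in> bounded_ops S" and iso: "op_adj S v \<circ> v = op_id S" and f: "f \<in> l2 S"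
  shows "l2_norm (v f) = l2_norm f"
proof -
  have "op_adj S v (v f) = f" using iso f by (metis comp_apply op_id_apply)
  then have "complex_of_real ((l2_norm (v f))\<^sup>2) = of_real ((l2_norm f)\<^sup>2)"
    using norm_sq_via_adj[OF v f] inner_self[OF f] by simp
  then show ?thesis by (metis of_real_eq_iff power2_eq_imp_eq l2_norm_nonneg)
qed

section \<open>Commutants and generated von Neumann algebras\<close>

lemma commutant_bops: "commutant S M \<subseteq> bounded_ops S"
  by (auto simp: commutant_def)

lemma commutant_antimono: "M \<subseteq> N \<Longrightarrow> commutant S N \<subseteq> commutant S M"
  by (auto simp: commutant_def)

lemma commutant_commute: "x \<in> M \<Longrightarrow> y \<in> commutant S M \<Longrightarrow> x \<circ> y = y \<circ> x"
  by (simp add: commutant_def)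

lemma bicommutant_superset:
  assumes "M \<subseteq> bounded_ops S"
  shows "M \<subseteq> commutant S (commutant S M)"
proof
  fix x assume "x \<in> M"
  then show "x \<in> commutant S (commutant S M)"
    using assms commutant_commute[OF \<open>x \<in> M\<close>, of _ S] unfolding commutant_def[of S "commutant S M"] by fastforce
qed

lemma adj_commutant:
  assumes M: "M \<subseteq> bounded_ops S" "\<And>x. x \<in> M \<Longrightarrow> op_adj S x \<in> M" and y: "y \<in> commutant S M"
  shows "op_adj S y \<in> commutant S M"
proof -
  have yb: "y \<in> bounded_ops S" using y by (simp add: commutant_def)
  have "x \<circ> op_adj S y = op_adj S y \<circ> x" if x: "x \<in> M" for x
  proof -
    have xb: "x \<in> bounded_ops S" and xs: "op_adj S x \<in> M" using M x by auto
    then have "op_adj S x \<circ> y = y \<circ> op_adj S x" using y by (simp add: commutant_def)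
    then have "op_adj S (op_adj S x \<circ> y) = op_adj S (y \<circ> op_adj S x)" by simp
    then show ?thesis using xb yb by (simp add: adj_comp)
  qed
  then show ?thesis using yb by (simp add: commutant_def)
qed

lemma commutantD: "x \<in> commutant S M \<Longrightarrow> x \<in> bounded_ops S"
  by (simp add: commutant_def)

lemma commutant_id [simp]: "M \<subseteq> bounded_ops S \<Longrightarrow> op_id S \<in> commutant S M"
  by (auto simp: commutant_def subset_iff)

lemma commutant_commute_apply: "x \<in> M \<Longrightarrow> y \<in> commutant S M \<Longrightarrow> x (y f) = y (x f)"
  using commutant_commute[of x M y S] by (metis comp_apply)

lemma commutant_comp:
  assumes "x \<in> commutant S M" "y \<in> commutant S M"
  shows "x \<circ> y \<in> commutant S M"
proof -
  have "z \<circ> (x \<circ> y) = (x \<circ> y) \<circ> z" if "z \<in> M" for z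
    using commutant_commute[OF that assms(1)] commutant_commute[OF that assms(2)]
    by (metis comp_assoc)
  then show ?thesis using assms by (simp add: commutant_def)
qed

lemma commutant_add:
  assumes M: "M \<subseteq> bounded_ops S" and "x \<in> commutant S M" "y \<in> commutant S M"
  shows "x + y \<in> commutant S M"
proof -
  have "z \<circ> (x + y) = (x + y) \<circ> z" if "z \<in> M" for z
  proof
    fix f
    have z: "z \<in> bounded_ops S" using M that by auto
    have "z (x f + y f) = z (x f) + z (y f)"
      using assms by (intro bops_add[OF z]) (auto simp: commutantD)
    then show "(z \<circ> (x + y)) f = ((x + y) \<circ> z) f"
      using commutant_commute_apply[OF that assms(2)] commutant_commute_apply[OF that assms(3)]
      by (simp add: op_add_apply)
  qed
  then show ?thesis using assms by (simp add: commutant_def)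
qed

lemma commutant_scale:
  assumes M: "M \<subseteq> bounded_ops S" and "x \<in> commutant S M"
  shows "op_scale c x \<in> commutant S M"
proof -
  have "z \<circ> op_scale c x = op_scale c x \<circ> z" if "z \<in> M" for z
  proof
    fix f
    have z: "z \<in> bounded_ops S" using M that by auto
    have "z (vec_scale c (x f)) = vec_scale c (z (x f))"
      using assms by (intro bops_scale[OF z]) (auto simp: commutantD)
    then show "(z \<circ> op_scale c x) f = (op_scale c x \<circ> z) f"
      using commutant_commute_apply[OF that assms(2)] by (simp add: op_scale_def)
  qed
  then show ?thesis using assms by (simp add: commutant_def)
qed

lemma commutant_diff:
  "M \<subseteq> bounded_ops S \<Longrightarrow> x \<in> commutant S M \<Longrightarrow> y \<in> commutant S M \<Longrightarrow> x - y \<in> commutant S M"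
  unfolding op_diff_eq by (intro commutant_add commutant_scale)

lemma bicommutant_von_neumann:
  assumes X: "X \<subseteq> bounded_ops S" "\<And>x. x \<in> X \<Longrightarrow> op_adj S x \<in> X"
  shows "von_neumann_algebra S (commutant S (commutant S X))"
  unfolding von_neumann_algebra_def
proof (intro conjI ballI)
  show "commutant S (commutant S X) \<subseteq> bounded_ops S" by (rule commutant_bops)
  show "op_adj S x \<in> commutant S (commutant S X)" if "x \<in> commutant S (commutant S X)" for x
    by (rule adj_commutant[OF commutant_bops adj_commutant[OF X] that])
  have "commutant S (commutant S (commutant S X)) = commutant S X"
    by (rule antisym[OF commutant_antimono[OF bicommutant_superset[OF X(1)]]
          bicommutant_superset[OF commutant_bops]])
  then show "commutant S (commutant S (commutant S (commutant S X))) = commutant S (commutant S X)"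
    by simp
qed

text \<open>A von Neumann algebra that contains \<open>X\<close> is its own bicommutant, hence contains the one of \<open>X\<close>,
  which is itself a von Neumann algebra because \<open>X\<close> is closed under adjoints.\<close>

lemma vn_generated_eq_bicommutant:
  assumes X: "X \<subseteq> bounded_ops S" "\<And>x. x \<in> X \<Longrightarrow> op_adj S x \<in> X"
  shows "vn_generated S X = commutant S (commutant S X)"
  unfolding vn_generated_def
proof (intro antisym Inter_lower Inter_greatest)
  show "commutant S (commutant S X) \<in> {M. von_neumann_algebra S M \<and> X \<subseteq> M}"
    using bicommutant_von_neumann[OF X] bicommutant_superset[OF X(1)] by simp
  fix M assume "M \<in> {M. von_neumann_algebra S M \<and> X \<subseteq> M}"
  then have "commutant S (commutant S M) = M" "X \<subseteq> M"
    by (auto simp: von_neumann_algebra_def)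
  then show "commutant S (commutant S X) \<subseteq> M"
    using commutant_antimono[OF commutant_antimono[OF \<open>X \<subseteq> M\<close>]] by metis
qed

section \<open>Group von Neumann algebras as algebras of convolution operators\<close>

lemma bops_has_sum_on:
  assumes "x \<in> bounded_ops S" "f \<in> l2 S" "t \<in> S"
  shows "((\<lambda>a. f a * x (delta a) t) has_sum x f t) S"
proof -
  have "((\<lambda>a. f a * x (delta a) t) has_sum x f t) UNIV \<longleftrightarrow> ?thesis"
    using l2_outside[OF assms(2)] by (intro has_sum_cong_neutral) auto
  then show ?thesis using bops_has_sum[OF assms] by blast
qed

lemma cutoff_delta: "cutoff C (delta s) = (if s \<in> C then delta s else 0)"
  by (auto simp: cutoff_def delta_def fun_eq_iff fun_apply)

text \<open>Left and right translations are both composition with a bijection of the index set.\<close>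

definition perm_op :: "'s set \<Rightarrow> ('s \<Rightarrow> 's) \<Rightarrow> 's l2_op" where
  "perm_op S \<pi> = (\<lambda>f. if f \<in> l2 S then (\<lambda>s. if s \<in> S then f (\<pi> s) else 0) else 0)"

context
  fixes S :: "'s set" and \<pi> :: "'s \<Rightarrow> 's"
  assumes bij: "bij_betw \<pi> S S"
begin

lemma perm_op_l2 [simp]: "perm_op S \<pi> f \<in> l2 S"
proof (cases "f \<in> l2 S")
  case True
  have "(\<lambda>s. (cmod (f (\<pi> s)))\<^sup>2) summable_on S"
    using summable_on_reindex_bij_betw[OF bij, of "\<lambda>s. (cmod (f s))\<^sup>2"] l2_summable[OF True, of S] by simp
  then show ?thesis
    using True by (auto simp: perm_op_def l2_def cong: summable_on_cong)
qed (auto simp: perm_op_def)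

lemma norm_perm_op [simp]:
  assumes "f \<in> l2 S"
  shows "l2_norm (perm_op S \<pi> f) = l2_norm f"
proof -
  have on: "(l2_norm g)\<^sup>2 = (\<Sum>\<^sub>\<infinity>s\<in>S. (cmod (g s))\<^sup>2)" if "g \<in> l2 S" for g
    unfolding l2_norm_sq by (rule infsum_cong_neutral) (use l2_outside[OF that] in auto)
  have "(l2_norm (perm_op S \<pi> f))\<^sup>2 = (\<Sum>\<^sub>\<infinity>s\<in>S. (cmod (f (\<pi> s)))\<^sup>2)"
    unfolding on[OF perm_op_l2] by (rule infsum_cong) (use assms in \<open>auto simp: perm_op_def\<close>)
  also have "\<dots> = (l2_norm f)\<^sup>2"
    unfolding on[OF assms] by (rule infsum_reindex_bij_betw[OF bij])
  finally show ?thesis by simp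
qed

lemma perm_op_bops [simp]: "perm_op S \<pi> \<in> bounded_ops S"
proof (rule bopsI[where C = 1])
  fix f g assume "f \<in> l2 S" "g \<in> l2 S"
  then show "perm_op S \<pi> (f + g) = perm_op S \<pi> f + perm_op S \<pi> g"
    by (auto simp: perm_op_def fun_eq_iff plus_fun_apply)
next
  fix c f assume "f \<in> l2 S"
  then show "perm_op S \<pi> (vec_scale c f) = vec_scale c (perm_op S \<pi> f)"
    using scale_l2[of f S c] unfolding perm_op_def by (auto simp: fun_eq_iff vec_scale_def)
next
  show "perm_op S \<pi> f = 0" if "f \<notin> l2 S" for f
    using that by (simp add: perm_op_def)
qed auto

lemma perm_op_delta:
  assumes "t \<in> S"
  shows "perm_op S \<pi> (delta (\<pi> t)) = delta t"
proof -
  have "\<pi> t \<in> S" using bij assms bij_betwE by blast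
  moreover have "(\<pi> a = \<pi> t) = (a = t)" if "a \<in> S" for a
    using bij assms that by (metis bij_betw_inv_into_left)
  ultimately show ?thesis using assms by (simp add: perm_op_def) (auto simp: delta_def fun_eq_iff)
qed

end

definition right_regular :: "('g, 'm) monoid_scheme \<Rightarrow> 'g \<Rightarrow> 'g l2_op" where
  "right_regular G g = perm_op (carrier G) (\<lambda>s. s \<otimes>\<^bsub>G\<^esub> g)"

text \<open>The bounded operators of left convolution by a function supported in \<open>L\<close>, where the function is
  the image of the basis vector at the identity.\<close>

definition conv_ops :: "('g, 'm) monoid_scheme \<Rightarrow> 'g set \<Rightarrow> 'g l2_op set" where
  "conv_ops G L = {x \<in> bounded_ops (carrier G).
     (\<forall>s\<in>carrier G. \<forall>t\<in>carrier G. x (delta s) t = x (delta \<one>\<^bsub>G\<^esub>) (t \<otimes>\<^bsub>G\<^esub> inv\<^bsub>G\<^esub> s)) \<and>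
     (\<forall>t. t \<notin> L \<longrightarrow> x (delta \<one>\<^bsub>G\<^esub>) t = 0)}"

lemma conv_ops_bops: "x \<in> conv_ops G L \<Longrightarrow> x \<in> bounded_ops (carrier G)"
  by (simp add: conv_ops_def)

lemma conv_ops_support: "x \<in> conv_ops G L \<Longrightarrow> t \<notin> L \<Longrightarrow> x (delta \<one>\<^bsub>G\<^esub>) t = 0"
  by (simp add: conv_ops_def)

lemma conv_ops_entry:
  "x \<in> conv_ops G L \<Longrightarrow> s \<in> carrier G \<Longrightarrow> t \<in> carrier G \<Longrightarrow>
    x (delta s) t = x (delta \<one>\<^bsub>G\<^esub>) (t \<otimes>\<^bsub>G\<^esub> inv\<^bsub>G\<^esub> s)"
  by (simp add: conv_ops_def)

context group
begin

lemma inv_mult_cancel [simp]: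
  assumes "g \<in> carrier G" "s \<in> carrier G"
  shows "g \<otimes> (inv g \<otimes> s) = s" "inv g \<otimes> (g \<otimes> s) = s"
  using assms by (simp_all add: m_assoc[symmetric])

lemma left_regular_perm: "left_regular G g = perm_op (carrier G) (\<lambda>s. inv g \<otimes> s)"
  by (simp add: left_regular_def perm_op_def)

lemma bij_left_mult: "g \<in> carrier G \<Longrightarrow> bij_betw (\<lambda>s. g \<otimes> s) (carrier G) (carrier G)"
  by (rule bij_betw_byWitness[where f' = "\<lambda>s. inv g \<otimes> s"]) (auto simp: m_assoc[symmetric])

lemma bij_right_mult: "g \<in> carrier G \<Longrightarrow> bij_betw (\<lambda>s. s \<otimes> g) (carrier G) (carrier G)"
  by (rule bij_betw_byWitness[where f' = "\<lambda>s. s \<otimes> inv g"]) (auto simp: m_assoc)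

lemma left_regular_bops [simp]: "g \<in> carrier G \<Longrightarrow> left_regular G g \<in> bounded_ops (carrier G)"
  unfolding left_regular_perm by (intro perm_op_bops bij_left_mult inv_closed)

lemma right_regular_bops [simp]: "g \<in> carrier G \<Longrightarrow> right_regular G g \<in> bounded_ops (carrier G)"
  unfolding right_regular_def by (intro perm_op_bops bij_right_mult)

lemma norm_left_regular [simp]:
  "g \<in> carrier G \<Longrightarrow> f \<in> l2 (carrier G) \<Longrightarrow> l2_norm (left_regular G g f) = l2_norm f"
  unfolding left_regular_perm by (intro norm_perm_op bij_left_mult inv_closed)

lemma left_regular_delta [simp]:
  assumes "g \<in> carrier G" "s \<in> carrier G"
  shows "left_regular G g (delta s) = delta (g \<otimes> s)"
  using perm_op_delta[OF bij_left_mult[OF inv_closed[OF assms(1)]], of "g \<otimes> s"] assms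
  by (simp add: left_regular_perm m_assoc[symmetric])

lemma right_regular_delta [simp]:
  assumes "g \<in> carrier G" "s \<in> carrier G"
  shows "right_regular G g (delta s) = delta (s \<otimes> inv g)"
  using perm_op_delta[OF bij_right_mult[OF assms(1)], of "s \<otimes> inv g"] assms
  by (simp add: right_regular_def m_assoc)

lemma left_regular_apply:
  "f \<in> l2 (carrier G) \<Longrightarrow> s \<in> carrier G \<Longrightarrow> left_regular G g f s = f (inv g \<otimes> s)"
  by (simp add: left_regular_def)

lemma right_regular_apply:
  "f \<in> l2 (carrier G) \<Longrightarrow> s \<in> carrier G \<Longrightarrow> right_regular G g f s = f (s \<otimes> g)"
  by (simp add: right_regular_def perm_op_def)

lemma left_regular_mult:
  "g \<in> carrier G \<Longrightarrow> h \<in> carrier G \<Longrightarrow>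
    left_regular G g \<circ> left_regular G h = left_regular G (g \<otimes> h)"
  by (rule bops_eqI[where S = "carrier G"]) (auto simp: m_assoc)

lemma left_regular_one [simp]: "left_regular G \<one> = op_id (carrier G)"
  by (rule bops_eqI[where S = "carrier G"]) auto

lemma left_regular_adj [simp]:
  assumes "g \<in> carrier G"
  shows "op_adj (carrier G) (left_regular G g) = left_regular G (inv g)"
proof (rule bops_eqI[where S = "carrier G"])
  fix s t assume s: "s \<in> carrier G" and t: "t \<in> carrier G"
  have "(s = g \<otimes> t) = (t = inv g \<otimes> s)"
    using assms s t by (metis inv_solve_left)
  then show "op_adj (carrier G) (left_regular G g) (delta s) t = left_regular G (inv g) (delta s) t"
    using assms s t by (simp add: adj_delta) (simp add: delta_def)
qed (use assms in auto)

lemma left_regular_adj_closed: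
  assumes "subgroup L G" "x \<in> left_regular G ` L"
  shows "op_adj (carrier G) x \<in> left_regular G ` L"
  using assms by (auto simp: subgroup.mem_carrier[OF assms(1)] subgroup.m_inv_closed)

lemma left_regular_image_bops: "subgroup L G \<Longrightarrow> left_regular G ` L \<subseteq> bounded_ops (carrier G)"
  using subgroup.mem_carrier by fastforce

lemma VN_sub_bicommutant:
  assumes "subgroup L G"
  shows "VN_sub G L = commutant (carrier G) (commutant (carrier G) (left_regular G ` L))"
  unfolding VN_sub_def
  by (rule vn_generated_eq_bicommutant[OF left_regular_image_bops[OF assms] left_regular_adj_closed[OF assms]])

lemma VN_sub_von_neumann: "subgroup L G \<Longrightarrow> von_neumann_algebra (carrier G) (VN_sub G L)"
  unfolding VN_sub_bicommutant
  by (rule bicommutant_von_neumann[OF left_regular_image_bops left_regular_adj_closed])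

lemma right_regular_commutant:
  assumes "L \<subseteq> carrier G" "g \<in> carrier G"
  shows "right_regular G g \<in> commutant (carrier G) (left_regular G ` L)"
proof -
  have "left_regular G l \<circ> right_regular G g = right_regular G g \<circ> left_regular G l" if "l \<in> L" for l
  proof (rule bops_eqI[where S = "carrier G"])
    have "l \<in> carrier G" using that assms by auto
    then show "left_regular G l \<circ> right_regular G g \<in> bounded_ops (carrier G)"
      "right_regular G g \<circ> left_regular G l \<in> bounded_ops (carrier G)"
      "\<And>s t. s \<in> carrier G \<Longrightarrow> (left_regular G l \<circ> right_regular G g) (delta s) t
        = (right_regular G g \<circ> left_regular G l) (delta s) t"
      using assms by (auto simp: m_assoc)
  qed
  then show ?thesis using assms by (auto simp: commutant_def)
qed

lemma subgroup_mult_iff: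
  assumes L: "subgroup L G" and l: "l \<in> L" and s: "s \<in> carrier G"
  shows "l \<otimes> s \<in> L \<longleftrightarrow> s \<in> L"
proof
  assume "l \<otimes> s \<in> L"
  then have "inv l \<otimes> (l \<otimes> s) \<in> L"
    by (rule subgroup.m_closed[OF L subgroup.m_inv_closed[OF L l]])
  then show "s \<in> L"
    using s subgroup.mem_carrier[OF L l] by (simp add: m_assoc[symmetric])
qed (use L l in \<open>simp add: subgroup.m_closed\<close>)

text \<open>The commutant of the translations by \<open>L\<close> contains the projections onto functions supported in a
  union of right cosets of \<open>L\<close>.  For \<open>C = L\<close> this is what bounds the support of symbols.\<close>

lemma cutoff_commutant:
  assumes "L \<subseteq> carrier G" "\<And>l s. l \<in> L \<Longrightarrow> s \<in> carrier G \<Longrightarrow> l \<otimes> s \<in> C \<longleftrightarrow> s \<in> C"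
  shows "cutoff_op (carrier G) C \<in> commutant (carrier G) (left_regular G ` L)"
proof -
  have "left_regular G l \<circ> cutoff_op (carrier G) C = cutoff_op (carrier G) C \<circ> left_regular G l"
    if "l \<in> L" for l
  proof (rule bops_eqI[where S = "carrier G"])
    have l: "l \<in> carrier G" using that assms by auto
    then show "left_regular G l \<circ> cutoff_op (carrier G) C \<in> bounded_ops (carrier G)"
      "cutoff_op (carrier G) C \<circ> left_regular G l \<in> bounded_ops (carrier G)"
      by auto
    show "(left_regular G l \<circ> cutoff_op (carrier G) C) (delta s) t
        = (cutoff_op (carrier G) C \<circ> left_regular G l) (delta s) t" if "s \<in> carrier G" for s t
      using l that assms(2)[OF \<open>l \<in> L\<close> that] bops_zero[OF left_regular_bops[OF l]]
      by (auto simp: cutoff_op_def cutoff_delta)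
  qed
  then show ?thesis by (auto simp: commutant_def)
qed

text \<open>An element of the bicommutant commutes with right translations, which forces its matrix to be
  \<open>\<xi>(ts\<^sup>-\<^sup>1)\<close>, and with the restriction to \<open>L\<close>, which forces \<open>\<xi>\<close> to live on \<open>L\<close>.  Conversely let \<open>x\<close> be
  such a convolution operator and let \<open>y\<close> commute with the translations by \<open>L\<close>.  Expanding \<open>y x\<close> in
  columns of \<open>y\<close> and using \<open>y \<delta>\<^sub>k\<^sub>s = \<lambda>(k) y \<delta>\<^sub>s\<close> for \<open>k\<close> in \<open>L\<close>, the matrix entries of \<open>y x\<close> and of
  \<open>x y\<close> become the same series \<open>\<Sum>\<^sub>k \<xi>(k) (y \<delta>\<^sub>s)(k\<^sup>-\<^sup>1t)\<close>.\<close>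

lemma VN_sub_eq_conv_ops:
  assumes L: "subgroup L G"
  shows "VN_sub G L = conv_ops G L"
proof -
  let ?S = "carrier G" and ?X = "left_regular G ` L"
  have LS: "L \<subseteq> ?S" by (rule subgroup.subset[OF L])
  have "x \<in> conv_ops G L" if x: "x \<in> commutant ?S (commutant ?S ?X)" for x
  proof -
    have xb: "x \<in> bounded_ops ?S" using x by (rule commutantD)
    have "x (delta s) t = x (delta \<one>) (t \<otimes> inv s)" if "s \<in> ?S" "t \<in> ?S" for s t
    proof -
      have "x (delta s) = (x \<circ> right_regular G (inv s)) (delta \<one>)"
        using that by simp
      also have "\<dots> = (right_regular G (inv s) \<circ> x) (delta \<one>)"
        using commutant_commute[OF right_regular_commutant[OF LS inv_closed[OF that(1)]] x] by simp
      finally show ?thesis using that bops_l2[OF xb] by (simp add: right_regular_apply)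
    qed
    moreover have "x (delta \<one>) t = 0" if "t \<notin> L" for t
    proof -
      have "cutoff_op ?S L \<in> commutant ?S ?X"
        by (rule cutoff_commutant[OF LS subgroup_mult_iff[OF L]])
      then have "cutoff_op ?S L (x (delta \<one>)) = x (cutoff_op ?S L (delta \<one>))"
        by (rule commutant_commute_apply[OF _ x])
      then have "cutoff L (x (delta \<one>)) = x (delta \<one>)"
        using subgroup.one_closed[OF L] bops_l2[OF xb] by (simp add: cutoff_op_def cutoff_delta)
      then show ?thesis using that by (metis cutoff_def)
    qed
    ultimately show ?thesis using xb unfolding conv_ops_def by blast
  qed
  moreover have "x \<in> commutant ?S (commutant ?S ?X)" if x: "x \<in> conv_ops G L" for x
  proof -
    have xb: "x \<in> bounded_ops ?S" using x by (rule conv_ops_bops)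
    define \<xi> where "\<xi> = x (delta \<one>)"
    have xe: "x (delta s) t = \<xi> (t \<otimes> inv s)" if "s \<in> ?S" "t \<in> ?S" for s t
      using conv_ops_entry[OF x that] by (simp add: \<xi>_def)
    have "y \<circ> x = x \<circ> y" if y: "y \<in> commutant ?S ?X" for y
    proof (rule bops_eqI[where S = ?S])
      have yb: "y \<in> bounded_ops ?S" using y by (rule commutantD)
      show "y \<circ> x \<in> bounded_ops ?S" "x \<circ> y \<in> bounded_ops ?S" using xb yb by auto
      fix s t assume s: "s \<in> ?S" and t: "t \<in> ?S"
      \<comment> \<open>both entries as series over columns; \<open>b = t a\<^sup>-\<^sup>1 s\<close> turns the second series into the first\<close>
      have "((\<lambda>a. y (delta s) a * x (delta a) t) has_sum x (y (delta s)) t) ?S"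
        using s t xb yb by (intro bops_has_sum_on) auto
      then have 1: "((\<lambda>a. y (delta s) a * \<xi> (t \<otimes> inv a)) has_sum x (y (delta s)) t) ?S"
        by (rule iffD1[OF has_sum_cong, rotated]) (simp add: xe t)
      have "((\<lambda>b. x (delta s) b * y (delta b) t) has_sum y (x (delta s)) t) ?S"
        using s t xb yb by (intro bops_has_sum_on) auto
      moreover have "x (delta s) b * y (delta b) t = \<xi> (b \<otimes> inv s) * y (delta s) (s \<otimes> inv b \<otimes> t)"
        if b: "b \<in> ?S" for b
      proof (cases "b \<otimes> inv s \<in> L")
        case False
        then have "\<xi> (b \<otimes> inv s) = 0" using conv_ops_support[OF x] by (simp add: \<xi>_def)
        then show ?thesis using xe[OF s b] by simp
      next
        case True
        have "left_regular G (b \<otimes> inv s) (y (delta s)) = y (left_regular G (b \<otimes> inv s) (delta s))"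
          by (rule commutant_commute_apply[OF imageI[OF True] y])
        also have "\<dots> = y (delta b)" using b s by (simp add: m_assoc)
        finally have "y (delta b) t = left_regular G (b \<otimes> inv s) (y (delta s)) t"
          by simp
        then have "y (delta b) t = y (delta s) (inv (b \<otimes> inv s) \<otimes> t)"
          using left_regular_apply[OF bops_l2[OF yb] t] by simp
        then show ?thesis using xe[OF s b] b s by (simp add: inv_mult_group)
      qed
      ultimately have "((\<lambda>b. \<xi> (b \<otimes> inv s) * y (delta s) (s \<otimes> inv b \<otimes> t)) has_sum y (x (delta s)) t) ?S"
        by (rule iffD1[OF has_sum_cong, rotated])
      moreover have "((\<lambda>b. \<xi> (b \<otimes> inv s) * y (delta s) (s \<otimes> inv b \<otimes> t)) has_sum y (x (delta s)) t) ?S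
          \<longleftrightarrow> ((\<lambda>a. y (delta s) a * \<xi> (t \<otimes> inv a)) has_sum y (x (delta s)) t) ?S"
      proof (rule has_sum_reindex_bij_witness[where i = "\<lambda>a. t \<otimes> inv a \<otimes> s" and j = "\<lambda>b. s \<otimes> inv b \<otimes> t"])
      qed (use s t in \<open>auto simp: inv_mult_group m_assoc inv_solve_left inv_solve_right'\<close>)
      ultimately have "x (y (delta s)) t = y (x (delta s)) t"
        using 1 has_sum_unique by blast
      then show "(y \<circ> x) (delta s) t = (x \<circ> y) (delta s) t" by simp
    qed
    then show ?thesis using xb unfolding commutant_def[of _ "commutant ?S ?X"] by auto
  qed
  ultimately show ?thesis unfolding VN_sub_bicommutant[OF L] by blast
qed

end

section \<open>Filters along which group elements escape\<close>

text \<open>The complements in \<open>S\<close> of finite unions of members of \<open>\<B>\<close> are closed under finite intersection and,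
  by hypothesis, nonempty; they generate the filter.\<close>

lemma avoiding_filter:
  assumes "\<And>\<C>. finite \<C> \<Longrightarrow> \<C> \<subseteq> \<B> \<Longrightarrow> \<not> S \<subseteq> \<Union>\<C>"
  obtains \<F> where "\<F> \<noteq> bot" "eventually (\<lambda>g. g \<in> S) \<F>"
    "\<And>B. B \<in> \<B> \<Longrightarrow> eventually (\<lambda>g. g \<notin> B) \<F>"
proof -
  define I where "I = {\<C>. finite \<C> \<and> \<C> \<subseteq> \<B>}"
  define \<F> where "\<F> = (INF \<C>\<in>I. principal (S - \<Union>\<C>))"
  have ev: "eventually P \<F>" if "\<C> \<in> I" "\<And>g. g \<in> S - \<Union>\<C> \<Longrightarrow> P g" for \<C> P
    unfolding \<F>_def by (rule eventually_INF1[OF that(1)]) (use that(2) in \<open>auto simp: eventually_principal\<close>)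
  have "\<F> \<noteq> bot"
    unfolding \<F>_def
  proof (subst INF_filter_bot_base)
    fix \<C> \<D> assume "\<C> \<in> I" "\<D> \<in> I"
    then show "\<exists>\<E>\<in>I. principal (S - \<Union>\<E>) \<le> inf (principal (S - \<Union>\<C>)) (principal (S - \<Union>\<D>))"
      by (intro bexI[of _ "\<C> \<union> \<D>"]) (auto simp: I_def)
  next
    show "\<not> (\<exists>\<C>\<in>I. principal (S - \<Union>\<C>) = bot)"
      using assms by (auto simp: I_def principal_eq_bot_iff)
  qed
  moreover have "eventually (\<lambda>g. g \<in> S) \<F>"
    by (rule ev[of "{}"]) (auto simp: I_def)
  moreover have "eventually (\<lambda>g. g \<notin> B) \<F>" if "B \<in> \<B>" for B
    by (rule ev[of "{B}"]) (use that in \<open>auto simp: I_def\<close>)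
  ultimately show ?thesis using that by blast
qed

context group
begin

lemma conj_mult:
  assumes "g \<in> carrier G" "h \<in> carrier G" "x \<in> carrier G"
  shows "(g \<otimes> h) \<otimes> x \<otimes> inv (g \<otimes> h) = g \<otimes> (h \<otimes> x \<otimes> inv h) \<otimes> inv g"
  using assms by (simp add: m_assoc inv_mult_group)

text \<open>This is B. H. Neumann's theorem that finitely many cosets of subgroups of infinite index do not
  cover a group, for centralizers and phrased with orbits.  In the induction step choose a conjugate
  \<open>hxh\<^sup>-\<^sup>1\<close> of the new element \<open>x\<close> outside \<open>Y\<close>.  If \<open>gxg\<^sup>-\<^sup>1\<close> equals some \<open>y\<close> in \<open>Y\<close>, then for a fixed
  element \<open>k\<close> depending only on \<open>y\<close> the element \<open>k\<^sup>-\<^sup>1g\<close> conjugates \<open>x\<close> to \<open>hxh\<^sup>-\<^sup>1\<close>.  So if every group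
  element failed, then \<open>k\<^sup>-\<^sup>1g\<close> would conjugate some old element into \<open>Y\<close>, and \<open>g\<close> would conjugate
  it into \<open>kYk\<^sup>-\<^sup>1\<close>.  The induction hypothesis for \<open>Y\<close> enlarged by these finitely many conjugates excludes
  that.\<close>

lemma conjugates_avoid_finite_set:
  assumes "finite X" "X \<subseteq> carrier G" "\<And>x. x \<in> X \<Longrightarrow> infinite (conjugacy_class G x)" "finite Y"
  shows "\<exists>g\<in>carrier G. \<forall>x\<in>X. g \<otimes> x \<otimes> inv g \<notin> Y"
  using assms
proof (induction X arbitrary: Y rule: finite_induct)
  case empty
  then show ?case using one_closed by blast
next
  case (insert x X)
  have x: "x \<in> carrier G" using insert by auto
  define c where "c = (\<lambda>g x. g \<otimes> x \<otimes> inv g)"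
  have c_mult: "c (g \<otimes> h) y = c g (c h y)"
    if "g \<in> carrier G" "h \<in> carrier G" "y \<in> carrier G" for g h y
    using conj_mult[OF that] by (simp add: c_def)
  have c_closed: "c g y \<in> carrier G" if "g \<in> carrier G" "y \<in> carrier G" for g y
    using that by (simp add: c_def)
  have c_one: "c \<one> y = y" if "y \<in> carrier G" for y
    using that by (simp add: c_def)
  have "\<not> conjugacy_class G x \<subseteq> Y"
    using insert.prems finite_subset by blast
  then obtain h where h: "h \<in> carrier G" "c h x \<notin> Y"
    by (auto simp: conjugacy_class_def c_def)
  define k where "k = (\<lambda>y. (SOME g. g \<in> carrier G \<and> c g x = y) \<otimes> inv h)"
  have k: "k y \<in> carrier G \<and> c (inv (k y)) y = c h x" if "\<exists>g\<in>carrier G. c g x = y" for y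
  proof -
    define g where "g = (SOME g. g \<in> carrier G \<and> c g x = y)"
    have g: "g \<in> carrier G" "c g x = y"
      unfolding g_def using someI_ex[of "\<lambda>g. g \<in> carrier G \<and> c g x = y"] that by auto
    have "c (inv (g \<otimes> inv h)) y = c (inv (g \<otimes> inv h) \<otimes> g) x"
      using g h x by (simp add: c_mult)
    also have "inv (g \<otimes> inv h) \<otimes> g = h"
      using g h by (simp add: inv_mult_group m_assoc)
    finally show ?thesis using g h by (simp add: k_def g_def[symmetric])
  qed
  \<comment> \<open>\<open>Y\<close> together with the conjugates that the induction hypothesis has to avoid\<close>
  define Y' where "Y' = Y \<union> (\<Union>y\<in>Y. c (k y) ` Y)"
  have "finite Y'" using insert.prems by (simp add: Y'_def)
  then obtain g where g: "g \<in> carrier G" "\<And>x'. x' \<in> X \<Longrightarrow> c g x' \<notin> Y'"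
    using insert.IH[of Y'] insert.prems by (auto simp: c_def)
  show ?case
  proof (rule ccontr)
    assume "\<not> ?thesis"
    then have bad: "\<exists>x'\<in>insert x X. c g' x' \<in> Y" if "g' \<in> carrier G" for g'
      using that by (auto simp: c_def)
    then have y: "c g x \<in> Y" using g by (force simp: Y'_def)
    define l where "l = k (c g x)"
    have l: "l \<in> carrier G" "c (inv l) (c g x) = c h x"
      using k[of "c g x"] g(1) by (auto simp: l_def)
    then have "c (inv l \<otimes> g) x \<notin> Y"
      using h g x by (simp add: c_mult)
    then obtain x' where x': "x' \<in> X" "c (inv l \<otimes> g) x' \<in> Y"
      using bad[of "inv l \<otimes> g"] l g by auto
    then have x'G: "x' \<in> carrier G" using insert.prems by auto
    have "c g x' = c l (c (inv l \<otimes> g) x')"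
      using c_mult[of l "inv l \<otimes> g" x'] l g x'G by simp
    then have "c g x' \<in> Y'"
      using x' y by (auto simp: Y'_def l_def)
    then show False using g x' by blast
  qed
qed

text \<open>Weak mixing of the conjugation action: along the filter all elements other than the identity are
  conjugated away simultaneously.\<close>

lemma ICC_filter:
  assumes "ICC G"
  obtains \<F> where "\<F> \<noteq> bot" "eventually (\<lambda>g. g \<in> carrier G) \<F>"
    "\<And>s t. s \<in> carrier G \<Longrightarrow> s \<noteq> \<one> \<Longrightarrow> eventually (\<lambda>g. g \<otimes> s \<otimes> inv g \<noteq> t) \<F>"
proof -
  \<comment> \<open>the sets of group elements that the filter has to leave\<close>
  define B where "B = (\<lambda>(s, t). {g. g \<otimes> s \<otimes> inv g = t})"
  define I where "I = (carrier G - {\<one>}) \<times> (UNIV :: 'a set)"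
  have "\<not> carrier G \<subseteq> \<Union>\<C>" if \<C>: "finite \<C>" "\<C> \<subseteq> B ` I" for \<C>
  proof -
    obtain J where J: "finite J" "J \<subseteq> I" "\<C> = B ` J"
      using finite_subset_image[OF \<C>] by blast
    have "\<exists>g\<in>carrier G. \<forall>x\<in>fst ` J. g \<otimes> x \<otimes> inv g \<notin> snd ` J"
      using J assms by (intro conjugates_avoid_finite_set) (auto simp: ICC_def I_def)
    then show ?thesis unfolding J(3) by (force simp: B_def)
  qed
  then obtain \<F> where "\<F> \<noteq> bot" "eventually (\<lambda>g. g \<in> carrier G) \<F>"
      "\<And>C. C \<in> B ` I \<Longrightarrow> eventually (\<lambda>g. g \<notin> C) \<F>"
    using avoiding_filter[of "B ` I" "carrier G"] by blast
  moreover from this(3) have "eventually (\<lambda>g. g \<otimes> s \<otimes> inv g \<noteq> t) \<F>"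
    if "s \<in> carrier G" "s \<noteq> \<one>" for s t
    using that by (force simp: B_def I_def)
  ultimately show ?thesis using that by blast
qed

end

text \<open>The indices \<open>u i\<close> leave the finite set outside of which \<open>f\<close> is small.\<close>

lemma l2_tendsto_0:
  assumes f: "f \<in> l2 S" and u: "\<And>t. eventually (\<lambda>i. u i \<noteq> t) \<F>"
  shows "((\<lambda>i. f (u i)) \<longlongrightarrow> 0) \<F>"
proof (rule tendstoI)
  fix e :: real assume "e > 0"
  then obtain F where F: "finite F" "l2_norm (f - cutoff F f) < e"
    using cutoff_finite_approx[OF f] by blast
  have "cmod (f a) < e" if "a \<notin> F" for a
    using cmod_le_norm[of "f - cutoff F f" S a] f F that by (simp add: minus_apply cutoff_outside)
  moreover have "eventually (\<lambda>i. \<forall>t\<in>F. u i \<noteq> t) \<F>"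
    using F u by (simp add: eventually_ball_finite_distrib)
  ultimately show "eventually (\<lambda>i. dist (f (u i)) 0 < e) \<F>"
    by (auto elim!: eventually_mono)
qed

lemma l2_seminorm_functional:
  assumes "\<And>f g. f \<in> l2 S \<Longrightarrow> g \<in> l2 S \<Longrightarrow> \<Phi> (f + g) = \<Phi> f + \<Phi> g"
    and "\<And>c f. f \<in> l2 S \<Longrightarrow> cmod (\<Phi> (vec_scale c f)) = cmod c * cmod (\<Phi> f)"
    and "\<And>f. f \<in> l2 S \<Longrightarrow> cmod (\<Phi> f) \<le> C * l2_norm f"
  shows "l2_seminorm S C (\<lambda>f. cmod (\<Phi> f))"
  using assms by (auto simp: l2_seminorm_def norm_triangle_ineq)

text \<open>Density is used twice: convergence of the entries is extended first to all test vectors \<open>h\<close> for a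
  fixed column and then to all vectors \<open>f\<close>.\<close>

lemma weakly_null:
  assumes D: "eventually (\<lambda>i. D i \<in> bounded_ops S \<and> (\<forall>f\<in>l2 S. l2_norm (D i f) \<le> C * l2_norm f)) \<F>"
    and entries: "\<And>s t. s \<in> S \<Longrightarrow> t \<in> S \<Longrightarrow> ((\<lambda>i. D i (delta s) t) \<longlongrightarrow> 0) \<F>"
    and f: "f \<in> l2 S" and h: "h \<in> l2 S"
  shows "((\<lambda>i. l2_inner (D i f) h) \<longlongrightarrow> 0) \<F>"
proof -
  have bound: "cmod (l2_inner (D i f) h) \<le> C * l2_norm f * l2_norm h"
    if "D i \<in> bounded_ops S \<and> (\<forall>f\<in>l2 S. l2_norm (D i f) \<le> C * l2_norm f)" "f \<in> l2 S" "h \<in> l2 S" for i f h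
    using cauchy_schwarz[of "D i f" S h] mult_right_mono[of "l2_norm (D i f)" "C * l2_norm f" "l2_norm h"] that
    by (simp add: order_trans)
  \<comment> \<open>the first extension, from the entries of the column at \<open>s\<close> to all test vectors\<close>
  have column: "((\<lambda>i. cmod (l2_inner (D i (delta s)) h)) \<longlongrightarrow> 0) \<F>" if s: "s \<in> S" for s
  proof (rule seminorms_tendsto_0[where A = S and S = S and C = C])
    show "eventually (\<lambda>i. l2_seminorm S C (\<lambda>h. cmod (l2_inner (D i (delta s)) h))) \<F>"
      using D
    proof (rule eventually_mono)
      fix i assume i: "D i \<in> bounded_ops S \<and> (\<forall>f\<in>l2 S. l2_norm (D i f) \<le> C * l2_norm f)"
      then have "D i (delta s) \<in> l2 S" by simp
      then show "l2_seminorm S C (\<lambda>h. cmod (l2_inner (D i (delta s)) h))"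
        using bound[OF i delta_l2[OF s]]
        by (intro l2_seminorm_functional) (auto simp: inner_add_right[of _ S] inner_scale_right norm_mult)
    qed
    show "((\<lambda>i. cmod (l2_inner (D i (delta s)) (delta t))) \<longlongrightarrow> 0) \<F>" if "t \<in> S" for t
      using entries[OF s that] by (simp add: tendsto_norm_zero)
  qed (use h l2_outside[OF h] in auto)
  have "((\<lambda>i. cmod (l2_inner (D i f) h)) \<longlongrightarrow> 0) \<F>"
  proof (rule seminorms_tendsto_0[where p = "\<lambda>i f. cmod (l2_inner (D i f) h)" and C = "C * l2_norm h",
        OF _ column f l2_outside[OF f] subset_refl])
    show "eventually (\<lambda>i. l2_seminorm S (C * l2_norm h) (\<lambda>f. cmod (l2_inner (D i f) h))) \<F>"
      using D
    proof (rule eventually_mono)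
      fix i assume i: "D i \<in> bounded_ops S \<and> (\<forall>f\<in>l2 S. l2_norm (D i f) \<le> C * l2_norm f)"
      then have Di: "D i \<in> bounded_ops S" by simp
      show "l2_seminorm S (C * l2_norm h) (\<lambda>f. cmod (l2_inner (D i f) h))"
        using bound[OF i _ h] bops_l2[OF Di] h
        by (intro l2_seminorm_functional)
           (auto simp: bops_add[OF Di] bops_scale[OF Di] inner_add_left[of _ S] inner_scale_left norm_mult mult_ac)
    qed
  qed
  then show ?thesis by (rule tendsto_norm_zero_cancel)
qed

section \<open>The trace\<close>

context group
begin

lemma VN_eq_conv_ops: "VN G = conv_ops G (carrier G)"
  unfolding VN_def by (rule VN_sub_eq_conv_ops[OF subgroup_self])

context
  fixes L assumes L: "subgroup L G"
begin

lemma conv_ops_bicommutant: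
  "conv_ops G L = commutant (carrier G) (commutant (carrier G) (left_regular G ` L))"
  using VN_sub_bicommutant[OF L] VN_sub_eq_conv_ops[OF L] by simp

lemma conv_ops_id: "op_id (carrier G) \<in> conv_ops G L"
  unfolding conv_ops_bicommutant by (rule commutant_id[OF commutant_bops])

lemma conv_ops_comp: "x \<in> conv_ops G L \<Longrightarrow> y \<in> conv_ops G L \<Longrightarrow> x \<circ> y \<in> conv_ops G L"
  unfolding conv_ops_bicommutant by (rule commutant_comp)

lemma conv_ops_add: "x \<in> conv_ops G L \<Longrightarrow> y \<in> conv_ops G L \<Longrightarrow> x + y \<in> conv_ops G L"
  unfolding conv_ops_bicommutant by (rule commutant_add[OF commutant_bops])

lemma conv_ops_diff: "x \<in> conv_ops G L \<Longrightarrow> y \<in> conv_ops G L \<Longrightarrow> x - y \<in> conv_ops G L"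
  unfolding conv_ops_bicommutant by (rule commutant_diff[OF commutant_bops])

lemma conv_ops_scale: "x \<in> conv_ops G L \<Longrightarrow> op_scale c x \<in> conv_ops G L"
  unfolding conv_ops_bicommutant by (rule commutant_scale[OF commutant_bops])

lemma conv_ops_adj: "x \<in> conv_ops G L \<Longrightarrow> op_adj (carrier G) x \<in> conv_ops G L"
  using VN_sub_von_neumann[OF L] VN_sub_eq_conv_ops[OF L] by (simp add: von_neumann_algebra_def)

lemma left_regular_conv_ops: "l \<in> L \<Longrightarrow> left_regular G l \<in> conv_ops G L"
  unfolding conv_ops_bicommutant
  using bicommutant_superset[OF left_regular_image_bops[OF L]] by blast

end

lemma conv_ops_mono: "L \<subseteq> L' \<Longrightarrow> conv_ops G L \<subseteq> conv_ops G L'"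
  by (auto simp: conv_ops_def)

lemma conv_ops_eqI:
  assumes "x \<in> conv_ops G L" "y \<in> conv_ops G L'" "x (delta \<one>) = y (delta \<one>)"
  shows "x = y"
proof (rule bops_eqI[OF conv_ops_bops[OF assms(1)] conv_ops_bops[OF assms(2)]])
  show "x (delta s) t = y (delta s) t" if "s \<in> carrier G" "t \<in> carrier G" for s t
    using conv_ops_entry[OF assms(1) that] conv_ops_entry[OF assms(2) that] assms(3) by simp
qed

text \<open>This is \<open>VN G\<close> in its concrete form.\<close>

abbreviation "M \<equiv> conv_ops G (carrier G)"

lemmas M_id = conv_ops_id[OF subgroup_self]
  and M_comp = conv_ops_comp[OF subgroup_self]
  and M_add = conv_ops_add[OF subgroup_self]
  and M_diff = conv_ops_diff[OF subgroup_self]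
  and M_scale = conv_ops_scale[OF subgroup_self]
  and M_adj = conv_ops_adj[OF subgroup_self]
  and M_left_regular = left_regular_conv_ops[OF subgroup_self]

text \<open>Both sides are the pairing \<open>\<Sum>\<^sub>a y(a) x(a\<^sup>-\<^sup>1)\<close> of the two symbols, which is symmetric under
  \<open>a \<mapsto> a\<^sup>-\<^sup>1\<close>.\<close>

lemma tau_comm:
  assumes x: "x \<in> M" and y: "y \<in> M"
  shows "x (y (delta \<one>)) \<one> = y (x (delta \<one>)) \<one>"
proof -
  have *: "((\<lambda>a. y (delta \<one>) a * x (delta \<one>) (inv a)) has_sum x (y (delta \<one>)) \<one>) (carrier G)"
    if x: "x \<in> M" and y: "y \<in> M" for x y
  proof -
    have "((\<lambda>a. y (delta \<one>) a * x (delta a) \<one>) has_sum x (y (delta \<one>)) \<one>) (carrier G)"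
      using conv_ops_bops[OF x] conv_ops_bops[OF y] by (intro bops_has_sum_on) auto
    moreover have "x (delta a) \<one> = x (delta \<one>) (inv a)" if "a \<in> carrier G" for a
      using conv_ops_entry[OF x that one_closed] that by simp
    then have "((\<lambda>a. y (delta \<one>) a * x (delta a) \<one>) has_sum x (y (delta \<one>)) \<one>) (carrier G)
      \<longleftrightarrow> ((\<lambda>a. y (delta \<one>) a * x (delta \<one>) (inv a)) has_sum x (y (delta \<one>)) \<one>) (carrier G)"
      by (intro has_sum_cong) simp
    ultimately show ?thesis by blast
  qed
  have "((\<lambda>a. y (delta \<one>) a * x (delta \<one>) (inv a)) has_sum x (y (delta \<one>)) \<one>) (carrier G)
    \<longleftrightarrow> ((\<lambda>a. x (delta \<one>) a * y (delta \<one>) (inv a)) has_sum x (y (delta \<one>)) \<one>) (carrier G)"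
    by (rule has_sum_reindex_bij_witness[where i = "\<lambda>a. inv a" and j = "\<lambda>a. inv a"]) auto
  then show ?thesis
    using *[OF x y] *[OF y x] has_sum_unique by blast
qed

lemma tau_square:
  assumes "x \<in> M"
  shows "op_adj (carrier G) x (x (delta \<one>)) \<one> = of_real ((l2_norm (x (delta \<one>)))\<^sup>2)"
  using norm_sq_via_adj[OF conv_ops_bops[OF assms], of "delta \<one>"] by simp

lemma conjugate_in_M: "x \<in> M \<Longrightarrow> g \<in> carrier G \<Longrightarrow> left_regular G (inv g) \<circ> x \<circ> left_regular G g \<in> M"
  by (intro M_comp M_left_regular) auto

lemma conjugate_entry:
  assumes x: "x \<in> M" and g: "g \<in> carrier G" and s: "s \<in> carrier G" and t: "t \<in> carrier G"
  shows "(left_regular G (inv g) \<circ> x \<circ> left_regular G g) (delta s) t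
    = x (delta \<one>) (g \<otimes> (t \<otimes> inv s) \<otimes> inv g)"
proof -
  have "(left_regular G (inv g) \<circ> x \<circ> left_regular G g) (delta s) t = x (delta (g \<otimes> s)) (g \<otimes> t)"
    using assms bops_l2[OF conv_ops_bops[OF x]] by (simp add: left_regular_apply)
  also have "\<dots> = x (delta \<one>) (g \<otimes> t \<otimes> inv (g \<otimes> s))"
    using assms by (intro conv_ops_entry[OF x]) auto
  finally show ?thesis using assms by (simp add: inv_mult_group m_assoc)
qed

lemma norm_conjugate:
  assumes x: "x \<in> bounded_ops (carrier G)" and C: "\<And>f. f \<in> l2 (carrier G) \<Longrightarrow> l2_norm (x f) \<le> C * l2_norm f"
    and g: "g \<in> carrier G" and f: "f \<in> l2 (carrier G)"
  shows "l2_norm ((left_regular G (inv g) \<circ> x \<circ> left_regular G g) f) \<le> C * l2_norm f"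
  using C[of "left_regular G g f"] g f x by simp

text \<open>The matrix entry of the conjugate at \<open>(s, t)\<close> is the symbol of \<open>x\<close> at \<open>g (ts\<^sup>-\<^sup>1) g\<^sup>-\<^sup>1\<close>: it is constant for
  \<open>s = t\<close> and tends to zero otherwise.  The conjugates are uniformly bounded, so subtracting the
  scalar leaves a weakly null family.\<close>

lemma conjugates_tendsto_tau:
  assumes ev: "eventually (\<lambda>g. g \<in> carrier G) \<F>"
    and esc: "\<And>s t. s \<in> carrier G \<Longrightarrow> s \<noteq> \<one> \<Longrightarrow> eventually (\<lambda>g. g \<otimes> s \<otimes> inv g \<noteq> t) \<F>"
    and x: "x \<in> M" and f: "f \<in> l2 (carrier G)" and h: "h \<in> l2 (carrier G)"
  shows "((\<lambda>g. l2_inner ((left_regular G (inv g) \<circ> x \<circ> left_regular G g) f) h)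
           \<longlongrightarrow> x (delta \<one>) \<one> * l2_inner f h) \<F>"
proof -
  let ?S = "carrier G"
  define c where "c = x (delta \<one>) \<one>"
  define X where "X = (\<lambda>g. left_regular G (inv g) \<circ> x \<circ> left_regular G g)"
  define D where "D = (\<lambda>g. X g - op_scale c (op_id ?S))"
  have xb: "x \<in> bounded_ops ?S" by (rule conv_ops_bops[OF x])
  obtain C where C: "C \<ge> 0" "\<And>f. f \<in> l2 ?S \<Longrightarrow> l2_norm (x f) \<le> C * l2_norm f"
    by (rule bops_bound[OF xb], rule that)
  have Xb: "X g \<in> bounded_ops ?S" if "g \<in> ?S" for g
    unfolding X_def using that xb by simp
  have Xn: "l2_norm (X g f) \<le> C * l2_norm f" if "g \<in> ?S" "f \<in> l2 ?S" for g f
    unfolding X_def by (rule norm_conjugate[OF xb C(2) that])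
  have Xe: "X g (delta s) t = x (delta \<one>) (g \<otimes> (t \<otimes> inv s) \<otimes> inv g)"
    if "g \<in> ?S" "s \<in> ?S" "t \<in> ?S" for g s t
    unfolding X_def by (rule conjugate_entry[OF x that])
  have Db: "D g \<in> bounded_ops ?S" if "g \<in> ?S" for g
    unfolding D_def using Xb[OF that] by simp
  have Dapp: "D g f = X g f - vec_scale c f" if "f \<in> l2 ?S" for f g
    using that by (simp add: D_def op_diff_apply op_scale_def)
  have Dn: "l2_norm (D g f) \<le> (C + cmod c) * l2_norm f" if g: "g \<in> ?S" and f: "f \<in> l2 ?S" for g f
  proof -
    have "l2_norm (X g f + vec_scale (- c) f) \<le> l2_norm (X g f) + l2_norm (vec_scale (- c) f)"
      using Xb[OF g] f by (intro l2_norm_triangle[of _ ?S]) auto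
    moreover have "X g f + vec_scale (- c) f = D g f"
      unfolding Dapp[OF f] by (simp add: vec_scale_def fun_eq_iff fun_apply)
    ultimately show ?thesis
      using Xn[OF g f] by (simp add: l2_norm_scale distrib_right)
  qed
  have "((\<lambda>g. l2_inner (D g f) h) \<longlongrightarrow> 0) \<F>"
  proof (rule weakly_null[OF _ _ f h])
    show "eventually (\<lambda>g. D g \<in> bounded_ops ?S \<and> (\<forall>f\<in>l2 ?S. l2_norm (D g f) \<le> (C + cmod c) * l2_norm f)) \<F>"
      using ev by (rule eventually_mono) (use Db Dn in auto)
    fix s t assume s: "s \<in> ?S" and t: "t \<in> ?S"
    show "((\<lambda>g. D g (delta s) t) \<longlongrightarrow> 0) \<F>"
    proof (cases "s = t")
      case True
      have "D g (delta s) t = 0" if "g \<in> ?S" for g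
        using Xe[OF that s t] that s True by (simp add: Dapp fun_apply vec_scale_def c_def)
      then show ?thesis
        by (intro tendsto_eventually eventually_mono[OF ev]) auto
    next
      case False
      have eq: "D g (delta s) t = x (delta \<one>) (g \<otimes> (t \<otimes> inv s) \<otimes> inv g)" if "g \<in> ?S" for g
        using Xe[OF that s t] s False by (simp add: Dapp fun_apply vec_scale_def delta_apply)
      have "t \<otimes> inv s \<noteq> \<one>"
        using s t False by (metis inv_equality inv_inv inv_closed)
      then have "((\<lambda>g. x (delta \<one>) (g \<otimes> (t \<otimes> inv s) \<otimes> inv g)) \<longlongrightarrow> 0) \<F>"
        using s t xb by (intro l2_tendsto_0[where S = ?S] esc) auto
      then show ?thesis
        by (rule Lim_transform_eventually) (use eq ev in \<open>auto elim: eventually_mono\<close>)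
    qed
  qed
  then have lim: "((\<lambda>g. l2_inner (D g f) h + c * l2_inner f h) \<longlongrightarrow> 0 + c * l2_inner f h) \<F>"
    by (intro tendsto_intros)
  have "l2_inner (D g f) h + c * l2_inner f h = l2_inner (X g f) h" if "g \<in> ?S" for g
    using inner_diff_left[of "X g f" ?S "vec_scale c f" h] Xb[OF that] f h
    by (simp add: Dapp inner_scale_left)
  then have "\<forall>\<^sub>F g in \<F>. l2_inner (D g f) h + c * l2_inner f h = l2_inner (X g f) h"
    by (intro eventually_mono[OF ev])
  with lim show ?thesis
    unfolding X_def c_def by (simp add: Lim_transform_eventually)
qed

lemma tau_faithful_normal_tracial_state:
  "faithful_normal_tracial_state (carrier G) M (\<lambda>x\<in>M. x (delta \<one>) \<one>)"
  unfolding faithful_normal_tracial_state_def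
proof (intro conjI ballI allI impI)
  let ?S = "carrier G" and ?\<tau> = "\<lambda>x\<in>M. x (delta \<one>) \<one>"
  show "?\<tau> (x + y) = ?\<tau> x + ?\<tau> y" if "x \<in> M" "y \<in> M" for x y
    using that M_add[OF that] by (simp add: fun_apply)
  show "?\<tau> (op_scale c x) = c * ?\<tau> x" if "x \<in> M" for c x
    using that M_scale[OF that] by (simp add: op_scale_def vec_scale_def)
  have sq: "?\<tau> (op_adj ?S x \<circ> x) = of_real ((l2_norm (x (delta \<one>)))\<^sup>2)" if "x \<in> M" for x
    using M_comp[OF M_adj[OF that] that] tau_square[OF that] by simp
  show "0 \<le> ?\<tau> (op_adj ?S x \<circ> x)" if "x \<in> M" for x
    unfolding sq[OF that] by (simp add: less_eq_complex_def del: of_real_power)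
  show "?\<tau> (op_id ?S) = 1"
    using M_id by simp
  show "x = 0" if x: "x \<in> M" and 0: "?\<tau> (op_adj ?S x \<circ> x) = 0" for x
  proof (rule conv_ops_eqI[OF x])
    show "0 \<in> conv_ops G {}" by (simp add: conv_ops_def zero_fun_apply)
    have "l2_norm (x (delta \<one>)) = 0" using 0 unfolding sq[OF x] by simp
    then show "x (delta \<one>) = 0 (delta \<one>)"
      using l2_norm_eq_0[of "x (delta \<one>)" ?S] conv_ops_bops[OF x] by (simp add: zero_fun_apply)
  qed
  show "?\<tau> (x \<circ> y) = ?\<tau> (y \<circ> x)" if "x \<in> M" "y \<in> M" for x y
    using M_comp[OF that] M_comp[OF that(2,1)] tau_comm[OF that] by simp
  show "normal_functional ?S M ?\<tau>"
    unfolding normal_functional_def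
  proof (intro exI conjI allI ballI)
    \<comment> \<open>the vector state at the basis vector of the identity, as a series with one nonzero term\<close>
    let ?\<xi> = "\<lambda>n::nat. if n = 0 then delta \<one> else 0 :: 'a \<Rightarrow> complex"
    show "?\<xi> n \<in> l2 ?S" "?\<xi> n \<in> l2 ?S" for n by auto
    have "(\<lambda>n. (l2_norm (?\<xi> n))\<^sup>2) sums (\<Sum>n\<in>{0}. (l2_norm (?\<xi> n))\<^sup>2)"
      by (rule sums_finite) auto
    then show "summable (\<lambda>n. (l2_norm (?\<xi> n))\<^sup>2)" "summable (\<lambda>n. (l2_norm (?\<xi> n))\<^sup>2)"
      by (rule sums_summable)+
    fix x assume x: "x \<in> M"
    have "(\<lambda>n. l2_inner (x (?\<xi> n)) (?\<xi> n)) sums (\<Sum>n\<in>{0}. l2_inner (x (?\<xi> n)) (?\<xi> n))"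
      by (rule sums_finite) auto
    then show "(\<lambda>n. l2_inner (x (?\<xi> n)) (?\<xi> n)) sums ?\<tau> x"
      using x by simp
  qed
qed

text \<open>A tracial functional takes the same value on \<open>x\<close> and on its conjugates.  A normal one is given by a
  series of matrix coefficients, and the convergence of the conjugates to a scalar passes to the series
  by dominated convergence.\<close>

lemma normal_tracial_state_eq_tau:
  assumes "ICC G" and \<tau>: "faithful_normal_tracial_state (carrier G) M \<tau>" and x: "x \<in> M"
  shows "\<tau> x = x (delta \<one>) \<one>"
proof -
  let ?S = "carrier G"
  obtain \<F> where \<F>: "\<F> \<noteq> bot" and ev: "eventually (\<lambda>g. g \<in> ?S) \<F>"
    and esc: "\<And>s t. s \<in> ?S \<Longrightarrow> s \<noteq> \<one> \<Longrightarrow> eventually (\<lambda>g. g \<otimes> s \<otimes> inv g \<noteq> t) \<F>"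
    using ICC_filter[OF assms(1)] by metis
  define X where "X = (\<lambda>g. left_regular G (inv g) \<circ> x \<circ> left_regular G g)"
  have xb: "x \<in> bounded_ops ?S" by (rule conv_ops_bops[OF x])
  have X\<tau>: "\<tau> (X g) = \<tau> x" if g: "g \<in> ?S" for g
  proof -
    have "\<tau> (left_regular G (inv g) \<circ> (x \<circ> left_regular G g))
        = \<tau> ((x \<circ> left_regular G g) \<circ> left_regular G (inv g))"
      using \<tau> x g unfolding faithful_normal_tracial_state_def
      by (meson M_comp M_left_regular inv_closed)
    also have "(x \<circ> left_regular G g) \<circ> left_regular G (inv g) = x"
      using g xb by (simp add: comp_assoc left_regular_mult)
    finally show ?thesis unfolding X_def comp_assoc .
  qed
  obtain C where C: "C \<ge> 0" "\<And>f. f \<in> l2 ?S \<Longrightarrow> l2_norm (x f) \<le> C * l2_norm f"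
    by (rule bops_bound[OF xb], rule that)
  have "normal_functional ?S M \<tau>"
    using \<tau> unfolding faithful_normal_tracial_state_def by (elim conjE)
  then obtain \<xi> \<eta> :: "nat \<Rightarrow> 'a \<Rightarrow> complex"
    where \<xi>: "\<And>n. \<xi> n \<in> l2 ?S" and \<eta>: "\<And>n. \<eta> n \<in> l2 ?S"
      and sum\<xi>: "summable (\<lambda>n. (l2_norm (\<xi> n))\<^sup>2)" and sum\<eta>: "summable (\<lambda>n. (l2_norm (\<eta> n))\<^sup>2)"
      and sums: "\<And>y. y \<in> M \<Longrightarrow> (\<lambda>n. l2_inner (y (\<xi> n)) (\<eta> n)) sums \<tau> y"
    unfolding normal_functional_def by blast
  have bound: "cmod (l2_inner (X g (\<xi> n)) (\<eta> n)) \<le> C * ((l2_norm (\<xi> n))\<^sup>2 + (l2_norm (\<eta> n))\<^sup>2)"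
    if "g \<in> ?S" for g n
  proof -
    have "cmod (l2_inner (X g (\<xi> n)) (\<eta> n)) \<le> l2_norm (X g (\<xi> n)) * l2_norm (\<eta> n)"
      using cauchy_schwarz[of "X g (\<xi> n)" ?S "\<eta> n"] that xb \<eta> by (simp add: X_def)
    also have "\<dots> \<le> (C * l2_norm (\<xi> n)) * l2_norm (\<eta> n)"
      unfolding X_def by (intro mult_right_mono norm_conjugate[OF xb C(2)] that \<xi>) auto
    also have "\<dots> = C * (l2_norm (\<xi> n) * l2_norm (\<eta> n))" by simp
    also have "\<dots> \<le> C * ((l2_norm (\<xi> n))\<^sup>2 + (l2_norm (\<eta> n))\<^sup>2)"
    proof (rule mult_left_mono[OF _ C(1)])
      have "0 \<le> l2_norm (\<xi> n) * l2_norm (\<eta> n)" by simp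
      then show "l2_norm (\<xi> n) * l2_norm (\<eta> n) \<le> (l2_norm (\<xi> n))\<^sup>2 + (l2_norm (\<eta> n))\<^sup>2"
        using sum_squares_bound[of "l2_norm (\<xi> n)" "l2_norm (\<eta> n)"] by linarith
    qed
    finally show ?thesis .
  qed
  let ?c = "x (delta \<one>) \<one>"
  have "((\<lambda>g. suminf (\<lambda>n. l2_inner (X g (\<xi> n)) (\<eta> n))) \<longlongrightarrow> suminf (\<lambda>n. ?c * l2_inner (\<xi> n) (\<eta> n))) \<F>"
  proof (rule tannerys_theorem[THEN conjunct2, THEN conjunct2])
    show "((\<lambda>g. l2_inner (X g (\<xi> n)) (\<eta> n)) \<longlongrightarrow> ?c * l2_inner (\<xi> n) (\<eta> n)) \<F>" for n
      unfolding X_def by (rule conjugates_tendsto_tau[OF ev esc x \<xi> \<eta>])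
    have "eventually (\<lambda>(n::nat, g). g \<in> ?S) (at_top \<times>\<^sub>F \<F>)"
      using ev by (subst eventually_prod2) auto
    then show "eventually (\<lambda>(n, g). cmod (l2_inner (X g (\<xi> n)) (\<eta> n))
        \<le> C * ((l2_norm (\<xi> n))\<^sup>2 + (l2_norm (\<eta> n))\<^sup>2)) (at_top \<times>\<^sub>F \<F>)"
      by (rule eventually_mono) (use bound in auto)
    show "summable (\<lambda>n. C * ((l2_norm (\<xi> n))\<^sup>2 + (l2_norm (\<eta> n))\<^sup>2))"
      by (intro summable_mult summable_add sum\<xi> sum\<eta>)
  qed (rule \<F>)
  moreover have "suminf (\<lambda>n. l2_inner (X g (\<xi> n)) (\<eta> n)) = \<tau> x" if "g \<in> ?S" for g
    using sums[of "X g"] X\<tau>[OF that] conjugate_in_M[OF x that] by (simp add: X_def sums_iff)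
  then have "\<forall>\<^sub>F g in \<F>. suminf (\<lambda>n. l2_inner (X g (\<xi> n)) (\<eta> n)) = \<tau> x"
    by (intro eventually_mono[OF ev])
  ultimately have "((\<lambda>g. \<tau> x) \<longlongrightarrow> suminf (\<lambda>n. ?c * l2_inner (\<xi> n) (\<eta> n))) \<F>"
    by (rule Lim_transform_eventually)
  then have "\<tau> x = suminf (\<lambda>n. ?c * l2_inner (\<xi> n) (\<eta> n))"
    using tendsto_unique[OF \<F> tendsto_const] by blast
  also have "\<dots> = ?c"
  proof -
    have "(\<lambda>n. l2_inner (\<xi> n) (\<eta> n)) sums 1"
      using sums[OF M_id] \<tau> \<xi> by (simp add: faithful_normal_tracial_state_def)
    from sums_unique[OF sums_mult[OF this, of ?c]] show ?thesis by simp
  qed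
  finally show ?thesis .
qed

lemma vn_trace_eq:
  assumes "ICC G" "x \<in> M"
  shows "vn_trace (carrier G) M x = x (delta \<one>) \<one>"
proof -
  have "vn_trace (carrier G) M = (\<lambda>x\<in>M. x (delta \<one>) \<one>)"
    unfolding vn_trace_def
  proof (rule the_equality)
    show "(\<lambda>x\<in>M. x (delta \<one>) \<one>) \<in> extensional M
        \<and> faithful_normal_tracial_state (carrier G) M (\<lambda>x\<in>M. x (delta \<one>) \<one>)"
      using tau_faithful_normal_tracial_state by simp
    fix \<tau> assume "\<tau> \<in> extensional M \<and> faithful_normal_tracial_state (carrier G) M \<tau>"
    then show "\<tau> = (\<lambda>x\<in>M. x (delta \<one>) \<one>)"
      using normal_tracial_state_eq_tau[OF assms(1)] by (intro extensionalityI[of _ M]) auto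
  qed
  then show ?thesis using assms by simp
qed

lemma trace_norm2_eq:
  assumes "ICC G" "x \<in> M"
  shows "trace_norm2 (carrier G) M x = l2_norm (x (delta \<one>))"
  unfolding trace_norm2_def
  using vn_trace_eq[OF assms(1) M_comp[OF M_adj[OF assms(2)] assms(2)]] tau_square[OF assms(2)] by simp

section \<open>The group von Neumann algebra of an ICC group is a factor of type II1\<close>

text \<open>A central element equals all its conjugates and therefore their limit.\<close>

lemma ICC_vn_factor:
  assumes "ICC G"
  shows "vn_factor (carrier G) M"
proof -
  let ?S = "carrier G"
  have vna: "von_neumann_algebra ?S M"
    using VN_sub_von_neumann[OF subgroup_self] VN_sub_eq_conv_ops[OF subgroup_self] by simp
  obtain \<F> where \<F>: "\<F> \<noteq> bot" and ev: "eventually (\<lambda>g. g \<in> ?S) \<F>"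
    and esc: "\<And>s t. s \<in> ?S \<Longrightarrow> s \<noteq> \<one> \<Longrightarrow> eventually (\<lambda>g. g \<otimes> s \<otimes> inv g \<noteq> t) \<F>"
    using ICC_filter[OF assms] by metis
  have "x \<in> range (\<lambda>c. op_scale c (op_id ?S))" if "x \<in> M \<inter> commutant ?S M" for x
  proof -
    have x: "x \<in> M" and xc: "x \<in> commutant ?S M" using that by auto
    let ?c = "x (delta \<one>) \<one>"
    have fix_x: "left_regular G (inv g) \<circ> x \<circ> left_regular G g = x" if g: "g \<in> ?S" for g
    proof -
      have "left_regular G (inv g) \<circ> x = x \<circ> left_regular G (inv g)"
        by (rule commutant_commute[OF M_left_regular[OF inv_closed[OF g]] xc])
      then show ?thesis
        using g conv_ops_bops[OF x] by (simp add: comp_assoc left_regular_mult)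
    qed
    have "x (delta \<one>) t = ?c * delta \<one> t" if t: "t \<in> ?S" for t
    proof (rule tendsto_unique[OF \<F>])
      show "((\<lambda>g. l2_inner ((left_regular G (inv g) \<circ> x \<circ> left_regular G g) (delta \<one>)) (delta t))
          \<longlongrightarrow> ?c * delta \<one> t) \<F>"
        using conjugates_tendsto_tau[OF ev esc x delta_l2[OF one_closed] delta_l2[OF t]]
        by simp
      have "\<forall>\<^sub>F g in \<F>. x (delta \<one>) t
          = l2_inner ((left_regular G (inv g) \<circ> x \<circ> left_regular G g) (delta \<one>)) (delta t)"
        using ev by (rule eventually_mono) (simp add: fix_x del: comp_apply)
      then show "((\<lambda>g. l2_inner ((left_regular G (inv g) \<circ> x \<circ> left_regular G g) (delta \<one>)) (delta t))
          \<longlongrightarrow> x (delta \<one>) t) \<F>"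
        by (rule Lim_transform_eventually[OF tendsto_const])
    qed
    moreover have "x (delta \<one>) t = ?c * delta \<one> t" if "t \<notin> ?S" for t
      using conv_ops_support[OF x that] that by (auto simp: delta_def)
    ultimately have "x (delta \<one>) = (\<lambda>t. ?c * delta \<one> t)"
      by blast
    also have "\<dots> = op_scale ?c (op_id ?S) (delta \<one>)"
      by (simp add: op_scale_def vec_scale_def)
    finally have "x (delta \<one>) = op_scale ?c (op_id ?S) (delta \<one>)" .
    then have "x = op_scale ?c (op_id ?S)"
      by (rule conv_ops_eqI[OF x M_scale[OF M_id]])
    then show ?thesis by blast
  qed
  moreover have "x \<in> M \<inter> commutant ?S M" if "x \<in> range (\<lambda>c. op_scale c (op_id ?S))" for x
  proof -
    have "M \<subseteq> bounded_ops ?S" using conv_ops_bops by blast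
    then have "op_scale c (op_id ?S) \<in> M \<inter> commutant ?S M" for c
      using M_scale[OF M_id] commutant_scale[OF _ commutant_id] by simp
    then show ?thesis using that by auto
  qed
  ultimately show ?thesis using vna unfolding vn_factor_def by blast
qed

text \<open>If \<open>v\<^sup>*v = 1\<close> then the trace of \<open>vv\<^sup>*\<close> is \<open>1\<close> as well.  Therefore \<open>w = v\<^sup>*\<delta>\<^sub>1\<close> is a unit vector, and
  \<open>\<parallel>vw - \<delta>\<^sub>1\<parallel>\<^sup>2 = 1 + 1 - 2 = 0\<close>, that is, \<open>vv\<^sup>*\<close> and the identity have the same symbol.\<close>

lemma conv_ops_vn_finite: "vn_finite (carrier G) M"
  unfolding vn_finite_def
proof (intro ballI impI)
  let ?S = "carrier G"
  fix v assume v: "v \<in> M" and iso: "op_adj ?S v \<circ> v = op_id ?S"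
  have vb: "v \<in> bounded_ops ?S" by (rule conv_ops_bops[OF v])
  define w where "w = op_adj ?S v (delta \<one>)"
  have w: "w \<in> l2 ?S" using vb by (simp add: w_def)
  note norm_v = isometry_norm[OF vb iso]
  have "v w \<one> = 1"
    using tau_comm[OF v M_adj[OF v]] iso unfolding w_def
    by (metis comp_apply delta_l2 delta_self one_closed op_id_apply)
  moreover have "l2_inner w w = v w \<one>"
    using adj_inner[OF vb w delta_l2[OF one_closed]] by (simp add: w_def)
  ultimately have nw: "(l2_norm w)\<^sup>2 = 1"
    using inner_self[OF w] by (metis of_real_eq_1_iff)
  have "(l2_norm (v w + vec_scale (-1) (delta \<one>)))\<^sup>2 = 0"
    using norm_v[OF w] nw \<open>v w \<one> = 1\<close> vb
    by (subst l2_norm_sq_add[of _ ?S]) (auto simp: inner_scale_right l2_norm_scale)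
  then have "v w - delta \<one> = 0"
    using l2_norm_eq_0[of "v w - delta \<one>" ?S] vb by (simp add: diff_eq_add_scale)
  then have "(v \<circ> op_adj ?S v) (delta \<one>) = op_id ?S (delta \<one>)"
    by (simp add: w_def)
  then show "v \<circ> op_adj ?S v = op_id ?S"
    by (rule conv_ops_eqI[OF M_comp[OF v M_adj[OF v]] M_id])
qed

text \<open>Let \<open>p\<close> be abelian with symbol \<open>\<pi>\<close> and let \<open>z = pxp\<close>.  Commutativity of \<open>pMp\<close> gives
  \<open>z \<lambda>(g) p = p \<lambda>(g) z\<close>.  Multiply by \<open>\<lambda>(g)\<^sup>*\<close> from the left and let \<open>g\<close> escape: the result is
  \<open>\<tau>(z) p = \<tau>(p) z\<close>, so that \<open>pMp\<close> is one dimensional.  For \<open>x = \<lambda>(g)\<close> the trace of \<open>z\<close> is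
  \<open>\<pi>(g\<^sup>-\<^sup>1)\<close>; evaluation at \<open>g\<close> gives
  \<open>\<tau>(p) \<tau>(\<lambda>(g)\<^sup>* p \<lambda>(g) p) = \<pi>(g\<^sup>-\<^sup>1) \<pi>(g)\<close>.  When \<open>g\<close> escapes, the left side tends to
  \<open>\<tau>(p)\<^sup>3\<close> and the right side to zero.\<close>

lemma ICC_no_abelian_projection:
  assumes "ICC G" and nontrivial: "s \<in> carrier G" "s \<noteq> \<one>"
    and p: "abelian_projection (carrier G) M p"
  shows "p = 0"
proof -
  let ?S = "carrier G"
  obtain \<F> where \<F>: "\<F> \<noteq> bot" and ev: "eventually (\<lambda>g. g \<in> ?S) \<F>"
    and esc: "\<And>s t. s \<in> ?S \<Longrightarrow> s \<noteq> \<one> \<Longrightarrow> eventually (\<lambda>g. g \<otimes> s \<otimes> inv g \<noteq> t) \<F>"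
    using ICC_filter[OF assms(1)] by metis
  have pM: "p \<in> M" and pp: "p \<circ> p = p" and padj: "op_adj ?S p = p"
    and abel: "\<And>x y. x \<in> M \<Longrightarrow> y \<in> M \<Longrightarrow> (p \<circ> x \<circ> p) \<circ> (p \<circ> y \<circ> p) = (p \<circ> y \<circ> p) \<circ> (p \<circ> x \<circ> p)"
    using p by (auto simp: abelian_projection_def op_projection_def)
  have pb: "p \<in> bounded_ops ?S" by (rule conv_ops_bops[OF pM])
  have pp': "p (p f) = p f" for f using pp by (metis comp_apply)
  define \<pi> where "\<pi> = p (delta \<one>)"
  have \<pi>: "\<pi> \<in> l2 ?S" using pb by (simp add: \<pi>_def)
  have scalar: "z (delta \<one>) \<one> * \<pi> t = \<pi> \<one> * z (delta \<one>) t"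
    if x: "x \<in> M" and z: "z = p \<circ> x \<circ> p" and t: "t \<in> ?S" for x z t
  proof (rule tendsto_unique[OF \<F>])
    have zM: "z \<in> M" unfolding z by (intro M_comp pM x)
    then have zl2: "z (delta \<one>) \<in> l2 ?S" using conv_ops_bops bops_l2 by blast
    show "((\<lambda>g. l2_inner ((left_regular G (inv g) \<circ> z \<circ> left_regular G g) \<pi>) (delta t))
        \<longlongrightarrow> z (delta \<one>) \<one> * \<pi> t) \<F>"
      using conjugates_tendsto_tau[OF ev esc zM \<pi> delta_l2[OF t]] by simp
    have lim: "((\<lambda>g. l2_inner ((left_regular G (inv g) \<circ> p \<circ> left_regular G g) (z (delta \<one>))) (delta t))
        \<longlongrightarrow> \<pi> \<one> * z (delta \<one>) t) \<F>"
      using conjugates_tendsto_tau[OF ev esc pM zl2 delta_l2[OF t]] by (simp add: \<pi>_def)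
    have "(left_regular G (inv g) \<circ> p \<circ> left_regular G g) (z (delta \<one>))
        = (left_regular G (inv g) \<circ> z \<circ> left_regular G g) \<pi>" if g: "g \<in> ?S" for g
      using fun_cong[OF abel[OF x M_left_regular[OF g]], of "delta \<one>"] by (simp add: z \<pi>_def pp')
    then have "\<forall>\<^sub>F g in \<F>. l2_inner ((left_regular G (inv g) \<circ> p \<circ> left_regular G g) (z (delta \<one>))) (delta t)
        = l2_inner ((left_regular G (inv g) \<circ> z \<circ> left_regular G g) \<pi>) (delta t)"
      by (intro eventually_mono[OF ev]) simp
    with lim show "((\<lambda>g. l2_inner ((left_regular G (inv g) \<circ> z \<circ> left_regular G g) \<pi>) (delta t))
        \<longlongrightarrow> \<pi> \<one> * z (delta \<one>) t) \<F>"
      by (rule Lim_transform_eventually)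
  qed
  \<comment> \<open>\<open>scalar\<close> for \<open>x = \<lambda>(g)\<close>, evaluated at \<open>g\<close>\<close>
  have diag: "\<pi> \<one> * l2_inner ((left_regular G (inv g) \<circ> p \<circ> left_regular G g) \<pi>) (delta \<one>) = \<pi> (inv g) * \<pi> g"
    if g: "g \<in> ?S" for g
  proof -
    have "(p \<circ> left_regular G g \<circ> p) (delta \<one>) \<one> = (p \<circ> (p \<circ> left_regular G g)) (delta \<one>) \<one>"
      using tau_comm[OF pM M_comp[OF M_left_regular[OF g] pM]]
        tau_comm[OF M_comp[OF M_left_regular[OF g] pM] pM]
        tau_comm[OF M_left_regular[OF g] pM] by (simp add: pp')
    also have "\<dots> = p (delta g) \<one>" using g by (simp add: pp')
    also have "\<dots> = \<pi> (inv g)" using conv_ops_entry[OF pM g one_closed] g by (simp add: \<pi>_def)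
    finally have "\<pi> (inv g) * \<pi> g = \<pi> \<one> * (p \<circ> left_regular G g \<circ> p) (delta \<one>) g"
      using scalar[OF M_left_regular[OF g] refl g] by simp
    also have "(p \<circ> left_regular G g \<circ> p) (delta \<one>) g
        = (left_regular G (inv g) \<circ> p \<circ> left_regular G g) \<pi> \<one>"
      using left_regular_apply[of "p (left_regular G g \<pi>)" \<one> "inv g"] pb g by (simp add: \<pi>_def)
    finally show ?thesis by simp
  qed
  \<comment> \<open>distinct conjugates of a nontrivial \<open>s\<close> come from distinct elements, so \<open>g\<close> itself escapes\<close>
  have "eventually (\<lambda>g. g \<noteq> t) \<F>" for t
    using esc[OF nontrivial, of "t \<otimes> s \<otimes> inv t"] by (rule eventually_mono) auto
  then have "((\<lambda>g. \<pi> g) \<longlongrightarrow> 0) \<F>"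
    by (intro l2_tendsto_0[OF \<pi>])
  then have "((\<lambda>g. l2_norm \<pi> * cmod (\<pi> g)) \<longlongrightarrow> l2_norm \<pi> * 0) \<F>"
    by (intro tendsto_mult_left tendsto_norm_zero)
  then have lim: "((\<lambda>g. l2_norm \<pi> * cmod (\<pi> g)) \<longlongrightarrow> 0) \<F>"
    by simp
  have "cmod (\<pi> (inv g) * \<pi> g) \<le> l2_norm \<pi> * cmod (\<pi> g)" for g
    unfolding norm_mult by (rule mult_right_mono[OF cmod_le_norm[OF \<pi>] norm_ge_zero])
  then have "((\<lambda>g. \<pi> (inv g) * \<pi> g) \<longlongrightarrow> 0) \<F>"
    by (rule Lim_null_comparison[OF always_eventually lim, OF allI])
  then have "((\<lambda>g. \<pi> \<one> * l2_inner ((left_regular G (inv g) \<circ> p \<circ> left_regular G g) \<pi>) (delta \<one>)) \<longlongrightarrow> 0) \<F>"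
    by (rule Lim_transform_eventually) (use ev diag in \<open>auto elim!: eventually_mono\<close>)
  moreover have "((\<lambda>g. \<pi> \<one> * l2_inner ((left_regular G (inv g) \<circ> p \<circ> left_regular G g) \<pi>) (delta \<one>))
      \<longlongrightarrow> \<pi> \<one> * (\<pi> \<one> * \<pi> \<one>)) \<F>"
    using conjugates_tendsto_tau[OF ev esc pM \<pi> delta_l2[OF one_closed]]
    by (intro tendsto_mult_left) (simp add: \<pi>_def)
  ultimately have "\<pi> \<one> * (\<pi> \<one> * \<pi> \<one>) = 0"
    using tendsto_unique[OF \<F>] by blast
  then have "\<pi> \<one> = 0" by simp
  then have "op_adj ?S p (p (delta \<one>)) \<one> = 0"
    by (simp add: padj pp' \<pi>_def)
  then have "l2_norm \<pi> = 0"
    unfolding tau_square[OF pM] by (simp add: \<pi>_def)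
  then have "p (delta \<one>) = 0 (delta \<one>)"
    using l2_norm_eq_0[OF \<pi>] by (simp add: \<pi>_def zero_fun_apply)
  moreover have "0 \<in> conv_ops G {}" by (simp add: conv_ops_def zero_fun_apply)
  ultimately show ?thesis using conv_ops_eqI[OF pM] by blast
qed

lemma ICC_type_II1_factor:
  assumes "ICC G" "infinite (carrier G)"
  shows "type_II1_factor (carrier G) M"
proof -
  have "\<not> carrier G \<subseteq> {\<one>}" using assms(2) finite_subset by blast
  then show ?thesis
    using ICC_vn_factor[OF assms(1)] conv_ops_vn_finite ICC_no_abelian_projection[OF assms(1)]
    by (auto simp: type_II1_factor_def)
qed

end

section \<open>Conditional expectations\<close>

lemma norm_sq_cutoff_Un:
  assumes "f \<in> l2 S" "C \<inter> D = {}"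
  shows "(l2_norm (cutoff (C \<union> D) f))\<^sup>2 = (l2_norm (cutoff C f))\<^sup>2 + (l2_norm (cutoff D f))\<^sup>2"
proof -
  have "cutoff C (cutoff (C \<union> D) f) = cutoff C f" "cutoff (C \<union> D) f - cutoff C f = cutoff D f"
    using assms(2) by (auto simp: cutoff_def fun_eq_iff minus_apply)
  then show ?thesis
    using l2_norm_sq_split[of "cutoff (C \<union> D) f" S C] assms(1) by simp
qed

lemma sum_norm_sq_cutoff:
  assumes "finite \<C>" "pairwise disjnt \<C>" "f \<in> l2 S"
  shows "(\<Sum>C\<in>\<C>. (l2_norm (cutoff C f))\<^sup>2) \<le> (l2_norm f)\<^sup>2"
proof -
  have "(\<Sum>C\<in>\<C>. (l2_norm (cutoff C f))\<^sup>2) = (l2_norm (cutoff (\<Union>\<C>) f))\<^sup>2"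
    using assms(1,2)
  proof (induction \<C> rule: finite_induct)
    case empty
    have "cutoff {} f = 0" by (simp add: cutoff_def fun_eq_iff zero_fun_apply)
    then show ?case by simp
  next
    case (insert C \<C>)
    have "C \<inter> \<Union>\<C> = {}"
      using insert.prems insert.hyps by (auto simp: pairwise_insert disjnt_def)
    then show ?case
      using norm_sq_cutoff_Un[OF assms(3)] insert by (simp add: pairwise_insert)
  qed
  also have "\<dots> \<le> (l2_norm f)\<^sup>2"
    using l2_norm_cutoff_le[OF assms(3)] by (intro power_mono) auto
  finally show ?thesis .
qed

text \<open>The block diagonal part of \<open>x\<close> for the decomposition of the Hilbert space along the right cosets of
  \<open>L\<close>.  At a point \<open>s\<close> only the block of the coset of \<open>s\<close> is seen.\<close>

definition coset_exp :: "('g, 'm) monoid_scheme \<Rightarrow> 'g set \<Rightarrow> 'g l2_op \<Rightarrow> 'g l2_op" where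
  "coset_exp G L x = (\<lambda>f. if f \<in> l2 (carrier G)
     then (\<lambda>s. if s \<in> carrier G then x (cutoff (L #>\<^bsub>G\<^esub> s) f) s else 0) else 0)"

lemma conj_add_op:
  fixes a b x y :: "'s l2_op"
  assumes "a \<in> bounded_ops S" "x \<in> bounded_ops S" "y \<in> bounded_ops S"
  shows "a \<circ> (x + y) \<circ> b = (a \<circ> x \<circ> b) + (a \<circ> y \<circ> b)"
proof
  fix f
  show "(a \<circ> (x + y) \<circ> b) f = ((a \<circ> x \<circ> b) + (a \<circ> y \<circ> b)) f"
    using bops_add[OF assms(1), of "x (b f)" "y (b f)"] assms by (simp add: op_add_apply)
qed

lemma conj_scale_op:
  fixes a b x :: "'s l2_op"
  assumes "a \<in> bounded_ops S" "x \<in> bounded_ops S"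
  shows "a \<circ> op_scale c x \<circ> b = op_scale c (a \<circ> x \<circ> b)"
proof
  fix f
  show "(a \<circ> op_scale c x \<circ> b) f = (op_scale c (a \<circ> x \<circ> b)) f"
    using bops_scale[OF assms(1), of "x (b f)" c] assms by (simp add: op_scale_def)
qed

lemma op_positive_conj:
  assumes "op_positive S x" "v \<in> bounded_ops S"
  shows "op_positive S (op_adj S v \<circ> x \<circ> v)"
  using assms adj_inner_left[OF assms(2)] by (simp add: op_positive_def)

context group
begin

context
  fixes L assumes L: "subgroup L G"
begin

lemma mem_coset_iff: "s \<in> carrier G \<Longrightarrow> t \<in> carrier G \<Longrightarrow> t \<in> L #> s \<longleftrightarrow> t \<otimes> inv s \<in> L"
  using subgroup.rcos_module[OF L is_group] by blast

lemma coset_self: "s \<in> carrier G \<Longrightarrow> s \<in> L #> s"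
  by (rule rcos_self[OF _ L])

lemma coset_subset: "s \<in> carrier G \<Longrightarrow> L #> s \<subseteq> carrier G"
  by (rule r_coset_subset_G[OF subgroup.subset[OF L]])

lemma coset_eq: "t \<in> L #> s \<Longrightarrow> s \<in> carrier G \<Longrightarrow> L #> t = L #> s"
  using repr_independence[OF _ _ L] by metis

lemma coset_eq_subgroup: "s \<in> L \<Longrightarrow> L #> s = L"
  using subgroup.rcos_const[OF L is_group] by blast

text \<open>Compressions to mutually orthogonal subspaces add up to an operator that obeys the same bound.\<close>

lemma coset_exp_bound:
  assumes x: "x \<in> bounded_ops (carrier G)" and "C \<ge> 0"
    and C: "\<And>f. f \<in> l2 (carrier G) \<Longrightarrow> l2_norm (x f) \<le> C * l2_norm f"
    and f: "f \<in> l2 (carrier G)" and F: "finite F"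
  shows "(\<Sum>s\<in>F. (cmod (coset_exp G L x f s))\<^sup>2) \<le> (C * l2_norm f)\<^sup>2"
proof -
  let ?S = "carrier G" and ?R = "\<lambda>s. L #> s"
  define F' where "F' = F \<inter> ?S"
  have F': "finite F'" "F' \<subseteq> ?S" using F by (auto simp: F'_def)
  have "(\<Sum>s\<in>F. (cmod (coset_exp G L x f s))\<^sup>2) = (\<Sum>s\<in>F'. (cmod (x (cutoff (?R s) f) s))\<^sup>2)"
    unfolding F'_def using F f by (intro sum.mono_neutral_cong_right) (auto simp: coset_exp_def)
  also have "\<dots> = (\<Sum>D\<in>?R ` F'. \<Sum>s | s \<in> F' \<and> ?R s = D. (cmod (x (cutoff (?R s) f) s))\<^sup>2)"
    by (rule sum.image_gen[OF F'(1)])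
  also have "\<dots> \<le> (\<Sum>D\<in>?R ` F'. C\<^sup>2 * (l2_norm (cutoff D f))\<^sup>2)"
  proof (rule sum_mono)
    fix D
    have "(\<Sum>s | s \<in> F' \<and> ?R s = D. (cmod (x (cutoff (?R s) f) s))\<^sup>2)
        = (\<Sum>s | s \<in> F' \<and> ?R s = D. (cmod (x (cutoff D f) s))\<^sup>2)"
      by (intro sum.cong) auto
    also have "\<dots> \<le> (l2_norm (x (cutoff D f)))\<^sup>2"
      using F' x by (intro finite_sum_le_norm_sq[where S = ?S]) auto
    also have "\<dots> \<le> (C * l2_norm (cutoff D f))\<^sup>2"
      using C[of "cutoff D f"] f by (intro power_mono) auto
    finally show "(\<Sum>s | s \<in> F' \<and> ?R s = D. (cmod (x (cutoff (?R s) f) s))\<^sup>2)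
        \<le> C\<^sup>2 * (l2_norm (cutoff D f))\<^sup>2"
      by (simp add: power_mult_distrib)
  qed
  also have "\<dots> = C\<^sup>2 * (\<Sum>D\<in>?R ` F'. (l2_norm (cutoff D f))\<^sup>2)"
    by (simp add: sum_distrib_left)
  also have "\<dots> \<le> C\<^sup>2 * (l2_norm f)\<^sup>2"
  proof (intro mult_left_mono sum_norm_sq_cutoff[OF _ _ f])
    show "pairwise disjnt (?R ` F')"
    proof (intro pairwiseI)
      fix C D assume "C \<in> ?R ` F'" "D \<in> ?R ` F'" and ne: "C \<noteq> D"
      then obtain s t where st: "s \<in> ?S" "t \<in> ?S" "C = ?R s" "D = ?R t" using F' by auto
      show "disjnt C D"
        unfolding disjnt_iff using ne coset_eq[of _ s] coset_eq[of _ t] st by metis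
    qed
  qed (use F' in auto)
  finally show ?thesis by (simp add: power_mult_distrib)
qed

lemma coset_exp_bops:
  assumes x: "x \<in> bounded_ops (carrier G)"
  shows "coset_exp G L x \<in> bounded_ops (carrier G)"
proof -
  let ?S = "carrier G"
  obtain C where C: "C \<ge> 0" "\<And>f. f \<in> l2 ?S \<Longrightarrow> l2_norm (x f) \<le> C * l2_norm f"
    by (rule bops_bound[OF x], rule that)
  have fin: "(\<Sum>s\<in>F. (cmod (coset_exp G L x f s))\<^sup>2) \<le> (C * l2_norm f)\<^sup>2"
    if "f \<in> l2 ?S" "finite F" for f F
    by (rule coset_exp_bound[OF x C that])
  have l2: "coset_exp G L x f \<in> l2 ?S" if "f \<in> l2 ?S" for f
  proof -
    have "(\<lambda>a. (cmod (coset_exp G L x f a))\<^sup>2) summable_on UNIV"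
      by (rule nonneg_bdd_above_summable_on) (auto intro!: bdd_aboveI2 fin that)
    then show ?thesis using that by (auto simp: l2_iff coset_exp_def)
  qed
  show ?thesis
  proof (rule bopsI[OF _ l2, where C = C])
    show "l2_norm (coset_exp G L x f) \<le> C * l2_norm f" if "f \<in> l2 ?S" for f
    proof (rule power2_le_imp_le)
      show "(l2_norm (coset_exp G L x f))\<^sup>2 \<le> (C * l2_norm f)\<^sup>2"
        unfolding l2_norm_sq
        by (rule infsum_le_finite_sums[OF l2_summable[OF l2[OF that]]]) (use fin[OF that] in auto)
    qed (use C in auto)
    show "coset_exp G L x (f + g) = coset_exp G L x f + coset_exp G L x g"
      if "f \<in> l2 ?S" "g \<in> l2 ?S" for f g
      using that by (auto simp: coset_exp_def fun_eq_iff plus_fun_apply cutoff_add bops_add[OF x])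
    show "coset_exp G L x (vec_scale c f) = vec_scale c (coset_exp G L x f)" if "f \<in> l2 ?S" for c f
    proof
      fix s
      show "coset_exp G L x (vec_scale c f) s = vec_scale c (coset_exp G L x f) s"
        using that scale_l2[OF that, of c] bops_scale[OF x, of "cutoff (L #> s) f" c]
        by (simp add: coset_exp_def cutoff_scale) (simp add: vec_scale_def)
    qed
  qed (auto simp: coset_exp_def)
qed

lemma coset_exp_entry:
  assumes x: "x \<in> M" and s: "s \<in> carrier G" and t: "t \<in> carrier G"
  shows "coset_exp G L x (delta s) t = (if t \<otimes> inv s \<in> L then x (delta \<one>) (t \<otimes> inv s) else 0)"
proof -
  have "s \<in> L #> t \<longleftrightarrow> t \<in> L #> s"
    using coset_eq[of s t] coset_eq[of t s] coset_self s t by blast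
  then have "coset_exp G L x (delta s) t = (if t \<otimes> inv s \<in> L then x (delta s) t else 0)"
    using s t bops_zero[OF conv_ops_bops[OF x]]
    by (simp add: coset_exp_def cutoff_delta mem_coset_iff zero_fun_apply)
  then show ?thesis
    using conv_ops_entry[OF x s t] by presburger
qed

lemma coset_exp_symbol:
  assumes x: "x \<in> M"
  shows "coset_exp G L x (delta \<one>) = cutoff L (x (delta \<one>))"
proof
  fix t
  show "coset_exp G L x (delta \<one>) t = cutoff L (x (delta \<one>)) t"
  proof (cases "t \<in> carrier G")
    case True
    then show ?thesis using coset_exp_entry[OF x one_closed True] by (simp add: cutoff_def)
  next
    case False
    then show ?thesis
      using conv_ops_support[OF x False] by (simp add: cutoff_def coset_exp_def)
  qed
qed

lemma coset_exp_conv_ops: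
  assumes x: "x \<in> M"
  shows "coset_exp G L x \<in> conv_ops G L"
  unfolding conv_ops_def
proof (intro CollectI conjI ballI allI impI)
  show "coset_exp G L x \<in> bounded_ops (carrier G)"
    by (rule coset_exp_bops[OF conv_ops_bops[OF x]])
  show "coset_exp G L x (delta s) t = coset_exp G L x (delta \<one>) (t \<otimes> inv s)"
    if "s \<in> carrier G" "t \<in> carrier G" for s t
    using coset_exp_entry[OF x that] by (simp add: coset_exp_symbol[OF x] cutoff_def)
  show "coset_exp G L x (delta \<one>) t = 0" if "t \<notin> L" for t
    using that by (simp add: coset_exp_symbol[OF x] cutoff_def)
qed

lemma conv_ops_subset_M: "conv_ops G L \<subseteq> M"
  by (rule conv_ops_mono[OF subgroup.subset[OF L]])

lemma cutoff_symbol: "x \<in> conv_ops G L \<Longrightarrow> cutoff L (x (delta \<one>)) = x (delta \<one>)"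
  using conv_ops_support[of x G L] by (auto simp: cutoff_def fun_eq_iff)

text \<open>A function supported in \<open>L\<close> has no part on the other cosets, so only the block of \<open>L\<close> itself
  sees it.\<close>

lemma coset_exp_on_support:
  assumes x: "x \<in> M" and f: "f \<in> l2 (carrier G)" "cutoff L f = f"
  shows "coset_exp G L x f = cutoff L (x f)"
proof
  fix s
  have xb: "x \<in> bounded_ops (carrier G)" by (rule conv_ops_bops[OF x])
  consider "s \<in> L" | "s \<notin> L" "s \<in> carrier G" | "s \<notin> carrier G" by blast
  then show "coset_exp G L x f s = cutoff L (x f) s"
  proof cases
    case 1
    then show ?thesis
      using subgroup.mem_carrier[OF L] f coset_eq_subgroup by (simp add: coset_exp_def cutoff_def[of L "x f"])
  next
    case 2
    have "L \<inter> (L #> s) = {}"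
      using coset_eq[of _ s] coset_eq_subgroup coset_self 2 by blast
    then have "cutoff (L #> s) f = cutoff {} f"
      using f(2) cutoff_cutoff[of "L #> s" L f] by (simp add: Int_commute)
    also have "\<dots> = 0" by (simp add: cutoff_def fun_eq_iff zero_fun_apply)
    finally show ?thesis
      using 2 f bops_zero[OF xb] by (simp add: coset_exp_def cutoff_def[of L "x f"] zero_fun_apply)
  next
    case 3
    then show ?thesis using f subgroup.mem_carrier[OF L] by (auto simp: coset_exp_def cutoff_def[of L "x f"])
  qed
qed

lemma cutoff_commute:
  assumes "a \<in> conv_ops G L" "f \<in> l2 (carrier G)"
  shows "a (cutoff L f) = cutoff L (a f)"
proof -
  have "cutoff_op (carrier G) L \<in> commutant (carrier G) (left_regular G ` L)"
    by (rule cutoff_commutant[OF subgroup.subset[OF L] subgroup_mult_iff[OF L]])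
  then have "cutoff_op (carrier G) L (a f) = a (cutoff_op (carrier G) L f)"
    using assms(1) unfolding conv_ops_bicommutant[OF L] by (rule commutant_commute_apply)
  then show ?thesis
    using assms conv_ops_bops[OF assms(1)] by (simp add: cutoff_op_def)
qed

text \<open>Compare symbols.  The symbol of \<open>b\<close> is supported in \<open>L\<close>, and \<open>a\<close> commutes with the restriction to
  \<open>L\<close>; hence restricting the symbol of \<open>a x b\<close> to \<open>L\<close> affects only \<open>x\<close>.\<close>

lemma coset_exp_bimodule:
  assumes x: "x \<in> M" and a: "a \<in> conv_ops G L" and b: "b \<in> conv_ops G L"
  shows "coset_exp G L (a \<circ> x \<circ> b) = a \<circ> coset_exp G L x \<circ> b"
proof (rule conv_ops_eqI)
  have aM: "a \<in> M" and bM: "b \<in> M" using a b conv_ops_subset_M by auto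
  have axb: "a \<circ> x \<circ> b \<in> M" by (intro M_comp aM x bM)
  show "coset_exp G L (a \<circ> x \<circ> b) \<in> conv_ops G L" by (rule coset_exp_conv_ops[OF axb])
  show "a \<circ> coset_exp G L x \<circ> b \<in> conv_ops G L"
    by (intro conv_ops_comp[OF L] a b coset_exp_conv_ops[OF x])
  have bl: "b (delta \<one>) \<in> l2 (carrier G)" using conv_ops_bops[OF b] by simp
  show "coset_exp G L (a \<circ> x \<circ> b) (delta \<one>) = (a \<circ> coset_exp G L x \<circ> b) (delta \<one>)"
    using coset_exp_on_support[OF x bl cutoff_symbol[OF b]] conv_ops_bops[OF x]
      cutoff_commute[OF a, of "x (b (delta \<one>))"]
    by (simp add: coset_exp_symbol[OF axb])
qed

text \<open>The quadratic form of the block diagonal part is the sum over all cosets \<open>C\<close> of the quadratic form of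
  \<open>x\<close> at the parts of \<open>f\<close> on \<open>C\<close>.\<close>

lemma coset_exp_positive:
  assumes x: "x \<in> M" and pos: "op_positive (carrier G) x"
  shows "op_positive (carrier G) (coset_exp G L x)"
  unfolding op_positive_def
proof (intro conjI ballI)
  let ?S = "carrier G" and ?E = "coset_exp G L x"
  have xb: "x \<in> bounded_ops ?S" by (rule conv_ops_bops[OF x])
  show Eb: "?E \<in> bounded_ops ?S" by (rule coset_exp_bops[OF xb])
  fix f assume f: "f \<in> l2 ?S"
  define g where "g = (\<lambda>s. ?E f s * cnj (f s))"
  define Q where "Q = (\<lambda>s. L #> s) ` ?S"
  have gS: "g summable_on ?S"
    unfolding g_def using inner_summable[OF bops_l2[OF Eb] f] by (rule abs_summable_summable)
  \<comment> \<open>the index set as the disjoint union of its cosets\<close>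
  have bij: "bij_betw (\<lambda>s. (L #> s, s)) ?S (Sigma Q (\<lambda>C. C))"
  proof (rule bij_betw_byWitness[where f' = snd])
    show "\<forall>z\<in>Sigma Q (\<lambda>C. C). (L #> snd z, snd z) = z"
      using coset_eq by (auto simp: Q_def)
    show "(\<lambda>s. (L #> s, s)) ` ?S \<subseteq> Sigma Q (\<lambda>C. C)"
      using coset_self by (auto simp: Q_def)
    show "snd ` Sigma Q (\<lambda>C. C) \<subseteq> ?S"
      using coset_subset by (fastforce simp: Q_def)
  qed auto
  have "l2_inner (?E f) f = infsum g ?S"
    unfolding l2_inner_def g_def
    by (rule infsum_cong_neutral) (use l2_outside[OF f] in auto)
  also have "\<dots> = infsum (\<lambda>(C, s). g s) (Sigma Q (\<lambda>C. C))"
    using infsum_reindex_bij_betw[OF bij, of "\<lambda>(C, s). g s"] by simp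
  also have "\<dots> = (\<Sum>\<^sub>\<infinity>C\<in>Q. \<Sum>\<^sub>\<infinity>s\<in>C. g s)"
    using summable_on_reindex_bij_betw[OF bij, of "\<lambda>(C, s). g s"] gS
    by (intro infsum_Sigma'_banach[symmetric]) simp
  also have "(\<Sum>\<^sub>\<infinity>s\<in>C. g s) = l2_inner (x (cutoff C f)) (cutoff C f)" if "C \<in> Q" for C
  proof -
    have C: "C \<subseteq> ?S" "\<And>s. s \<in> C \<Longrightarrow> L #> s = C"
      using that coset_subset coset_eq by (auto simp: Q_def)
    have "(\<Sum>\<^sub>\<infinity>s\<in>C. g s) = (\<Sum>\<^sub>\<infinity>s\<in>C. x (cutoff C f) s * cnj (cutoff C f s))"
      using C f by (intro infsum_cong) (auto simp: g_def coset_exp_def cutoff_def[of C f])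
    also have "\<dots> = l2_inner (x (cutoff C f)) (cutoff C f)"
      unfolding l2_inner_def by (rule infsum_cong_neutral) (auto simp: cutoff_def)
    finally show ?thesis .
  qed
  then have "(\<Sum>\<^sub>\<infinity>C\<in>Q. \<Sum>\<^sub>\<infinity>s\<in>C. g s) = (\<Sum>\<^sub>\<infinity>C\<in>Q. l2_inner (x (cutoff C f)) (cutoff C f))"
    by (rule infsum_cong)
  finally have eq: "l2_inner (?E f) f = (\<Sum>\<^sub>\<infinity>C\<in>Q. l2_inner (x (cutoff C f)) (cutoff C f))" .
  show "0 \<le> l2_inner (?E f) f"
  proof (cases "(\<lambda>C. l2_inner (x (cutoff C f)) (cutoff C f)) summable_on Q")
    case True
    then show ?thesis
      unfolding eq using pos f by (intro infsum_nonneg_complex) (auto simp: op_positive_def)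
  qed (simp add: eq infsum_not_exists)
qed

end

end

context group
begin

text \<open>Two trace preserving conditional expectations have \<open>\<tau>(E(x) a) = \<tau>(E(x a)) = \<tau>(x a)\<close> for \<open>a\<close>
  in \<open>N\<close>, so their difference \<open>d\<close> at \<open>x\<close> is orthogonal to \<open>N\<close>.  Take \<open>a = d\<^sup>*\<close>.\<close>

lemma cond_exp_eqI:
  assumes "ICC G" and N: "N \<subseteq> M" "op_id (carrier G) \<in> N"
    and N_adj: "\<And>x. x \<in> N \<Longrightarrow> op_adj (carrier G) x \<in> N"
    and N_diff: "\<And>x y. x \<in> N \<Longrightarrow> y \<in> N \<Longrightarrow> x - y \<in> N"
    and E: "E \<in> extensional M" "conditional_expectation (carrier G) M N E"
      "\<And>x. x \<in> M \<Longrightarrow> E x (delta \<one>) \<one> = x (delta \<one>) \<one>"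
  shows "cond_exp (carrier G) M N = E"
  unfolding cond_exp_def
proof (rule the_equality)
  let ?S = "carrier G"
  have inN: "E x \<in> N" if "x \<in> M" "conditional_expectation ?S M N E" for E x
    using that by (simp add: conditional_expectation_def)
  show "E \<in> extensional M \<and> conditional_expectation ?S M N E \<and>
      (\<forall>x\<in>M. vn_trace ?S M (E x) = vn_trace ?S M x)"
    using E vn_trace_eq[OF assms(1)] inN[OF _ E(2)] N(1) by (auto simp: subset_iff)
  fix E'
  assume E': "E' \<in> extensional M \<and> conditional_expectation ?S M N E' \<and>
      (\<forall>x\<in>M. vn_trace ?S M (E' x) = vn_trace ?S M x)"
  then have E'2: "conditional_expectation ?S M N E'" by blast
  have E'tr: "E' x (delta \<one>) \<one> = x (delta \<one>) \<one>" if "x \<in> M" for x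
    using E' vn_trace_eq[OF assms(1)] inN[OF that E'2] N(1) that by (metis subsetD)
  \<comment> \<open>on the trace pairing with \<open>N\<close>, an expectation acts as the identity\<close>
  have pair: "E x (a (delta \<one>)) \<one> = x (a (delta \<one>)) \<one>"
    if E: "conditional_expectation ?S M N E" and tr: "\<And>x. x \<in> M \<Longrightarrow> E x (delta \<one>) \<one> = x (delta \<one>) \<one>"
      and x: "x \<in> M" and a: "a \<in> N" for E x a
  proof -
    have "E (op_id ?S \<circ> x \<circ> a) = op_id ?S \<circ> E x \<circ> a"
      using E x a N(2) by (simp add: conditional_expectation_def)
    moreover have "op_id ?S \<circ> x = x"
      by (rule op_id_comp(1)[OF conv_ops_bops[OF x]])
    moreover have "op_id ?S \<circ> E x = E x"
      by (rule op_id_comp(1)[OF conv_ops_bops[OF subsetD[OF N(1) inN[OF x E]]]])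
    ultimately have "E (x \<circ> a) = E x \<circ> a" by simp
    then have "E x (a (delta \<one>)) \<one> = E (x \<circ> a) (delta \<one>) \<one>"
      by (simp only: comp_apply)
    also have "\<dots> = (x \<circ> a) (delta \<one>) \<one>"
      by (rule tr[OF M_comp[OF x subsetD[OF N(1) a]]])
    finally show ?thesis by (simp only: comp_apply)
  qed
  show "E' = E"
  proof (rule extensionalityI[of _ M])
    fix x assume x: "x \<in> M"
    define d where "d = E' x - E x"
    have dN: "d \<in> N" unfolding d_def by (rule N_diff[OF inN[OF x E'2] inN[OF x E(2)]])
    then have dM: "d \<in> M" using N(1) by blast
    define a where "a = op_adj ?S d"
    have aN: "a \<in> N" unfolding a_def by (rule N_adj[OF dN])
    have "d (a (delta \<one>)) \<one> = E' x (a (delta \<one>)) \<one> - E x (a (delta \<one>)) \<one>"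
      by (simp only: d_def op_diff_apply minus_apply)
    also have "\<dots> = 0"
      by (simp only: pair[OF E'2 E'tr x aN] pair[OF E(2,3) x aN] diff_self)
    finally have "a (d (delta \<one>)) \<one> = 0"
      by (simp only: tau_comm[OF subsetD[OF N(1) aN] dM])
    then have "l2_norm (d (delta \<one>)) = 0"
      unfolding a_def tau_square[OF dM] by simp
    then have "d (delta \<one>) = 0"
      using l2_norm_eq_0 conv_ops_bops[OF dM] bops_l2 by blast
    then have "E' x (delta \<one>) = E x (delta \<one>)"
      by (simp add: d_def op_diff_apply)
    then show "E' x = E x"
      using conv_ops_eqI inN[OF x E'2] inN[OF x E(2)] N(1) by (metis subsetD)
  qed (use E E' in auto)
qed

lemma coset_exp_conditional_expectation:
  assumes L: "subgroup L G"
  shows "conditional_expectation (carrier G) M (conv_ops G L) (restrict (coset_exp G L) M)"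
  unfolding conditional_expectation_def
proof (intro conjI ballI allI impI)
  let ?S = "carrier G" and ?E = "coset_exp G L" and ?E' = "restrict (coset_exp G L) M"
  have sub: "conv_ops G L \<subseteq> M" by (rule conv_ops_subset_M[OF L])
  note E = coset_exp_conv_ops[OF L] and sym = coset_exp_symbol[OF L]
  show "?E' (x + y) = ?E' x + ?E' y" if x: "x \<in> M" and y: "y \<in> M" for x y
  proof -
    have xy: "x + y \<in> M" by (rule M_add[OF x y])
    have "?E (x + y) = ?E x + ?E y"
      by (rule conv_ops_eqI[OF E[OF xy] conv_ops_add[OF L E[OF x] E[OF y]]])
         (simp add: sym[OF xy] sym[OF x] sym[OF y] op_add_apply cutoff_add)
    then show ?thesis using x y xy by simp
  qed
  show "?E' (op_scale c x) = op_scale c (?E' x)" if x: "x \<in> M" for c x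
  proof -
    have cx: "op_scale c x \<in> M" by (rule M_scale[OF x])
    have "?E (op_scale c x) = op_scale c (?E x)"
      by (rule conv_ops_eqI[OF E[OF cx] conv_ops_scale[OF L E[OF x]]])
         (simp add: sym[OF cx] sym[OF x] op_scale_apply cutoff_scale)
    then show ?thesis using x cx by simp
  qed
  show "?E' x \<in> conv_ops G L" if "x \<in> M" for x
    using E[OF that] that by simp
  show "?E' y = y" if y: "y \<in> conv_ops G L" for y
  proof -
    have yM: "y \<in> M" using sub y by blast
    have "?E y = y"
      by (rule conv_ops_eqI[OF E[OF yM] y]) (simp add: sym[OF yM] cutoff_symbol[OF L y])
    then show ?thesis using yM by simp
  qed
  show "op_positive ?S (?E' x)" if "x \<in> M" "op_positive ?S x" for x
    using coset_exp_positive[OF L that] that by simp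
  show "?E' (a \<circ> x \<circ> b) = a \<circ> ?E' x \<circ> b"
    if x: "x \<in> M" and a: "a \<in> conv_ops G L" and b: "b \<in> conv_ops G L" for x a b
  proof -
    have "a \<circ> x \<circ> b \<in> M" by (rule M_comp[OF M_comp[OF subsetD[OF sub a] x] subsetD[OF sub b]])
    then show ?thesis using coset_exp_bimodule[OF L x a b] x by simp
  qed
qed

lemma cond_exp_eq_coset_exp:
  assumes "ICC G" and L: "subgroup L G"
  shows "cond_exp (carrier G) M (conv_ops G L) = restrict (coset_exp G L) M"
proof (rule cond_exp_eqI[OF assms(1)])
  show "restrict (coset_exp G L) M x (delta \<one>) \<one> = x (delta \<one>) \<one>" if "x \<in> M" for x
    using that subgroup.one_closed[OF L] by (simp add: coset_exp_symbol[OF L] cutoff_def)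
qed (use conv_ops_subset_M[OF L] conv_ops_id[OF L] conv_ops_adj[OF L] conv_ops_diff[OF L]
      coset_exp_conditional_expectation[OF L] in auto)

context
  fixes u us
  assumes u: "u \<in> M" and us_def: "us = op_adj (carrier G) u"
    and us_u: "us \<circ> u = op_id (carrier G)" and u_us: "u \<circ> us = op_id (carrier G)"
begin

lemma us_M: "us \<in> M"
  unfolding us_def by (rule M_adj[OF u])

lemma unitary_bops: "u \<in> bounded_ops (carrier G)" "us \<in> bounded_ops (carrier G)"
  using conv_ops_bops[OF u] conv_ops_bops[OF us_M] .

lemma unitary_adj: "op_adj (carrier G) us = u"
  unfolding us_def by (rule adj_adj[OF unitary_bops(1)])

lemma unitary_cancel:
  assumes "z \<in> bounded_ops (carrier G)"
  shows "us \<circ> (u \<circ> z) = z" "u \<circ> (us \<circ> z) = z"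
  using assms us_u u_us by (simp_all add: comp_assoc[symmetric])

lemma unitary_norm:
  assumes "f \<in> l2 (carrier G)"
  shows "l2_norm (u f) = l2_norm f" "l2_norm (us f) = l2_norm f"
  using isometry_norm[OF unitary_bops(1)] isometry_norm[OF unitary_bops(2)] us_u u_us us_def
    unitary_adj assms by simp_all

lemma conj_unitary_M: "x \<in> M \<Longrightarrow> us \<circ> x \<circ> u \<in> M" "x \<in> M \<Longrightarrow> u \<circ> x \<circ> us \<in> M"
  using M_comp u us_M by blast+

lemma conj_unitary_trace:
  assumes x: "x \<in> M"
  shows "(us \<circ> x \<circ> u) (delta \<one>) \<one> = x (delta \<one>) \<one>" "(u \<circ> x \<circ> us) (delta \<one>) \<one> = x (delta \<one>) \<one>"
proof -
  have *: "(b \<circ> x \<circ> a) (delta \<one>) \<one> = x (delta \<one>) \<one>"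
    if "a \<in> M" "b \<in> M" "a \<circ> b = op_id (carrier G)" for a b
  proof -
    have "(b \<circ> x \<circ> a) (delta \<one>) \<one> = x (a (b (delta \<one>))) \<one>"
      using tau_comm[OF that(2) M_comp[OF x that(1)]] by simp
    then show ?thesis using that(3) by (metis comp_apply delta_l2 one_closed op_id_apply)
  qed
  show "(us \<circ> x \<circ> u) (delta \<one>) \<one> = x (delta \<one>) \<one>" by (rule *[OF u us_M u_us])
  show "(u \<circ> x \<circ> us) (delta \<one>) \<one> = x (delta \<one>) \<one>" by (rule *[OF us_M u us_u])
qed

lemma conj_unitary_norm2:
  assumes z: "z \<in> M"
  shows "l2_norm ((u \<circ> z \<circ> us) (delta \<one>)) = l2_norm (z (delta \<one>))"
proof -
  let ?S = "carrier G"
  have zb: "z \<in> bounded_ops ?S" by (rule conv_ops_bops[OF z])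
  have "op_adj ?S (u \<circ> z \<circ> us) = u \<circ> op_adj ?S z \<circ> us"
    using zb unitary_bops unitary_adj us_def by (simp add: adj_comp comp_assoc)
  then have "op_adj ?S (u \<circ> z \<circ> us) \<circ> (u \<circ> z \<circ> us) = u \<circ> (op_adj ?S z \<circ> z) \<circ> us"
    using zb unitary_bops by (simp add: comp_assoc unitary_cancel)
  then have "complex_of_real ((l2_norm ((u \<circ> z \<circ> us) (delta \<one>)))\<^sup>2) = of_real ((l2_norm (z (delta \<one>)))\<^sup>2)"
    using tau_square[OF conj_unitary_M(2)[OF z]] tau_square[OF z]
      conj_unitary_trace(2)[OF M_comp[OF M_adj[OF z] z]] by (metis comp_apply)
  then show ?thesis by (metis of_real_eq_iff power2_eq_imp_eq l2_norm_nonneg)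
qed

text \<open>Conjugation by \<open>u\<close> preserves products, adjoints, positivity and the trace, so it carries the properties
  that characterize the expectation onto \<open>VN(L)\<close> over to the conjugated map.\<close>

lemma cond_exp_conj:
  assumes "ICC G" and L: "subgroup L G"
  shows "cond_exp (carrier G) M ((\<lambda>x. u \<circ> x \<circ> us) ` conv_ops G L)
    = restrict (\<lambda>x. u \<circ> coset_exp G L (us \<circ> x \<circ> u) \<circ> us) M"
proof (rule cond_exp_eqI[OF assms(1)])
  let ?S = "carrier G" and ?A = "conv_ops G L" and ?E = "restrict (coset_exp G L) M"
  let ?B = "(\<lambda>x. u \<circ> x \<circ> us) ` ?A"
  let ?F = "restrict (\<lambda>x. u \<circ> coset_exp G L (us \<circ> x \<circ> u) \<circ> us) M"
  have sub: "?A \<subseteq> M" by (rule conv_ops_subset_M[OF L])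
  have F: "?F x = u \<circ> ?E (us \<circ> x \<circ> u) \<circ> us" if "x \<in> M" for x
    using that conj_unitary_M by simp
  have CE: "conditional_expectation ?S M ?A ?E"
    by (rule coset_exp_conditional_expectation[OF L])
  have EA: "?E x \<in> ?A" if "x \<in> M" for x
    using CE that by (simp add: conditional_expectation_def)
  have Ab: "x \<in> bounded_ops ?S" if "x \<in> ?A" for x by (rule conv_ops_bops[OF that])
  show BM: "?B \<subseteq> M" using sub conj_unitary_M(2) by blast
  show "op_id ?S \<in> ?B"
  proof (rule image_eqI)
    show "op_id ?S = u \<circ> op_id ?S \<circ> us" using unitary_bops u_us by simp
  qed (rule conv_ops_id[OF L])
  show "op_adj ?S x \<in> ?B" if xB: "x \<in> ?B" for x
  proof -
    obtain y where y: "y \<in> ?A" "x = u \<circ> y \<circ> us" using xB by blast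
    have "op_adj ?S x = u \<circ> op_adj ?S y \<circ> us"
      using Ab[OF y(1)] unitary_bops unitary_adj us_def by (simp add: y(2) adj_comp comp_assoc)
    then show ?thesis using conv_ops_adj[OF L y(1)] by blast
  qed
  show "x - y \<in> ?B" if xyB: "x \<in> ?B" "y \<in> ?B" for x y
  proof -
    obtain x' y' where xy: "x' \<in> ?A" "x = u \<circ> x' \<circ> us" "y' \<in> ?A" "y = u \<circ> y' \<circ> us"
      using xyB by blast
    have "x - y = u \<circ> (x' - y') \<circ> us"
      using conj_add_op[of u ?S x' "op_scale (-1) y'" us] conj_scale_op[of u ?S y' "-1" us]
        unitary_bops Ab xy by (simp add: op_diff_eq)
    then show ?thesis using conv_ops_diff[OF L xy(1,3)] by blast
  qed
  show "?F \<in> extensional M" by simp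
  show "?F x (delta \<one>) \<one> = x (delta \<one>) \<one>" if x: "x \<in> M" for x
  proof -
    have "?F x (delta \<one>) \<one> = ?E (us \<circ> x \<circ> u) (delta \<one>) \<one>"
      unfolding F[OF x] using sub EA[OF conj_unitary_M(1)[OF x]] by (intro conj_unitary_trace) auto
    also have "\<dots> = (us \<circ> x \<circ> u) (delta \<one>) \<one>"
      using conj_unitary_M(1)[OF x] subgroup.one_closed[OF L]
      by (simp add: coset_exp_symbol[OF L] cutoff_def)
    also have "\<dots> = x (delta \<one>) \<one>" by (rule conj_unitary_trace[OF x])
    finally show ?thesis .
  qed
  show "conditional_expectation ?S M ?B ?F"
    unfolding conditional_expectation_def
  proof (intro conjI ballI allI impI)
    show "?F (x + y) = ?F x + ?F y" if x: "x \<in> M" and y: "y \<in> M" for x y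
    proof -
      have "us \<circ> (x + y) \<circ> u = (us \<circ> x \<circ> u) + (us \<circ> y \<circ> u)"
        by (rule conj_add_op[OF unitary_bops(2) conv_ops_bops[OF x] conv_ops_bops[OF y]])
      moreover have "?E ((us \<circ> x \<circ> u) + (us \<circ> y \<circ> u)) = ?E (us \<circ> x \<circ> u) + ?E (us \<circ> y \<circ> u)"
        using CE conj_unitary_M(1)[OF x] conj_unitary_M(1)[OF y] unfolding conditional_expectation_def by blast
      ultimately show ?thesis
        unfolding F[OF x] F[OF y] F[OF M_add[OF x y]]
        using conj_add_op[OF unitary_bops(1) Ab[OF EA[OF conj_unitary_M(1)[OF x]]]
            Ab[OF EA[OF conj_unitary_M(1)[OF y]]]] by simp
    qed
    show "?F (op_scale c x) = op_scale c (?F x)" if x: "x \<in> M" for c x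
    proof -
      have "us \<circ> op_scale c x \<circ> u = op_scale c (us \<circ> x \<circ> u)"
        by (rule conj_scale_op[OF unitary_bops(2) conv_ops_bops[OF x]])
      moreover have "?E (op_scale c (us \<circ> x \<circ> u)) = op_scale c (?E (us \<circ> x \<circ> u))"
        using CE conj_unitary_M(1)[OF x] unfolding conditional_expectation_def by blast
      ultimately show ?thesis
        unfolding F[OF x] F[OF M_scale[OF x]]
        using conj_scale_op[OF unitary_bops(1) Ab[OF EA[OF conj_unitary_M(1)[OF x]]]] by simp
    qed
    show "?F x \<in> ?B" if x: "x \<in> M" for x
      unfolding F[OF x] using EA[OF conj_unitary_M(1)[OF x]] by blast
    show "?F y = y" if yB: "y \<in> ?B" for y
    proof -
      obtain z where z: "z \<in> ?A" "y = u \<circ> z \<circ> us" using yB by blast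
      have y: "y \<in> M" using yB BM by blast
      have "us \<circ> y \<circ> u = z"
        using Ab[OF z(1)] unitary_bops us_u by (simp add: z(2) comp_assoc unitary_cancel)
      moreover have "?E z = z"
        using CE z(1) unfolding conditional_expectation_def by blast
      ultimately show ?thesis unfolding F[OF y] by (simp only: z(2))
    qed
    show "op_positive ?S (?F x)" if x: "x \<in> M" and pos: "op_positive ?S x" for x
    proof -
      have "op_positive ?S (us \<circ> x \<circ> u)"
        using op_positive_conj[OF pos unitary_bops(1)] by (simp add: us_def)
      then have "op_positive ?S (?E (us \<circ> x \<circ> u))"
        using CE conj_unitary_M(1)[OF x] unfolding conditional_expectation_def by blast
      from op_positive_conj[OF this unitary_bops(2)] show ?thesis
        unfolding F[OF x] unitary_adj .
    qed
    show "?F (a \<circ> x \<circ> b) = a \<circ> ?F x \<circ> b" if x: "x \<in> M" and a: "a \<in> ?B" and b: "b \<in> ?B" for x a b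
    proof -
      obtain a' where a': "a' \<in> ?A" "a = u \<circ> a' \<circ> us" using a by blast
      obtain b' where b': "b' \<in> ?A" "b = u \<circ> b' \<circ> us" using b by blast
      note [simp] = unitary_bops Ab[OF a'(1)] Ab[OF b'(1)] conv_ops_bops[OF x] unitary_cancel us_u
      have axb: "a \<circ> x \<circ> b \<in> M" by (rule M_comp[OF M_comp[OF subsetD[OF BM a] x] subsetD[OF BM b]])
      have "us \<circ> (a \<circ> x \<circ> b) \<circ> u = a' \<circ> (us \<circ> x \<circ> u) \<circ> b'"
        unfolding a'(2) b'(2) by (simp add: comp_assoc)
      moreover have "?E (a' \<circ> (us \<circ> x \<circ> u) \<circ> b') = a' \<circ> ?E (us \<circ> x \<circ> u) \<circ> b'"
        using CE conj_unitary_M(1)[OF x] a'(1) b'(1) unfolding conditional_expectation_def by blast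
      ultimately have "?F (a \<circ> x \<circ> b) = u \<circ> (a' \<circ> ?E (us \<circ> x \<circ> u) \<circ> b') \<circ> us"
        unfolding F[OF axb] by simp
      also have "\<dots> = a \<circ> ?F x \<circ> b"
      proof -
        define e where "e = ?E (us \<circ> x \<circ> u)"
        have [simp]: "e \<in> bounded_ops ?S"
          unfolding e_def by (rule Ab[OF EA[OF conj_unitary_M(1)[OF x]]])
        show ?thesis
          unfolding F[OF x] a'(2) b'(2) e_def[symmetric] by (simp add: comp_assoc)
      qed
      finally show ?thesis .
    qed
  qed
qed

end

end

section \<open>Strong singularity\<close>

context group
begin

lemma norm_right_regular [simp]:
  "g \<in> carrier G \<Longrightarrow> f \<in> l2 (carrier G) \<Longrightarrow> l2_norm (right_regular G g f) = l2_norm f"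
  unfolding right_regular_def by (intro norm_perm_op bij_right_mult)

lemma op_norm_left_regular_le_1:
  assumes "g \<in> carrier G"
  shows "op_norm (carrier G) (left_regular G g) \<le> 1"
  unfolding op_norm_def
proof (rule cSUP_least)
  have "0 \<in> {f \<in> l2 (carrier G). l2_norm f \<le> 1}" by simp
  then show "{f \<in> l2 (carrier G). l2_norm f \<le> 1} \<noteq> {}" by blast
qed (use assms in auto)

text \<open>For a basis vector \<open>f = \<delta>\<^sub>s\<close> with \<open>s \<notin> L\<close> the square of the norm in question is the mass that the
  symbol of \<open>y\<close> has on the coset \<open>L (ks)\<^sup>-\<^sup>1\<close>.  Along the filter these cosets leave every finite set,
  because \<open>r\<close> belongs to the coset only if \<open>rks\<close> is in \<open>L\<close>.  General \<open>f\<close> follow by density.\<close>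

lemma cutoff_translates_tendsto_0:
  assumes L: "subgroup L G" and ev: "eventually (\<lambda>k. k \<in> L) \<F>"
    and esc: "\<And>r s. r \<in> carrier G \<Longrightarrow> s \<in> carrier G - L \<Longrightarrow> eventually (\<lambda>k. r \<otimes> k \<otimes> s \<notin> L) \<F>"
    and y: "y \<in> M" and y_le: "\<And>f. f \<in> l2 (carrier G) \<Longrightarrow> l2_norm (y f) \<le> l2_norm f"
    and f: "f \<in> l2 (carrier G)" and supp: "\<And>a. a \<in> L \<Longrightarrow> f a = 0"
  shows "((\<lambda>k. l2_norm (cutoff L (y (left_regular G k f)))) \<longlongrightarrow> 0) \<F>"
proof -
  let ?S = "carrier G"
  have yb: "y \<in> bounded_ops ?S" by (rule conv_ops_bops[OF y])
  have LS: "k \<in> ?S" if "k \<in> L" for k using that subgroup.mem_carrier[OF L] by blast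
  have seminorm: "l2_seminorm ?S 1 (\<lambda>f. l2_norm (cutoff L (y (left_regular G k f))))" if "k \<in> L" for k
    unfolding l2_seminorm_def
  proof (intro conjI ballI allI)
    have kb: "left_regular G k \<in> bounded_ops ?S" using LS[OF that] by simp
    fix f assume f: "f \<in> l2 ?S"
    show "0 \<le> l2_norm (cutoff L (y (left_regular G k f)))" by simp
    have "l2_norm (cutoff L (y (left_regular G k f))) \<le> l2_norm (y (left_regular G k f))"
      using yb by (intro l2_norm_cutoff_le[where S = ?S]) auto
    also have "\<dots> \<le> l2_norm f"
      using y_le[of "left_regular G k f"] f kb LS[OF that] by simp
    finally show "l2_norm (cutoff L (y (left_regular G k f))) \<le> 1 * l2_norm f" by simp
    show "l2_norm (cutoff L (y (left_regular G k (f + g))))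
        \<le> l2_norm (cutoff L (y (left_regular G k f))) + l2_norm (cutoff L (y (left_regular G k g)))"
      if g: "g \<in> l2 ?S" for g
      unfolding bops_add[OF kb f g] bops_add[OF yb bops_l2[OF kb] bops_l2[OF kb]] cutoff_add
      using yb by (intro l2_norm_triangle[where S = ?S]) auto
    show "l2_norm (cutoff L (y (left_regular G k (vec_scale c f))))
        \<le> cmod c * l2_norm (cutoff L (y (left_regular G k f)))" for c
      unfolding bops_scale[OF kb f] bops_scale[OF yb bops_l2[OF kb]] cutoff_scale by (simp add: l2_norm_scale)
  qed
  have basis: "((\<lambda>k. l2_norm (cutoff L (y (left_regular G k (delta s))))) \<longlongrightarrow> 0) \<F>"
    if s: "s \<in> ?S - L" for s
  proof (rule tendstoI)
    fix e :: real assume "e > 0"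
    define \<eta> where "\<eta> = y (delta \<one>)"
    have \<eta>: "\<eta> \<in> l2 ?S" using yb by (simp add: \<eta>_def)
    obtain F where F: "finite F" "l2_norm (\<eta> - cutoff F \<eta>) < e"
      using cutoff_finite_approx[OF \<eta> \<open>e > 0\<close>] by blast
    have "eventually (\<lambda>k. \<forall>r\<in>F \<inter> ?S. r \<otimes> k \<otimes> s \<notin> L) \<F>"
      using F(1) esc s by (subst eventually_ball_finite_distrib) auto
    with ev show "eventually (\<lambda>k. dist (l2_norm (cutoff L (y (left_regular G k (delta s))))) 0 < e) \<F>"
    proof (rule eventually_elim2)
      fix k assume kL: "k \<in> L" and esc': "\<forall>r\<in>F \<inter> ?S. r \<otimes> k \<otimes> s \<notin> L"
      have k: "k \<in> ?S" by (rule LS[OF kL])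
      let ?g = "inv (k \<otimes> s)" and ?\<zeta> = "\<eta> - cutoff F \<eta>"
      have g: "?g \<in> ?S" using k s by simp
      have \<zeta>: "?\<zeta> \<in> l2 ?S" using \<eta> by simp
      have "cmod (cutoff L (y (left_regular G k (delta s))) t) \<le> cmod (right_regular G ?g ?\<zeta> t)" for t
      proof (cases "t \<in> L")
        case True
        then have t: "t \<in> ?S" by (rule LS)
        have "y (left_regular G k (delta s)) t = \<eta> (t \<otimes> ?g)"
          using conv_ops_entry[OF y, of "k \<otimes> s" t] k s t by (simp add: \<eta>_def)
        moreover have "t \<otimes> ?g \<notin> F"
        proof
          assume "t \<otimes> ?g \<in> F"
          then have "t \<otimes> ?g \<otimes> k \<otimes> s \<notin> L" using esc' m_closed[OF t g] by blast
          moreover have "t \<otimes> ?g \<otimes> k \<otimes> s = t" using k s t by (simp add: m_assoc)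
          ultimately show False using True by simp
        qed
        ultimately show ?thesis
          using right_regular_apply[OF \<zeta> t] by (simp add: minus_apply cutoff_def)
      qed (simp add: cutoff_outside)
      then have "l2_norm (cutoff L (y (left_regular G k (delta s)))) \<le> l2_norm (right_regular G ?g ?\<zeta>)"
        using right_regular_bops[OF g] by (intro l2_norm_mono[where S = ?S]) auto
      also have "\<dots> < e"
        using F(2) g \<zeta> by simp
      finally show "dist (l2_norm (cutoff L (y (left_regular G k (delta s))))) 0 < e"
        by simp
    qed
  qed
  show ?thesis
  proof (rule seminorms_tendsto_0[where p = "\<lambda>k f. l2_norm (cutoff L (y (left_regular G k f)))"
        and A = "?S - L", OF _ basis f])
    show "eventually (\<lambda>k. l2_seminorm ?S 1 (\<lambda>f. l2_norm (cutoff L (y (left_regular G k f))))) \<F>"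
      using ev by (rule eventually_mono) (rule seminorm)
    show "f a = 0" if "a \<notin> ?S - L" for a
      using that supp l2_outside[OF f] by blast
  qed auto
qed

text \<open>The unitaries \<open>v = \<lambda>(k)\<close> with \<open>k\<close> in \<open>L\<close> witness the required distance in the limit.  Here \<open>\<upsilon>\<close> is the
  symbol of \<open>u\<close>, \<open>a\<close> is the norm of its part on \<open>L\<close>, and \<open>c k\<close> is what the part off \<open>L\<close> contributes to
  the symbol of \<open>u\<^sup>*vu\<close> on \<open>L\<close>.\<close>

lemma conv_ops_strongly_singular:
  assumes icc: "ICC G" and L: "subgroup L G"
    and \<F>: "\<F> \<noteq> bot" and ev: "eventually (\<lambda>k. k \<in> L) \<F>"
    and esc: "\<And>r s. r \<in> carrier G \<Longrightarrow> s \<in> carrier G - L \<Longrightarrow> eventually (\<lambda>k. r \<otimes> k \<otimes> s \<notin> L) \<F>"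
  shows "strongly_singular (carrier G) M (conv_ops G L)"
  unfolding strongly_singular_def
proof (intro conjI ballI impI)
  let ?S = "carrier G" and ?A = "conv_ops G L"
  show "von_neumann_algebra ?S ?A"
    using VN_sub_von_neumann[OF L] VN_sub_eq_conv_ops[OF L] by simp
  show sub: "?A \<subseteq> M" by (rule conv_ops_subset_M[OF L])
  fix u assume u: "u \<in> M" and "op_unitary ?S u"
  define us where "us = op_adj ?S u"
  have us_u: "us \<circ> u = op_id ?S" and u_us: "u \<circ> us = op_id ?S"
    using \<open>op_unitary ?S u\<close> by (auto simp: op_unitary_def us_def)
  note uni = u us_def us_u u_us
  have us: "us \<in> M" by (rule us_M[OF uni])
  note [simp] = unitary_bops[OF uni]
  define \<upsilon> where "\<upsilon> = u (delta \<one>)"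
  define a where "a = l2_norm (cutoff L \<upsilon>)"
  have \<upsilon>: "\<upsilon> \<in> l2 ?S" by (simp add: \<upsilon>_def)
  have n\<upsilon>: "l2_norm \<upsilon> = 1"
    using unitary_norm(1)[OF uni, of "delta \<one>"] by (simp add: \<upsilon>_def)
  \<comment> \<open>Pythagoras for a unit vector\<close>
  have complement: "l2_norm (f - cutoff L f) = sqrt (1 - (l2_norm (cutoff L f))\<^sup>2)"
    if "f \<in> l2 ?S" "l2_norm f = 1" for f
    using l2_norm_sq_split[OF that(1), of L] that(2) by (intro real_sqrt_unique[symmetric]) auto
  let ?EA = "cond_exp ?S M ?A" and ?EB = "cond_exp ?S M ((\<lambda>x. u \<circ> x \<circ> us) ` ?A)"
  have EA: "?EA x = coset_exp G L x" if "x \<in> M" for x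
    using that by (simp add: cond_exp_eq_coset_exp[OF icc L])
  have EB: "?EB x = u \<circ> coset_exp G L (us \<circ> x \<circ> u) \<circ> us" if "x \<in> M" for x
    using that by (simp add: cond_exp_conj[OF uni icc L])
  have E_M: "coset_exp G L x \<in> M" if "x \<in> M" for x
    using coset_exp_conv_ops[OF L that] sub by blast
  have rhs: "trace_norm2 ?S M (u - ?EA u) = sqrt (1 - a\<^sup>2)"
    unfolding EA[OF u]
    by (simp add: trace_norm2_eq[OF icc M_diff[OF u E_M[OF u]]] op_diff_apply
        coset_exp_symbol[OF L u] \<upsilon>_def[symmetric] complement[OF \<upsilon> n\<upsilon>] a_def)
  define c where "c = (\<lambda>k. l2_norm (cutoff L (us (left_regular G k (\<upsilon> - cutoff L \<upsilon>)))))"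
  have "(c \<longlongrightarrow> 0) \<F>"
    unfolding c_def
  proof (rule cutoff_translates_tendsto_0[OF L ev esc us])
    show "l2_norm (us f) \<le> l2_norm f" if "f \<in> l2 ?S" for f
      using unitary_norm(2)[OF uni that] by simp
  qed (use \<upsilon> in \<open>auto simp: minus_apply cutoff_inside\<close>)
  then have lim: "((\<lambda>k. ereal (sqrt (1 - (a + c k)\<^sup>2))) \<longlongrightarrow> ereal (sqrt (1 - (a + 0)\<^sup>2))) \<F>"
    by (intro tendsto_intros)
  \<comment> \<open>the supremum in the norm is tested at \<open>\<lambda>(k)\<close>\<close>
  have bound: "ereal (sqrt (1 - (a + c k)\<^sup>2)) \<le> norm_inf_2 ?S M (?EA - ?EB)" if kL: "k \<in> L" for k
  proof -
    have k: "k \<in> ?S" by (rule subgroup.mem_carrier[OF L kL])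
    let ?v = "left_regular G k"
    have vA: "?v \<in> ?A" by (rule left_regular_conv_ops[OF L kL])
    have v: "?v \<in> M" using vA sub by blast
    note [simp] = left_regular_bops[OF k]
    define w where "w = us \<circ> ?v \<circ> u"
    have w: "w \<in> M" unfolding w_def by (rule conj_unitary_M(1)[OF uni v])
    have wb: "w \<in> bounded_ops ?S" by (rule conv_ops_bops[OF w])
    have Ev: "coset_exp G L ?v = ?v"
      by (rule conv_ops_eqI[OF coset_exp_conv_ops[OF L v] vA])
         (simp only: coset_exp_symbol[OF L v] cutoff_symbol[OF L vA])
    have Eb: "coset_exp G L w \<in> bounded_ops ?S" by (rule conv_ops_bops[OF E_M[OF w]])
    have "u \<circ> (w - coset_exp G L w) \<circ> us
        = (u \<circ> w \<circ> us) - (u \<circ> coset_exp G L w \<circ> us)"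
      using conj_add_op[of u ?S w "op_scale (-1) (coset_exp G L w)" us]
        conj_scale_op[of u ?S "coset_exp G L w" "-1" us] wb Eb by (simp add: op_diff_eq)
    also have "u \<circ> w \<circ> us = ?v"
      by (simp add: w_def comp_assoc u_us unitary_cancel[OF uni])
    finally have "?v - (u \<circ> coset_exp G L w \<circ> us) = u \<circ> (w - coset_exp G L w) \<circ> us"
      by (rule sym)
    moreover have "(?EA - ?EB) ?v = ?v - (u \<circ> coset_exp G L w \<circ> us)"
      by (simp only: minus_apply EA[OF v] EB[OF v] Ev w_def)
    moreover have wE: "w - coset_exp G L w \<in> M" by (rule M_diff[OF w E_M[OF w]])
    ultimately have "trace_norm2 ?S M ((?EA - ?EB) ?v)
        = l2_norm (w (delta \<one>) - cutoff L (w (delta \<one>)))"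
      using trace_norm2_eq[OF icc conj_unitary_M(2)[OF uni wE]] conj_unitary_norm2[OF uni wE]
      by (simp add: op_diff_apply coset_exp_symbol[OF L w])
    also have "\<dots> = sqrt (1 - (l2_norm (cutoff L (w (delta \<one>))))\<^sup>2)"
    proof (rule complement)
      show "w (delta \<one>) \<in> l2 ?S" using wb by simp
      show "l2_norm (w (delta \<one>)) = 1"
        using unitary_norm(2)[OF uni, of "left_regular G k \<upsilon>"] k \<upsilon> n\<upsilon> by (simp add: w_def \<upsilon>_def)
    qed
    finally have val: "trace_norm2 ?S M ((?EA - ?EB) ?v) = sqrt (1 - (l2_norm (cutoff L (w (delta \<one>))))\<^sup>2)" .
    have "l2_norm (cutoff L (w (delta \<one>))) \<le> a + c k"
    proof -
      let ?f = "cutoff L \<upsilon>" and ?h = "\<upsilon> - cutoff L \<upsilon>"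
      have f: "?f \<in> l2 ?S" and h: "?h \<in> l2 ?S" using \<upsilon> by auto
      have "w (delta \<one>) = us (?v (?f + ?h))"
        by (simp add: w_def \<upsilon>_def)
      also have "\<dots> = us (?v ?f) + us (?v ?h)"
        unfolding bops_add[OF left_regular_bops[OF k] f h]
        by (rule bops_add[OF unitary_bops(2)[OF uni]]) simp_all
      finally have "l2_norm (cutoff L (w (delta \<one>)))
          \<le> l2_norm (cutoff L (us (?v ?f))) + c k"
        unfolding c_def by (simp only: cutoff_add) (rule l2_norm_triangle[where S = ?S], simp_all)
      also have "l2_norm (cutoff L (us (?v ?f))) \<le> l2_norm (us (?v ?f))"
        by (rule l2_norm_cutoff_le[where S = ?S]) simp
      also have "\<dots> = a"
        using unitary_norm(2)[OF uni, of "?v ?f"] k f by (simp add: a_def)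
      finally show ?thesis by simp
    qed
    then have "sqrt (1 - (a + c k)\<^sup>2) \<le> trace_norm2 ?S M ((?EA - ?EB) ?v)"
      unfolding val by (intro real_sqrt_le_mono diff_left_mono power_mono) auto
    then have "ereal (sqrt (1 - (a + c k)\<^sup>2)) \<le> ereal (trace_norm2 ?S M ((?EA - ?EB) ?v))"
      by simp
    also have "\<dots> \<le> norm_inf_2 ?S M (?EA - ?EB)"
      unfolding norm_inf_2_def by (rule SUP_upper) (simp add: v op_norm_left_regular_le_1[OF k])
    finally show ?thesis .
  qed
  have "ereal (sqrt (1 - (a + 0)\<^sup>2)) \<le> norm_inf_2 ?S M (?EA - ?EB)"
    by (rule tendsto_le[OF \<F> tendsto_const lim]) (rule eventually_mono[OF ev], rule bound)
  then show "ereal (trace_norm2 ?S M (u - ?EA u))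
      \<le> norm_inf_2 ?S M (?EA - cond_exp ?S M ((\<lambda>x. u \<circ> x \<circ> op_adj ?S u) ` ?A))"
    unfolding rhs us_def[symmetric] by simp
qed

end

section \<open>Semidirect products\<close>

locale semidirect =
  fixes H :: "('h, 'm) monoid_scheme" and K :: "('k, 'n) monoid_scheme" and \<alpha> :: "'k \<Rightarrow> 'h \<Rightarrow> 'h"
  assumes H: "group H" and K: "group K" and \<alpha>: "\<alpha> \<in> hom K (AutoGroup H)"
begin

abbreviation "\<Gamma> \<equiv> semidirect_product H K \<alpha>"

sublocale H: group H by (rule H)
sublocale K: group K by (rule K)

lemma carrier_\<Gamma>: "carrier \<Gamma> = carrier H \<times> carrier K"
  and one_\<Gamma>: "\<one>\<^bsub>\<Gamma>\<^esub> = (\<one>\<^bsub>H\<^esub>, \<one>\<^bsub>K\<^esub>)"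
  and mult_\<Gamma>: "(h, k) \<otimes>\<^bsub>\<Gamma>\<^esub> (h', k') = (h \<otimes>\<^bsub>H\<^esub> \<alpha> k h', k \<otimes>\<^bsub>K\<^esub> k')"
  by (simp_all add: semidirect_product_def)

lemma \<alpha>_auto: "k \<in> carrier K \<Longrightarrow> \<alpha> k \<in> auto H"
  using hom_in_carrier[OF \<alpha>] by (simp add: AutoGroup_def)

lemma \<alpha>_hom: "k \<in> carrier K \<Longrightarrow> group_hom H H (\<alpha> k)"
  using \<alpha>_auto H by (auto simp: auto_def group_hom_def group_hom_axioms_def)

lemma \<alpha>_bij: "k \<in> carrier K \<Longrightarrow> bij_betw (\<alpha> k) (carrier H) (carrier H)"
  using \<alpha>_auto by (auto simp: auto_def Bij_def)

lemma \<alpha>_closed [simp]: "k \<in> carrier K \<Longrightarrow> h \<in> carrier H \<Longrightarrow> \<alpha> k h \<in> carrier H"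
  using \<alpha>_bij bij_betwE by blast

lemma \<alpha>_one [simp]: "k \<in> carrier K \<Longrightarrow> \<alpha> k \<one>\<^bsub>H\<^esub> = \<one>\<^bsub>H\<^esub>"
  by (rule group_hom.hom_one[OF \<alpha>_hom])

lemma \<alpha>_mult: "k \<in> carrier K \<Longrightarrow> h \<in> carrier H \<Longrightarrow> h' \<in> carrier H \<Longrightarrow>
    \<alpha> k (h \<otimes>\<^bsub>H\<^esub> h') = \<alpha> k h \<otimes>\<^bsub>H\<^esub> \<alpha> k h'"
  by (rule group_hom.hom_mult[OF \<alpha>_hom])

lemma \<alpha>_comp:
  assumes k: "k \<in> carrier K" and k': "k' \<in> carrier K" and h: "h \<in> carrier H"
  shows "\<alpha> (k \<otimes>\<^bsub>K\<^esub> k') h = \<alpha> k (\<alpha> k' h)"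
proof -
  have Bij: "\<alpha> k \<in> Bij (carrier H)" "\<alpha> k' \<in> Bij (carrier H)"
    using \<alpha>_auto k k' by (auto simp: auto_def)
  have "\<alpha> (k \<otimes>\<^bsub>K\<^esub> k') = \<alpha> k \<otimes>\<^bsub>AutoGroup H\<^esub> \<alpha> k'"
    by (rule hom_mult[OF \<alpha> k k'])
  also have "\<dots> = compose (carrier H) (\<alpha> k) (\<alpha> k')"
    using Bij by (simp add: AutoGroup_def BijGroup_def)
  finally show ?thesis using h by (simp add: compose_eq)
qed

lemma \<alpha>_K_one [simp]: "h \<in> carrier H \<Longrightarrow> \<alpha> \<one>\<^bsub>K\<^esub> h = h"
proof -
  assume h: "h \<in> carrier H"
  have "\<alpha> \<one>\<^bsub>K\<^esub> (\<alpha> \<one>\<^bsub>K\<^esub> h) = \<alpha> \<one>\<^bsub>K\<^esub> h"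
    using \<alpha>_comp[of "\<one>\<^bsub>K\<^esub>" "\<one>\<^bsub>K\<^esub>" h] h by simp
  then show ?thesis
    using \<alpha>_bij[of "\<one>\<^bsub>K\<^esub>"] h by (meson K.one_closed \<alpha>_closed bij_betw_imp_inj_on inj_onD)
qed

lemma \<alpha>_inj: "k \<in> carrier K \<Longrightarrow> h \<in> carrier H \<Longrightarrow> h' \<in> carrier H \<Longrightarrow> \<alpha> k h = \<alpha> k h' \<longleftrightarrow> h = h'"
  using \<alpha>_bij by (meson bij_betw_imp_inj_on inj_onD)

lemma \<alpha>_inv_cancel [simp]:
  assumes "k \<in> carrier K" "h \<in> carrier H"
  shows "\<alpha> (inv\<^bsub>K\<^esub> k) (\<alpha> k h) = h" "\<alpha> k (\<alpha> (inv\<^bsub>K\<^esub> k) h) = h"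
  using assms by (simp_all add: \<alpha>_comp[symmetric])

lemma \<Gamma>_group: "group \<Gamma>"
proof (rule groupI)
  fix x y z assume "x \<in> carrier \<Gamma>" "y \<in> carrier \<Gamma>" "z \<in> carrier \<Gamma>"
  then show "x \<otimes>\<^bsub>\<Gamma>\<^esub> y \<otimes>\<^bsub>\<Gamma>\<^esub> z = x \<otimes>\<^bsub>\<Gamma>\<^esub> (y \<otimes>\<^bsub>\<Gamma>\<^esub> z)"
    by (auto simp: carrier_\<Gamma> mult_\<Gamma> \<alpha>_mult \<alpha>_comp H.m_assoc K.m_assoc)
next
  fix x assume "x \<in> carrier \<Gamma>"
  then obtain h k where x: "x = (h, k)" "h \<in> carrier H" "k \<in> carrier K" by (auto simp: carrier_\<Gamma>)
  show "\<exists>y\<in>carrier \<Gamma>. y \<otimes>\<^bsub>\<Gamma>\<^esub> x = \<one>\<^bsub>\<Gamma>\<^esub>"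
    using x by (intro bexI[of _ "(inv\<^bsub>H\<^esub> (\<alpha> (inv\<^bsub>K\<^esub> k) h), inv\<^bsub>K\<^esub> k)"])
       (auto simp: carrier_\<Gamma> mult_\<Gamma> one_\<Gamma>)
qed (auto simp: carrier_\<Gamma> mult_\<Gamma> one_\<Gamma>)

sublocale \<Gamma>: group \<Gamma> by (rule \<Gamma>_group)

lemma inv_\<Gamma>:
  assumes "h \<in> carrier H" "k \<in> carrier K"
  shows "inv\<^bsub>\<Gamma>\<^esub> (h, k) = (inv\<^bsub>H\<^esub> (\<alpha> (inv\<^bsub>K\<^esub> k) h), inv\<^bsub>K\<^esub> k)"
  using assms by (intro \<Gamma>.inv_equality) (auto simp: carrier_\<Gamma> mult_\<Gamma> one_\<Gamma>)

lemma K_subgroup: "subgroup ({\<one>\<^bsub>H\<^esub>} \<times> carrier K) \<Gamma>"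
  by (rule \<Gamma>.subgroupI) (auto simp: carrier_\<Gamma> mult_\<Gamma> inv_\<Gamma>)

lemma conjugate_by_K:
  "h \<in> carrier H \<Longrightarrow> k \<in> carrier K \<Longrightarrow> l \<in> carrier K \<Longrightarrow>
    (\<one>\<^bsub>H\<^esub>, l) \<otimes>\<^bsub>\<Gamma>\<^esub> (h, k) \<otimes>\<^bsub>\<Gamma>\<^esub> inv\<^bsub>\<Gamma>\<^esub> (\<one>\<^bsub>H\<^esub>, l) = (\<alpha> l h, l \<otimes>\<^bsub>K\<^esub> k \<otimes>\<^bsub>K\<^esub> inv\<^bsub>K\<^esub> l)"
  by (simp add: inv_\<Gamma> mult_\<Gamma>)

lemma conjugate_by_H:
  "g \<in> carrier H \<Longrightarrow> k \<in> carrier K \<Longrightarrow>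
    (g, \<one>\<^bsub>K\<^esub>) \<otimes>\<^bsub>\<Gamma>\<^esub> (\<one>\<^bsub>H\<^esub>, k) \<otimes>\<^bsub>\<Gamma>\<^esub> inv\<^bsub>\<Gamma>\<^esub> (g, \<one>\<^bsub>K\<^esub>) = (g \<otimes>\<^bsub>H\<^esub> inv\<^bsub>H\<^esub> (\<alpha> k g), k)"
  using group_hom.hom_inv[OF \<alpha>_hom] by (simp add: inv_\<Gamma> mult_\<Gamma>)

context
  assumes free: "\<And>k. k \<in> carrier K \<Longrightarrow> k \<noteq> \<one>\<^bsub>K\<^esub> \<Longrightarrow> {h \<in> carrier H. \<alpha> k h = h} = {\<one>\<^bsub>H\<^esub>}"
begin

text \<open>If \<open>k\<close> and \<open>l\<close> agree at \<open>h\<close>, then \<open>l\<^sup>-\<^sup>1k\<close> fixes \<open>h\<close>.\<close>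

lemma free_inj:
  assumes k: "k \<in> carrier K" and l: "l \<in> carrier K" and h: "h \<in> carrier H" "h \<noteq> \<one>\<^bsub>H\<^esub>"
    and eq: "\<alpha> k h = \<alpha> l h"
  shows "k = l"
proof (rule ccontr)
  assume "k \<noteq> l"
  then have "inv\<^bsub>K\<^esub> l \<otimes>\<^bsub>K\<^esub> k \<noteq> \<one>\<^bsub>K\<^esub>"
    using K.inv_solve_left[OF K.one_closed l k] l by (metis K.r_one)
  moreover have "\<alpha> (inv\<^bsub>K\<^esub> l \<otimes>\<^bsub>K\<^esub> k) h = h"
    using k l h eq by (simp add: \<alpha>_comp)
  ultimately show False
    using free[of "inv\<^bsub>K\<^esub> l \<otimes>\<^bsub>K\<^esub> k"] k l h by blast
qed

text \<open>If \<open>h \<noteq> \<one>\<close>, conjugation by elements of \<open>K\<close> produces different \<open>H\<close>-components.  If \<open>h = \<one>\<close>,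
  conjugation by \<open>g\<close> in \<open>H\<close> produces \<open>g \<alpha>\<^sub>k(g)\<^sup>-\<^sup>1\<close>, and equality of these for \<open>g\<close> and \<open>g'\<close> means
  that \<open>\<alpha> k\<close> fixes \<open>g'\<^sup>-\<^sup>1g\<close>.\<close>

lemma free_imp_ICC:
  assumes "infinite (carrier H)" "infinite (carrier K)"
  shows "ICC \<Gamma>"
  unfolding ICC_def
proof
  fix x assume x: "x \<in> carrier \<Gamma> - {\<one>\<^bsub>\<Gamma>\<^esub>}"
  then obtain h k where hk: "x = (h, k)" "h \<in> carrier H" "k \<in> carrier K" by (auto simp: carrier_\<Gamma>)
  show "infinite (conjugacy_class \<Gamma> x)"
  proof (cases "h = \<one>\<^bsub>H\<^esub>")
    case False
    have "inj_on (\<lambda>l. (\<alpha> l h, l \<otimes>\<^bsub>K\<^esub> k \<otimes>\<^bsub>K\<^esub> inv\<^bsub>K\<^esub> l)) (carrier K)"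
      using free_inj hk False by (auto intro: inj_onI)
    moreover have "(\<lambda>l. (\<alpha> l h, l \<otimes>\<^bsub>K\<^esub> k \<otimes>\<^bsub>K\<^esub> inv\<^bsub>K\<^esub> l)) ` carrier K \<subseteq> conjugacy_class \<Gamma> x"
      unfolding conjugacy_class_def
    proof (intro image_subsetI image_eqI)
      fix l assume "l \<in> carrier K"
      then show "(\<alpha> l h, l \<otimes>\<^bsub>K\<^esub> k \<otimes>\<^bsub>K\<^esub> inv\<^bsub>K\<^esub> l)
          = (\<one>\<^bsub>H\<^esub>, l) \<otimes>\<^bsub>\<Gamma>\<^esub> x \<otimes>\<^bsub>\<Gamma>\<^esub> inv\<^bsub>\<Gamma>\<^esub> (\<one>\<^bsub>H\<^esub>, l)" "(\<one>\<^bsub>H\<^esub>, l) \<in> carrier \<Gamma>"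
        using conjugate_by_K hk by (simp_all add: carrier_\<Gamma>)
    qed
    ultimately show ?thesis
      using assms(2) finite_imageD infinite_super by blast
  next
    case True
    then have k: "k \<noteq> \<one>\<^bsub>K\<^esub>" using x hk by (auto simp: one_\<Gamma>)
    have "inj_on (\<lambda>g. (g \<otimes>\<^bsub>H\<^esub> inv\<^bsub>H\<^esub> (\<alpha> k g), k)) (carrier H)"
    proof (rule inj_onI)
      fix g g' assume g: "g \<in> carrier H" "g' \<in> carrier H"
        and "(g \<otimes>\<^bsub>H\<^esub> inv\<^bsub>H\<^esub> (\<alpha> k g), k) = (g' \<otimes>\<^bsub>H\<^esub> inv\<^bsub>H\<^esub> (\<alpha> k g'), k)"
      then have eq: "g \<otimes>\<^bsub>H\<^esub> inv\<^bsub>H\<^esub> (\<alpha> k g) = g' \<otimes>\<^bsub>H\<^esub> inv\<^bsub>H\<^esub> (\<alpha> k g')" by simp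
      have "inv\<^bsub>H\<^esub> g' \<otimes>\<^bsub>H\<^esub> g = inv\<^bsub>H\<^esub> g' \<otimes>\<^bsub>H\<^esub> (g \<otimes>\<^bsub>H\<^esub> inv\<^bsub>H\<^esub> (\<alpha> k g)) \<otimes>\<^bsub>H\<^esub> \<alpha> k g"
        using g hk by (simp add: H.m_assoc)
      also have "\<dots> = inv\<^bsub>H\<^esub> (\<alpha> k g') \<otimes>\<^bsub>H\<^esub> \<alpha> k g"
        unfolding eq using g hk by (simp add: H.m_assoc[symmetric])
      also have "\<dots> = \<alpha> k (inv\<^bsub>H\<^esub> g' \<otimes>\<^bsub>H\<^esub> g)"
        using g hk group_hom.hom_inv[OF \<alpha>_hom] by (simp add: \<alpha>_mult)
      finally have "\<alpha> k (inv\<^bsub>H\<^esub> g' \<otimes>\<^bsub>H\<^esub> g) = inv\<^bsub>H\<^esub> g' \<otimes>\<^bsub>H\<^esub> g"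
        by (rule sym)
      then have "inv\<^bsub>H\<^esub> g' \<otimes>\<^bsub>H\<^esub> g \<in> {h \<in> carrier H. \<alpha> k h = h}"
        using g by (intro CollectI conjI) simp_all
      then have "inv\<^bsub>H\<^esub> g' \<otimes>\<^bsub>H\<^esub> g = \<one>\<^bsub>H\<^esub>"
        unfolding free[OF hk(3) k] by (rule singletonD)
      then show "g = g'"
        using g H.inv_solve_left[of "\<one>\<^bsub>H\<^esub>" g' g] by simp
    qed
    moreover have "(\<lambda>g. (g \<otimes>\<^bsub>H\<^esub> inv\<^bsub>H\<^esub> (\<alpha> k g), k)) ` carrier H \<subseteq> conjugacy_class \<Gamma> x"
      unfolding conjugacy_class_def
    proof (intro image_subsetI image_eqI)
      fix g assume "g \<in> carrier H"
      then show "(g \<otimes>\<^bsub>H\<^esub> inv\<^bsub>H\<^esub> (\<alpha> k g), k)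
          = (g, \<one>\<^bsub>K\<^esub>) \<otimes>\<^bsub>\<Gamma>\<^esub> x \<otimes>\<^bsub>\<Gamma>\<^esub> inv\<^bsub>\<Gamma>\<^esub> (g, \<one>\<^bsub>K\<^esub>)" "(g, \<one>\<^bsub>K\<^esub>) \<in> carrier \<Gamma>"
        using conjugate_by_H hk True by (simp_all add: carrier_\<Gamma>)
    qed
    ultimately show ?thesis
      using assms(1) finite_imageD infinite_super by blast
  qed
qed

text \<open>For each pair in \<open>F1 \<times> F2\<close> at most one element of \<open>K\<close> is forbidden.\<close>

lemma free_imp_separating:
  assumes "infinite (carrier K)" "finite F1" "finite F2" "F1 \<subseteq> carrier H - {\<one>\<^bsub>H\<^esub>}"
  shows "\<exists>k\<in>carrier K. \<alpha> k ` F1 \<inter> F2 = {}"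
proof -
  define B where "B = (\<lambda>(f1, f2). {k \<in> carrier K. \<alpha> k f1 = f2})"
  have "finite (B z)" if zF: "z \<in> F1 \<times> F2" for z
  proof -
    obtain f1 f2 where z: "z = (f1, f2)" "f1 \<in> carrier H" "f1 \<noteq> \<one>\<^bsub>H\<^esub>"
      using zF subsetD[OF assms(4)] by (cases z) auto
    have "k = l" if "k \<in> B z" "l \<in> B z" for k l
      using that free_inj[OF _ _ z(2,3)] by (simp add: B_def z(1))
    then have "B z \<subseteq> {l}" if "l \<in> B z" for l
      using that by blast
    then show ?thesis
      by (metis ex_in_conv finite.emptyI finite_insert finite_subset)
  qed
  then have "finite (\<Union>z\<in>F1 \<times> F2. B z)" using assms by blast
  then obtain k where "k \<in> carrier K" "k \<notin> (\<Union>z\<in>F1 \<times> F2. B z)"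
    using assms(1) by (meson finite_subset subsetI)
  then show ?thesis by (intro bexI[of _ k]) (auto simp: B_def)
qed

end

text \<open>The filter is chosen so that \<open>\<alpha>\<^sub>k(h) \<noteq> h'\<close> eventually, for all \<open>h, h' \<noteq> \<one>\<close>.  With \<open>r = (h, k)\<close>,
  \<open>z = (\<one>, l)\<close> and \<open>s = (h', k')\<close>, the product \<open>r z s\<close> lies in \<open>K\<close> only if \<open>\<alpha>\<^sub>l(h')\<close> equals the
  element \<open>\<alpha>\<^sub>k\<^sup>-\<^sup>1(h\<^sup>-\<^sup>1)\<close>, which does not depend on \<open>l\<close>.\<close>

lemma separating_filter:
  assumes sep: "\<And>F. finite F \<Longrightarrow> F \<subseteq> carrier H - {\<one>\<^bsub>H\<^esub>} \<Longrightarrow> \<exists>k\<in>carrier K. \<alpha> k ` F \<inter> F = {}"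
  obtains \<F> where "\<F> \<noteq> bot" "eventually (\<lambda>z. z \<in> {\<one>\<^bsub>H\<^esub>} \<times> carrier K) \<F>"
    "\<And>r s. r \<in> carrier \<Gamma> \<Longrightarrow> s \<in> carrier \<Gamma> - {\<one>\<^bsub>H\<^esub>} \<times> carrier K \<Longrightarrow>
       eventually (\<lambda>z. r \<otimes>\<^bsub>\<Gamma>\<^esub> z \<otimes>\<^bsub>\<Gamma>\<^esub> s \<notin> {\<one>\<^bsub>H\<^esub>} \<times> carrier K) \<F>"
proof -
  let ?L = "{\<one>\<^bsub>H\<^esub>} \<times> carrier K"
  define B where "B = (\<lambda>(h, h'). {z \<in> ?L. \<alpha> (snd z) h = h'})"
  define I where "I = (carrier H - {\<one>\<^bsub>H\<^esub>}) \<times> (carrier H - {\<one>\<^bsub>H\<^esub>})"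
  have "\<not> ?L \<subseteq> \<Union>\<C>" if \<C>: "finite \<C>" "\<C> \<subseteq> B ` I" for \<C>
  proof -
    obtain J where J: "finite J" "J \<subseteq> I" "\<C> = B ` J"
      using finite_subset_image[OF \<C>] by blast
    have "\<exists>k\<in>carrier K. \<alpha> k ` (fst ` J \<union> snd ` J) \<inter> (fst ` J \<union> snd ` J) = {}"
      using J by (intro sep) (auto simp: I_def)
    then obtain k where k: "k \<in> carrier K" "\<alpha> k ` (fst ` J \<union> snd ` J) \<inter> (fst ` J \<union> snd ` J) = {}"
      by blast
    have "\<alpha> k h \<noteq> h'" if "(h, h') \<in> J" for h h'
      using k(2) that by (force simp: disjoint_iff)
    then have "(\<one>\<^bsub>H\<^esub>, k) \<notin> \<Union>\<C>"
    proof -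
      have "(\<one>\<^bsub>H\<^esub>, k) \<notin> B j" if "j \<in> J" for j
        using \<open>\<And>h h'. (h, h') \<in> J \<Longrightarrow> \<alpha> k h \<noteq> h'\<close>[of "fst j" "snd j"] that
        by (simp add: B_def split_beta)
      then show ?thesis unfolding J(3) by blast
    qed
    then show ?thesis using k(1) by auto
  qed
  then obtain \<F> where \<F>: "\<F> \<noteq> bot" "eventually (\<lambda>z. z \<in> ?L) \<F>"
      "\<And>C. C \<in> B ` I \<Longrightarrow> eventually (\<lambda>z. z \<notin> C) \<F>"
    using avoiding_filter[of "B ` I" ?L] by blast
  have esc: "eventually (\<lambda>z. \<alpha> (snd z) h \<noteq> h') \<F>"
    if "h \<in> carrier H" "h \<noteq> \<one>\<^bsub>H\<^esub>" "h' \<in> carrier H" for h h'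
  proof (cases "h' = \<one>\<^bsub>H\<^esub>")
    case True
    show ?thesis using \<F>(2)
    proof (rule eventually_mono)
      fix z assume "z \<in> ?L"
      then have z: "snd z \<in> carrier K" by auto
      show "\<alpha> (snd z) h \<noteq> h'"
        using \<alpha>_inj[OF z that(1) H.one_closed] that z True by simp
    qed
  next
    case False
    have "eventually (\<lambda>z. z \<notin> B (h, h')) \<F>"
      using \<F>(3) that False by (auto simp: I_def)
    with \<F>(2) show ?thesis
      by (rule eventually_elim2) (auto simp: B_def)
  qed
  have "eventually (\<lambda>z. r \<otimes>\<^bsub>\<Gamma>\<^esub> z \<otimes>\<^bsub>\<Gamma>\<^esub> s \<notin> ?L) \<F>"
    if r: "r \<in> carrier \<Gamma>" and s: "s \<in> carrier \<Gamma> - ?L" for r s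
  proof -
    obtain h k where hk: "r = (h, k)" "h \<in> carrier H" "k \<in> carrier K"
      using r by (auto simp: carrier_\<Gamma>)
    obtain h' k' where hk': "s = (h', k')" "h' \<in> carrier H" "k' \<in> carrier K" "h' \<noteq> \<one>\<^bsub>H\<^esub>"
      using s by (auto simp: carrier_\<Gamma>)
    let ?g = "\<alpha> (inv\<^bsub>K\<^esub> k) (inv\<^bsub>H\<^esub> h)"
    have "eventually (\<lambda>z. \<alpha> (snd z) h' \<noteq> ?g) \<F>"
      using hk hk' by (intro esc) auto
    with \<F>(2) show ?thesis
    proof (rule eventually_elim2)
      fix z assume z: "z \<in> ?L" and ne: "\<alpha> (snd z) h' \<noteq> ?g"
      obtain l where l: "z = (\<one>\<^bsub>H\<^esub>, l)" "l \<in> carrier K" using z by auto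
      have "h \<otimes>\<^bsub>H\<^esub> \<alpha> k (\<alpha> l h') \<noteq> \<one>\<^bsub>H\<^esub>"
      proof
        assume "h \<otimes>\<^bsub>H\<^esub> \<alpha> k (\<alpha> l h') = \<one>\<^bsub>H\<^esub>"
        then have "\<alpha> k (\<alpha> l h') = inv\<^bsub>H\<^esub> h"
          using hk hk' l H.inv_solve_left[of "\<alpha> k (\<alpha> l h')" h "\<one>\<^bsub>H\<^esub>"] by simp
        then have "\<alpha> l h' = ?g"
          using hk hk' l \<alpha>_inv_cancel(1)[of k "\<alpha> l h'"] by simp
        then show False using ne l by simp
      qed
      then show "r \<otimes>\<^bsub>\<Gamma>\<^esub> z \<otimes>\<^bsub>\<Gamma>\<^esub> s \<notin> ?L"
        using hk hk' l by (simp add: mult_\<Gamma> \<alpha>_comp)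
    qed
  qed
  with \<F> show ?thesis using that by blast
qed

end

theorem theorem2p2:
  fixes H :: "('h, 'm) monoid_scheme"
    and K :: "('k, 'n) monoid_scheme"
    and \<alpha> :: "'k \<Rightarrow> 'h \<Rightarrow> 'h"
  assumes "group H" and "infinite (carrier H)"
    and "group K" and "infinite (carrier K)"
    and "\<alpha> \<in> hom K (AutoGroup H)"
  shows
    "let \<Gamma> = semidirect_product H K \<alpha>;
         i = (\<forall>k \<in> carrier K - {\<one>\<^bsub>K\<^esub>}. {h \<in> carrier H. \<alpha> k h = h} = {\<one>\<^bsub>H\<^esub>});
         ii = (ICC \<Gamma> \<and>
               (\<forall>F1 F2. finite F1 \<and> finite F2 \<and>
                  F1 \<subseteq> carrier H - {\<one>\<^bsub>H\<^esub>} \<and> F2 \<subseteq> carrier H - {\<one>\<^bsub>H\<^esub>} \<longrightarrow>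
                  (\<exists>k \<in> carrier K. \<alpha> k ` F1 \<inter> F2 = {})));
         iii = (ICC \<Gamma> \<and>
               (\<forall>F. finite F \<and> F \<subseteq> carrier H - {\<one>\<^bsub>H\<^esub>} \<longrightarrow>
                  (\<exists>k \<in> carrier K. \<alpha> k ` F \<inter> F = {})));
         iv = (type_II1_factor (carrier \<Gamma>) (VN \<Gamma>) \<and>
               strongly_singular (carrier \<Gamma>) (VN \<Gamma>) (VN_sub \<Gamma> ({\<one>\<^bsub>H\<^esub>} \<times> carrier K)))
     in (i \<longrightarrow> ii) \<and> (ii \<longleftrightarrow> iii) \<and> (iii \<longrightarrow> iv)"
  unfolding Let_def
proof (intro conjI)
  interpret semidirect H K \<alpha>
    using assms(1,3,5) by (rule semidirect.intro)
  let ?i = "\<forall>k \<in> carrier K - {\<one>\<^bsub>K\<^esub>}. {h \<in> carrier H. \<alpha> k h = h} = {\<one>\<^bsub>H\<^esub>}"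
  let ?ii = "ICC \<Gamma> \<and>
               (\<forall>F1 F2. finite F1 \<and> finite F2 \<and>
                  F1 \<subseteq> carrier H - {\<one>\<^bsub>H\<^esub>} \<and> F2 \<subseteq> carrier H - {\<one>\<^bsub>H\<^esub>} \<longrightarrow>
                  (\<exists>k \<in> carrier K. \<alpha> k ` F1 \<inter> F2 = {}))"
  let ?iii = "ICC \<Gamma> \<and>
               (\<forall>F. finite F \<and> F \<subseteq> carrier H - {\<one>\<^bsub>H\<^esub>} \<longrightarrow>
                  (\<exists>k \<in> carrier K. \<alpha> k ` F \<inter> F = {}))"
  let ?iv = "type_II1_factor (carrier \<Gamma>) (VN \<Gamma>) \<and>
               strongly_singular (carrier \<Gamma>) (VN \<Gamma>) (VN_sub \<Gamma> ({\<one>\<^bsub>H\<^esub>} \<times> carrier K))"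
  show "?i \<longrightarrow> ?ii"
  proof
    assume ?i
    then have free: "{h \<in> carrier H. \<alpha> k h = h} = {\<one>\<^bsub>H\<^esub>}" if "k \<in> carrier K" "k \<noteq> \<one>\<^bsub>K\<^esub>" for k
      using that by simp
    show ?ii
      using free_imp_ICC[OF free assms(2,4)] free_imp_separating[OF free assms(4)] by blast
  qed
  show "?ii \<longleftrightarrow> ?iii"
  proof
    assume ?ii then show ?iii by blast
  next
    assume iii: ?iii
    have "\<exists>k\<in>carrier K. \<alpha> k ` F1 \<inter> F2 = {}"
      if F: "finite F1" "finite F2" "F1 \<subseteq> carrier H - {\<one>\<^bsub>H\<^esub>}" "F2 \<subseteq> carrier H - {\<one>\<^bsub>H\<^esub>}" for F1 F2
    proof -
      have "\<exists>k\<in>carrier K. \<alpha> k ` (F1 \<union> F2) \<inter> (F1 \<union> F2) = {}"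
        by (rule conjunct2[OF iii, rule_format]) (use F in simp)
      then show ?thesis by blast
    qed
    note sep = this
    show ?ii
      by (intro conjI allI impI, rule conjunct1[OF iii], rule sep) simp_all
  qed
  show "?iii \<longrightarrow> ?iv"
  proof
    assume iii: ?iii
    obtain \<F> where \<F>: "\<F> \<noteq> bot" "eventually (\<lambda>z. z \<in> {\<one>\<^bsub>H\<^esub>} \<times> carrier K) \<F>"
      "\<And>r s. r \<in> carrier \<Gamma> \<Longrightarrow> s \<in> carrier \<Gamma> - {\<one>\<^bsub>H\<^esub>} \<times> carrier K \<Longrightarrow>
         eventually (\<lambda>z. r \<otimes>\<^bsub>\<Gamma>\<^esub> z \<otimes>\<^bsub>\<Gamma>\<^esub> s \<notin> {\<one>\<^bsub>H\<^esub>} \<times> carrier K) \<F>"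
      using separating_filter iii by metis
    have "infinite (carrier \<Gamma>)"
      using assms(2,4) by (auto simp: carrier_\<Gamma> finite_cartesian_product_iff)
    then show ?iv
      using iii \<Gamma>.ICC_type_II1_factor \<Gamma>.conv_ops_strongly_singular[OF _ K_subgroup \<F>]
      by (simp add: \<Gamma>.VN_eq_conv_ops \<Gamma>.VN_sub_eq_conv_ops[OF K_subgroup])
  qed
qed

end
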